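(* Let $E,F\in\mathcal F_{T,\alpha\beta}$. If there is a size-preserving bijection from the collection of horizontal blocks of $E$ to that of $F$, and the $\alpha\beta$-block of $E$ has the same size as the $\alpha\beta$-block of $F$, then $E$ is bi-Hölder equivalent to $F$ (in particular $E$ and $F$ are homeomorphic): there exist a bijection $f:E\to F$, $s>0$ and $C>0$ with $C^{-1}|x-y|^{1/s}\le|f(x)-f(y)|\le C|x-y|^s$ for all $x,y\in E$. If in addition both $E$ and $F$ have uniform contraction ratio $r$ (all $r_j=r$ in both IFSs), then $E$ and $F$ are Lipschitz equivalent, i.e. such an $f$ exists with $s=1$.
   Context: Let $\Delta\subset\mathbb R^2$ be the triangle with vertices $\omega_\alpha=(0,0)$, $\omega_\beta=(1,0)$, $\omega_\gamma=(1/2,\sqrt3/2)$. A fractal gasket is the attractor $K$ of an IFS $\{\varphi_j(z)=r_j(z+d_j)\}_{j=1}^N$ with $r_j\in(0,1)$, $d_j\in\mathbb R^2$, such that $\bigcup_j\varphi_j(\Delta)\subset\Delta$ and for $i\ne j$, $\varphi_i(\Delta)$ and $\varphi_j(\Delta)$ intersect only at common vertices. With $\Sigma=\{1,\dots,N\}$: $\alpha=-1$ if $(0,0)\notin K$, otherwise $\alpha\in\Sigma$ with $\varphi_\alpha((0,0))=(0,0)$; likewise $\beta=-2$ or $\varphi_\beta$ fixes $(1,0)$; $\gamma=-3$ or $\varphi_\gamma$ fixes $\omega_\gamma$. $K$ satisfies the top isolated condition if $\omega_\gamma\in K$ and $\varphi_\gamma(\Delta)\cap\varphi_j(\Delta)=\emptyset$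 for all $j\neq\gamma$. A horizontal block of $K$ is a set $I=\{i_1,\dots,i_k\}\subset\Sigma$ with $\varphi_{i_j}(\omega_\beta)=\varphi_{i_{j+1}}(\omega_\alpha)$ for $1\le j\le k-1$ which is maximal with this property; $k$ is its size. If $\alpha$ and $\beta$ lie in the same horizontal block, this block is the $\alpha\beta$-block. $\mathcal F_{T,\alpha\beta}$ is the collection of fractal gaskets $K$ such that (i) $K$ satisfies the top isolated condition or $\omega_\gamma\notin K$, and (ii) $\alpha$ and $\beta$ belong to the same horizontal block of $K$. *)

theory Defs
  imports "HOL-Analysis.Analysis"
begin

definition omega_a :: complex where "omega_a = 0"
definition omega_b :: complex where "omega_b = 1"
definition omega_c :: complex where "omega_c = Complex (1/2) (sqrt 3 / 2)"

definition Delta :: "complex set" where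
  "Delta = convex hull {omega_a, omega_b, omega_c}"

definition ifs_map :: "(nat \<Rightarrow> real) \<Rightarrow> (nat \<Rightarrow> complex) \<Rightarrow> nat \<Rightarrow> complex \<Rightarrow> complex" where
  "ifs_map r d j z = complex_of_real (r j) * (z + d j)"

definition attractor :: "nat \<Rightarrow> (nat \<Rightarrow> real) \<Rightarrow> (nat \<Rightarrow> complex) \<Rightarrow> complex set" where
  "attractor N r d = (THE K. K \<noteq> {} \<and> compact K \<and> K = (\<Union>j\<in>{1..N}. ifs_map r d j ` K))"

definition fractal_gasket :: "nat \<Rightarrow> (nat \<Rightarrow> real) \<Rightarrow> (nat \<Rightarrow> complex) \<Rightarrow> bool" where
  "fractal_gasket N r d \<longleftrightarrow>
     N \<ge> 1 \<and>
     (\<forall>j\<in>{1..N}. 0 < r j \<and> r j < 1) \<and>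
     (\<Union>j\<in>{1..N}. ifs_map r d j ` Delta) \<subseteq> Delta \<and>
     (\<forall>i\<in>{1..N}. \<forall>j\<in>{1..N}. i \<noteq> j \<longrightarrow>
        ifs_map r d i ` Delta \<inter> ifs_map r d j ` Delta \<subseteq>
        ifs_map r d i ` {omega_a, omega_b, omega_c} \<inter> ifs_map r d j ` {omega_a, omega_b, omega_c})"

definition top_isolated :: "nat \<Rightarrow> (nat \<Rightarrow> real) \<Rightarrow> (nat \<Rightarrow> complex) \<Rightarrow> bool" where
  "top_isolated N r d \<longleftrightarrow>
     omega_c \<in> attractor N r d \<and>
     (\<exists>c\<in>{1..N}. ifs_map r d c omega_c = omega_c \<and>
        (\<forall>j\<in>{1..N}. j \<noteq> c \<longrightarrow> ifs_map r d c ` Delta \<inter> ifs_map r d j ` Delta = {}))"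

definition hchain :: "nat \<Rightarrow> (nat \<Rightarrow> real) \<Rightarrow> (nat \<Rightarrow> complex) \<Rightarrow> nat list \<Rightarrow> bool" where
  "hchain N r d l \<longleftrightarrow> l \<noteq> [] \<and> distinct l \<and> set l \<subseteq> {1..N} \<and>
     (\<forall>j. Suc j < length l \<longrightarrow> ifs_map r d (l ! j) omega_b = ifs_map r d (l ! Suc j) omega_a)"

definition hblock :: "nat \<Rightarrow> (nat \<Rightarrow> real) \<Rightarrow> (nat \<Rightarrow> complex) \<Rightarrow> nat set \<Rightarrow> bool" where
  "hblock N r d I \<longleftrightarrow> (\<exists>l. hchain N r d l \<and> set l = I) \<and>
     (\<forall>l. hchain N r d l \<and> I \<subseteq> set l \<longrightarrow> set l = I)"

definition hblocks :: "nat \<Rightarrow> (nat \<Rightarrow> real) \<Rightarrow> (nat \<Rightarrow> complex) \<Rightarrow> nat set set" where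
  "hblocks N r d = {I. hblock N r d I}"

definition ab_block :: "nat \<Rightarrow> (nat \<Rightarrow> real) \<Rightarrow> (nat \<Rightarrow> complex) \<Rightarrow> nat set \<Rightarrow> bool" where
  "ab_block N r d I \<longleftrightarrow> hblock N r d I \<and>
     (\<exists>a\<in>{1..N}. \<exists>b\<in>{1..N}. ifs_map r d a omega_a = omega_a \<and>
        ifs_map r d b omega_b = omega_b \<and> a \<in> I \<and> b \<in> I)"

definition in_FTab :: "nat \<Rightarrow> (nat \<Rightarrow> real) \<Rightarrow> (nat \<Rightarrow> complex) \<Rightarrow> bool" where
  "in_FTab N r d \<longleftrightarrow> fractal_gasket N r d \<and>
     (top_isolated N r d \<or> omega_c \<notin> attractor N r d) \<and>
     (\<exists>I. ab_block N r d I)"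

end

(* A point of a gasket is addressed by an infinite word over the cells, and two points are about as
close as n-th level cells when their words agree up to n or run into the two sides of a common
vertex of two cells. If only horizontal contacts x k \<beta>\<beta>\<beta>... ~ x k' \<alpha>\<alpha>\<alpha>... occur, this closeness is
determined by the block structure together with the ends \<alpha>, \<beta> of the \<alpha>\<beta>-block, so a bijection of
the letters that respects the blocks gives the required map.

The remaining contacts, where the top of a cell i touches a base corner a of a cell j, are removed
by a "hotel" trick. Since the top cell \<gamma> is isolated, the cell i near its top is a sequence of
clopen pieces i \<gamma>^m converging to the contact point, and so are the pieces j a^m \<delta> \<gamma>, where \<delta> is
the highest cell that serves as a target j. Shifting the latter along the sequence makes room for
the top point of i. On words this is the level preserving substitution
  i \<gamma>^3 -> j a \<delta> \<gamma>,   j a^m \<delta> \<gamma> \<gamma> -> j a^(m+1) \<delta> \<gamma>,   j a^m \<delta> \<gamma> k -> i \<gamma>^(m+2) k   (k \<noteq> \<gamma>, m \<ge> 1),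
which changes the closeness of words by at most a constant number of levels. *)

theory Submission
  imports Defs "HOL-Library.Stream"
begin

section \<open>Infinite words\<close>

text \<open>The two gaskets are not compared directly. Each is parametrised by a model: all words
  over its letters, with closeness measured by horizontal contacts alone. The substitution leads
  from words of the model to addresses of points, so vertical contacts, absent in the model,
  reappear in the image. Sizes of cells of level \<open>n\<close> are controlled only by
  \<open>lo ^ n\<close> and \<open>hi ^ n\<close>. As both sides of a rule have equal length, the
  bounded loss of levels costs a constant factor and leaves the exponent
  \<open>ln hi / ln lo\<close> alone; this exponent is 1 for a uniform ratio. The obstacle is that
  the shifted pieces have to be isolated. A cell \<open>de ga\<close> could be touched only at the
  top of \<open>de\<close>. If \<open>de\<close> were a source, its top would be a base corner of a
  target with a still higher top; so the highest target is no source and its top is free. The given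
  bijection of blocks need not send one \<alpha>\<beta>-block to the other. Their equal size allows
  two of its values to be exchanged. After that the corner cells correspond by themselves, being the
  first and last letters of their blocks.\<close>

primrec run :: "'a \<Rightarrow> nat \<Rightarrow> 'a stream \<Rightarrow> bool" where
  "run a 0 w \<longleftrightarrow> True"
| "run a (Suc n) w \<longleftrightarrow> shd w = a \<and> run a n (stl w)"

text \<open>\<open>Q k a k' b\<close> stands for a contact of the cells \<open>k\<close> and \<open>k'\<close> at the points with addresses
  \<open>k a a a \<dots>\<close> and \<open>k' b b b \<dots>\<close>. Two words are near at depth \<open>n\<close> if the cells of level \<open>n\<close> that
  they determine coincide or touch.\<close>

primrec near :: "('a \<Rightarrow> 'a \<Rightarrow> 'a \<Rightarrow> 'a \<Rightarrow> bool) \<Rightarrow> nat \<Rightarrow> 'a stream \<Rightarrow> 'a stream \<Rightarrow> bool" where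
  "near Q 0 w v \<longleftrightarrow> True"
| "near Q (Suc n) w v \<longleftrightarrow>
     (if shd w = shd v then near Q n (stl w) (stl v)
      else \<exists>a b. Q (shd w) a (shd v) b \<and> run a n (stl w) \<and> run b n (stl v))"

lemma run_mono: "run a n w \<Longrightarrow> m \<le> n \<Longrightarrow> run a m w"
proof (induction m arbitrary: n w)
  case (Suc m) then show ?case by (cases n) auto
qed simp

lemma run_replicate: "run a n (replicate m a @- w) \<longleftrightarrow> run a (n - m) w"
proof (induction m arbitrary: n)
  case (Suc m) then show ?case by (cases n) auto
qed simp

lemma run_replicate_le: "n \<le> m \<Longrightarrow> run a n (replicate m a @- w)"
  by (simp add: run_replicate)

lemma run_sconst: "(\<And>n. run a n w) \<Longrightarrow> w = sconst a"
proof (coinduction arbitrary: w)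
  case Eq_stream
  then have "run a (Suc n) w" for n by blast
  then show ?case by simp
qed

lemma run_sconst_self: "run a n (sconst a)"
  by (induction n) auto

lemma run_eq_replicate: "run a n w \<Longrightarrow> \<exists>y. w = replicate n a @- y"
proof (induction n arbitrary: w)
  case (Suc n)
  then obtain y where "stl w = replicate n a @- y" by auto
  then show ?case using Suc.prems by (intro exI[of _ y]) (metis replicate_Suc run.simps(2) shift.simps(2) stream.collapse)
qed simp

lemma sconst_or_run:
  assumes "w \<noteq> sconst a" shows "\<exists>n y. w = replicate n a @- y \<and> shd y \<noteq> a"
proof -
  obtain n where "\<not> run a n w" using run_sconst[of a w] assms by auto
  then show ?thesis
  proof (induction n arbitrary: w)
    case (Suc n)
    show ?case
    proof (cases "shd w = a")
      case True
      then have "\<not> run a n (stl w)" using Suc.prems by simp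
      from Suc.IH[OF this] obtain n y where y: "stl w = replicate n a @- y" "shd y \<noteq> a" by blast
      have "w = a ## stl w" using True by (metis stream.collapse)
      then have "w = replicate (Suc n) a @- y" using y by (metis replicate_Suc shift.simps(2))
      then show ?thesis using y by blast
    next
      case False then show ?thesis by (intro exI[of _ 0] exI[of _ w]) simp
    qed
  qed simp
qed

text \<open>Iterating a chosen step and concatenating the emitted factors with \<open>flat\<close>
  defines a transducer on words; \<open>q \<noteq> []\<close> keeps it productive. The same
  principle yields the substitution, its inverse and addresses of points.\<close>

lemma stream_unfold:
  assumes "\<And>w. w \<in> I \<Longrightarrow> \<exists>q y. P w q y \<and> y \<in> I \<and> q \<noteq> []"
  shows "\<exists>h. \<forall>w\<in>I. \<exists>q y. P w q y \<and> y \<in> I \<and> h w = q @- h y"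
proof -
  from assms have "\<forall>w\<in>I. \<exists>qy. P w (fst qy) (snd qy) \<and> snd qy \<in> I \<and> fst qy \<noteq> []" by fastforce
  from bchoice[OF this] obtain f where
    f: "\<And>w. w \<in> I \<Longrightarrow> P w (fst (f w)) (snd (f w)) \<and> snd (f w) \<in> I \<and> fst (f w) \<noteq> []"
    by blast
  define h where "h w = flat (smap (fst \<circ> f) (siterate (snd \<circ> f) w))" for w
  have "h w = fst (f w) @- h (snd (f w))" if "w \<in> I" for w
    unfolding h_def using f[OF that] by (subst flat_unfold) auto
  then show ?thesis using f by blast
qed

lemma near_run:
  "run a n w \<Longrightarrow> run a n v \<Longrightarrow> near Q n w v"
proof (induction n arbitrary: w v)
qed auto

lemma near_refl: "near Q n w w"
  by (induction n arbitrary: w) auto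

lemma near_mono: "near Q n w v \<Longrightarrow> m \<le> n \<Longrightarrow> near Q m w v"
proof (induction m arbitrary: n w v)
  case (Suc m)
  then obtain n' where n': "n = Suc n'" "m \<le> n'" by (cases n) auto
  show ?case
  proof (cases "shd w = shd v")
    case True then show ?thesis using Suc n' by simp
  next
    case False
    then obtain a b where ab: "Q (shd w) a (shd v) b" "run a n' (stl w)" "run b n' (stl v)"
      using Suc.prems(1) unfolding n'(1) near.simps by auto
    have "run a m (stl w)" by (rule run_mono[OF ab(2) n'(2)])
    moreover have "run b m (stl v)" by (rule run_mono[OF ab(3) n'(2)])
    ultimately show ?thesis using False ab(1) by auto
  qed
qed simp

lemma near_weaken:
  assumes "\<And>k a k' b. Q k a k' b \<Longrightarrow> Q' k a k' b" "near Q n w v"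
  shows "near Q' n w v"
  using assms(2)
proof (induction n arbitrary: w v)
  case (Suc n) then show ?case using assms(1) by (auto split: if_splits) blast
qed simp

lemma near_sym:
  assumes "\<And>k a k' b. Q k a k' b \<Longrightarrow> Q k' b k a" "near Q n w v"
  shows "near Q n v w"
  using assms(2)
proof (induction n arbitrary: w v)
  case (Suc n) then show ?case using assms(1) by (auto split: if_splits) blast
qed simp

lemma near_shift: "near Q n (p @- w) (p @- v) \<longleftrightarrow> near Q (n - length p) w v"
proof (induction p arbitrary: n)
  case (Cons x p) then show ?case by (cases n) auto
qed simp

lemma near_cong_streams:
  assumes "\<And>k a k' b. k \<in> A \<Longrightarrow> k' \<in> A \<Longrightarrow> k \<noteq> k' \<Longrightarrow> Q k a k' b \<longleftrightarrow> Q' k a k' b"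
    "w \<in> streams A" "v \<in> streams A"
  shows "near Q n w v \<longleftrightarrow> near Q' n w v"
  using assms(2,3)
proof (induction n arbitrary: w v)
  case (Suc n) then show ?case using assms(1)
    by (auto simp: streams_shd streams_stl)
qed simp

section \<open>Contacts and germs at corners of cells\<close>

text \<open>Says that \<open>w\<close> lies in the cell of level \<open>Suc n\<close> that sits in
  the cell \<open>k\<close> at its corner \<open>pt k a\<close>.\<close>

definition germ :: "'a \<Rightarrow> 'a \<Rightarrow> nat \<Rightarrow> 'a stream \<Rightarrow> bool" where
  "germ k a n w \<longleftrightarrow> shd w = k \<and> run a n (stl w)"

text \<open>Contacts are recorded through the common point, so a germ may change its cell and letter
  as long as the point stays. The set \<open>S\<close> selects the corners that count.\<close>

definition contact :: "('a \<Rightarrow> 'a \<Rightarrow> 'p) \<Rightarrow> 'a set \<Rightarrow> 'a \<Rightarrow> 'a \<Rightarrow> 'a \<Rightarrow> 'a \<Rightarrow> bool" where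
  "contact pt S k a k' b \<longleftrightarrow> a \<in> S \<and> b \<in> S \<and> pt k a = pt k' b"

lemma contact_sym: "contact pt S k a k' b \<Longrightarrow> contact pt S k' b k a"
  by (auto simp: contact_def)

lemma near_contact_sym: "near (contact pt S) n w v \<Longrightarrow> near (contact pt S) n v w"
  by (rule near_sym[of "contact pt S"]) (auto intro: contact_sym)

section \<open>The substitution on words\<close>

text \<open>\<open>al\<close>, \<open>be\<close>, \<open>ga\<close> are the letters of the cells at the left, right and top corner, \<open>pt k a\<close> is the
  corresponding corner of the cell \<open>k\<close>, and \<open>tgt i = Some (j, a)\<close> chooses a base corner \<open>pt j a\<close>
  touched by the top of the cell \<open>i\<close>.\<close>

locale hotel =
  fixes A :: "'a set" and al be ga de :: 'a and pt :: "'a \<Rightarrow> 'a \<Rightarrow> 'p"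
    and tgt :: "'a \<Rightarrow> ('a \<times> 'a) option"
  assumes letters: "al \<in> A" "be \<in> A" "ga \<in> A" "de \<in> A"
    and distinct: "al \<noteq> be" "al \<noteq> ga" "be \<noteq> ga" "de \<notin> {al, be, ga}"
    and pt_inj: "\<And>k a b. k \<in> A \<Longrightarrow> a \<in> {al, be, ga} \<Longrightarrow> b \<in> {al, be, ga} \<Longrightarrow> pt k a = pt k b \<Longrightarrow> a = b"
    and pt_same: "\<And>k k' a. k \<in> A \<Longrightarrow> k' \<in> A \<Longrightarrow> a \<in> {al, be, ga} \<Longrightarrow> pt k a = pt k' a \<Longrightarrow> k = k'"
    and top_free: "\<And>k a b. k \<in> A \<Longrightarrow> a \<in> {al, be, ga} \<Longrightarrow> b \<in> {al, be, ga} \<Longrightarrow> pt ga a = pt k b \<Longrightarrow> k = ga"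
    and corner_free: "\<And>k a b. k \<in> A \<Longrightarrow> a \<in> {al, be} \<Longrightarrow> b \<in> {al, be, ga} \<Longrightarrow> pt a a = pt k b \<Longrightarrow> k = a"
    and tgt: "\<And>i j a. tgt i = Some (j, a) \<Longrightarrow> i \<in> A \<and> j \<in> A \<and> i \<noteq> j \<and> a \<in> {al, be} \<and> pt i ga = pt j a"
    and tgt_notin: "\<And>i j a. tgt i = Some (j, a) \<Longrightarrow> j \<notin> {al, be, ga}"
    and tgt_dom: "\<And>i j a. i \<in> A \<Longrightarrow> j \<in> A \<Longrightarrow> i \<noteq> j \<Longrightarrow> a \<in> {al, be} \<Longrightarrow> pt i ga = pt j a \<Longrightarrow> tgt i \<noteq> None"
    and de_tgt: "tgt de = None"
begin

text \<open>\<open>Q2\<close> measures closeness of source words, \<open>Q3\<close> closeness of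
  their images: only in the image do tops of cells take part in contacts.\<close>

abbreviation "Q2 \<equiv> contact pt {al, be}"
abbreviation "Q3 \<equiv> contact pt {al, be, ga}"

lemma tgt_ne_ga: "tgt i = Some (j, a) \<Longrightarrow> i \<noteq> ga"
  using tgt[of i j a] top_free[of j ga a] by auto

lemma tgt_facts:
  assumes "tgt i = Some (j, a)"
  shows "i \<in> A" "j \<in> A" "i \<noteq> j" "a = al \<or> a = be" "pt i ga = pt j a" "j \<noteq> al" "j \<noteq> be" "j \<noteq> ga"
    "i \<noteq> ga" "i \<noteq> de" "a \<noteq> ga" "a \<noteq> de" "j \<noteq> a" "a \<in> A"
  using tgt[OF assms] tgt_notin[OF assms] tgt_ne_ga[OF assms] de_tgt assms distinct letters by auto

lemma tgt_inj: "tgt i = Some (j, a) \<Longrightarrow> tgt i' = Some (j, a) \<Longrightarrow> i = i'"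
  using tgt[of i j a] tgt[of i' j a] pt_same[of i i' ga] by auto

text \<open>These prefixes cover the left sides of the three nontrivial rules, so a word that is not
  special has its first letter copied.\<close>

definition special :: "'a stream \<Rightarrow> bool" where
  "special w \<longleftrightarrow> (\<exists>i j a y. tgt i = Some (j, a) \<and> w = [i, ga, ga, ga] @- y) \<or>
     (\<exists>i j a m y. tgt i = Some (j, a) \<and> w = j ## replicate (Suc m) a @- de ## ga ## y)"

text \<open>The substitution on factors; the third argument is the rest of the word, which serves as
  look-ahead.\<close>

inductive fac :: "'a list \<Rightarrow> 'a list \<Rightarrow> 'a stream \<Rightarrow> bool" where
  plain: "k \<in> A \<Longrightarrow> \<not> special (k ## y) \<Longrightarrow> fac [k] [k] y"
| check_in: "tgt i = Some (j, a) \<Longrightarrow> fac [i, ga, ga, ga] [j, a, de, ga] y"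
| move_on: "tgt i = Some (j, a) \<Longrightarrow>
    fac (j # replicate (Suc m) a @ [de, ga, ga]) (j # replicate (Suc (Suc m)) a @ [de, ga]) y"
| check_out: "tgt i = Some (j, a) \<Longrightarrow> shd y \<noteq> ga \<Longrightarrow>
    fac (j # replicate (Suc m) a @ [de, ga]) (i # replicate (Suc (Suc (Suc m))) ga) y"

text \<open>A relation rather than a function, because it is produced from both ends, by parsing a
  source word or by parsing an image, and in both cases it is established by coinduction.\<close>

coinductive Rel :: "'a stream \<Rightarrow> 'a stream \<Rightarrow> bool" where
  "fac p q y \<Longrightarrow> Rel y z \<Longrightarrow> Rel (p @- y) (q @- z)"

lemma fac_nonempty: "fac p q y \<Longrightarrow> p \<noteq> [] \<and> q \<noteq> []"
  by (auto elim: fac.cases)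

text \<open>The numbers of letters \<open>ga\<close> in the rules are chosen for this: the lengths
  are 1, 4, \<open>m + 5\<close> and \<open>m + 4\<close> on both sides. Removing a common factor
  therefore lowers the depth equally for words and images.\<close>

lemma fac_length: "fac p q y \<Longrightarrow> length p = length q"
  by (auto elim: fac.cases)

lemma fac_set: "fac p q y \<Longrightarrow> set p \<subseteq> A \<and> set q \<subseteq> A"
  by (auto elim!: fac.cases dest: tgt_facts simp: letters split: if_splits)

lemma Rel_streams:
  assumes "Rel w v"
  shows "w \<in> streams A" "v \<in> streams A"
proof -
  have "w !! n \<in> A \<and> v !! n \<in> A" for n
    using assms
  proof (induction n arbitrary: w v rule: less_induct)
    case (less n)
    from less.prems obtain p q y z where *: "w = p @- y" "v = q @- z" "fac p q y" "Rel y z"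
      by (auto elim: Rel.cases)
    note f = fac_nonempty[OF *(3)] fac_length[OF *(3)] fac_set[OF *(3)]
    show ?case
    proof (cases "n < length p")
      case True
      then show ?thesis using f * by (metis nth_mem shift_snth_less subsetD)
    next
      case False
      then have "n - length p < n" using f by (cases p) auto
      from less.IH[OF this *(4)] show ?thesis using False f * by simp
    qed
  qed
  then show "w \<in> streams A" "v \<in> streams A" by (auto simp: streams_iff_snth)
qed

lemma Rel_cases [consumes 1, case_names plain check_in move_on check_out]:
  assumes "Rel w v"
  obtains (plain) k y z where "w = k ## y" "v = k ## z" "Rel y z" "k \<in> A" "\<not> special w"
  | (check_in) i j a y z where "tgt i = Some (j, a)" "w = i ## ga ## ga ## ga ## y"
      "v = j ## replicate (Suc 0) a @- de ## ga ## z" "Rel y z"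
  | (move_on) i j a m y z where "tgt i = Some (j, a)" "w = j ## replicate (Suc m) a @- de ## ga ## ga ## y"
      "v = j ## replicate (Suc (Suc m)) a @- de ## ga ## z" "Rel y z"
  | (check_out) i j a m y z where "tgt i = Some (j, a)" "w = j ## replicate (Suc m) a @- de ## ga ## y"
      "v = i ## replicate (Suc (Suc (Suc m))) ga @- z" "Rel y z" "shd y \<noteq> ga"
  using assms
proof cases
  case (1 p q y z)
  from 1(3) show ?thesis
  proof cases
    case (plain k) then show ?thesis using 1 that(1)[of k y z] by auto
  next
    case (check_in i j a) then show ?thesis using 1 that(2)[of i j a y z] by auto
  next
    case (move_on i j a m) then show ?thesis using 1 that(3)[of i j a m y z] by (auto simp del: replicate.simps)
  next
    case (check_out i j a m) then show ?thesis using 1 that(4)[of i j a m y z] by (auto simp del: replicate.simps)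
  qed
qed

section \<open>Runs, blocks and germs under the substitution\<close>

text \<open>Neither sources nor targets equal \<open>ga\<close>, so only a copied factor can start
  with \<open>ga\<close>. This makes the look-ahead of \<open>check_out\<close> visible in the
  image.\<close>

lemma Rel_shd_ga:
  assumes "Rel w v"
  shows "shd w = ga \<longleftrightarrow> shd v = ga"
  using assms by (cases rule: Rel_cases) (auto dest: tgt_facts)

lemma Rel_run_ga:
  assumes "Rel w v"
  shows "run ga n w \<longleftrightarrow> run ga n v"
  using assms
proof (induction n arbitrary: w v)
  case (Suc n)
  show ?case using Suc.prems
  proof (cases rule: Rel_cases)
    case (plain k y z) then show ?thesis using Suc.IH by simp
  qed (auto dest: tgt_facts)
qed simp

text \<open>One level is lost because \<open>al\<close> or \<open>be\<close> may itself be a source: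
  the last letter of the run can open a factor \<open>i ga ga ga\<close>. Targets avoid the base
  letters, so no other factor interferes.\<close>

lemma Rel_run:
  assumes "Rel w v" "a \<in> {al, be}" "run a n w"
  shows "run a (n - 1) v"
  using assms
proof (induction n arbitrary: w v)
  case (Suc n)
  show ?case using Suc.prems(1)
  proof (cases rule: Rel_cases)
    case (plain k y z) then show ?thesis using Suc by (cases n) auto
  next
    case check_in then show ?thesis using Suc.prems distinct by (cases n) auto
  qed (use Suc.prems in \<open>auto dest: tgt_facts\<close>)
qed simp

text \<open>Here the loss is due to \<open>check_out\<close>, whose image starts with a source,
  possibly a base letter.\<close>

lemma Rel_run_inv:
  assumes "Rel w v" "a \<in> {al, be}" "run a n v"
  shows "run a (n - 1) w"
  using assms
proof (induction n arbitrary: w v)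
  case (Suc n)
  show ?case using Suc.prems(1)
  proof (cases rule: Rel_cases)
    case (plain k y z) then show ?thesis using Suc by (cases n) auto
  next
    case check_out then show ?thesis using Suc.prems distinct by (cases n) auto
  qed (use Suc.prems in \<open>auto dest: tgt_facts\<close>)
qed simp

text \<open>No image of a nontrivial factor can begin inside the prefix: \<open>a\<close> is not a
  target, and as a source it would be followed by \<open>ga\<close>; \<open>de\<close> is not a
  source, and as a target it would be followed by a base letter.\<close>

lemma Rel_block:
  assumes "Rel w v" "a \<in> {al, be}" "v = replicate m a @- de ## ga ## z"
  shows "\<exists>z'. w = replicate m a @- de ## ga ## z'"
  using assms
proof (induction m arbitrary: w v)
  case 0
  show ?case using 0(1)
  proof (cases rule: Rel_cases)
    case (plain k y z')
    then have "shd y = ga" using 0 Rel_shd_ga[of y z'] by auto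
    then have "y = ga ## stl y" by (metis stream.collapse)
    then show ?thesis using plain 0 by (intro exI[of _ "stl y"]) auto
  qed (use 0 in \<open>auto dest: tgt_facts\<close>)
next
  case (Suc m)
  show ?case using Suc.prems(1)
  proof (cases rule: Rel_cases)
    case (plain k y z') then show ?thesis using Suc by auto
  next
    case (check_out i j b m' y z')
    then show ?thesis using Suc.prems distinct by (cases m) auto
  qed (use Suc.prems in \<open>auto dest: tgt_facts\<close>)
qed

lemma run_block_le: "run e n (replicate m a @- x ## y) \<Longrightarrow> x \<noteq> e \<Longrightarrow> n \<le> m \<and> (0 < n \<longrightarrow> e = a)"
proof (induction m arbitrary: n)
  case 0 then show ?case by (cases n) auto
next
  case (Suc m) 
  then show ?case by (cases n) auto
qed

lemma block_eq:
  assumes "replicate m a @- x ## y = replicate m' a @- x ## y'" "x \<noteq> a"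
  shows "m = m' \<and> y = y'"
  using assms
proof (induction m arbitrary: m')
  case 0 then show ?case by (cases m') auto
next
  case (Suc m) then show ?case by (cases m') auto
qed

text \<open>The rule \<open>check_out\<close> turns a germ at \<open>(j, a)\<close> into one at
  \<open>(i, ga)\<close>. Both name the same point, so the conclusion preserves the point and not
  the letters.\<close>

lemma Rel_germ:
  assumes "Rel w v" "k \<in> A" "e \<in> {al, be}" "n \<ge> 1" "germ k e n w"
  shows "\<exists>k' \<in> A. \<exists>e' \<in> {al, be, ga}. pt k' e' = pt k e \<and> germ k' e' (n - 1) v"
  using assms(1)
proof (cases rule: Rel_cases)
  case (plain k' y z)
  then show ?thesis using assms Rel_run[OF plain(3) assms(3)]
    by (intro bexI[of _ k] bexI[of _ e]) (auto simp: germ_def)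
next
  case (check_in i j a y z)
  then show ?thesis using assms distinct by (cases n) (auto simp: germ_def)
next
  case (move_on i j a m y z)
  then have "n \<le> Suc m \<and> e = a" "k = j"
    using assms distinct run_block_le[of e n "Suc m" a de "ga ## ga ## y"] by (auto simp: germ_def simp del: replicate.simps)
  then show ?thesis using move_on assms
    by (intro bexI[of _ k] bexI[of _ e]) (auto simp: germ_def run_replicate_le simp del: replicate.simps)
next
  case (check_out i j a m y z)
  then have "n \<le> Suc m \<and> e = a" "k = j"
    using assms distinct run_block_le[of e n "Suc m" a de "ga ## y"] by (auto simp: germ_def simp del: replicate.simps)
  then show ?thesis using check_out assms tgt_facts[OF check_out(1)]
    by (intro bexI[of _ i] bexI[of _ ga]) (auto simp: germ_def run_replicate_le simp del: replicate.simps)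
qed

text \<open>A source followed by three letters \<open>ga\<close> cannot be copied, since the source
  word would be special; this fixes the depth 3. It stems from \<open>check_out\<close>, where
  \<open>m + 3\<close> letters \<open>ga\<close> stand for \<open>m + 1\<close> letters
  \<open>a\<close>: two levels are lost.\<close>

lemma Rel_germ_inv:
  assumes "Rel w v" "k \<in> A" "e \<in> {al, be, ga}" "n \<ge> 3" "germ k e n v" "e = ga \<Longrightarrow> tgt k \<noteq> None"
  shows "\<exists>k' \<in> A. \<exists>e' \<in> {al, be}. pt k' e' = pt k e \<and> germ k' e' (n - 2) w"
  using assms(1)
proof (cases rule: Rel_cases)
  case (plain k' y z)
  show ?thesis
  proof (cases "e = ga")
    case False
    then show ?thesis using plain assms Rel_run_inv[OF plain(3), of e n]
    by (intro bexI[of _ k] bexI[of _ e]) (auto simp: germ_def intro: run_mono)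
  next
    case True
    then obtain j a where t: "tgt k = Some (j, a)" using assms by auto
    have "run ga n y" using plain assms True Rel_run_ga[OF plain(3)] by (auto simp: germ_def)
    then have "run ga 3 y" by (rule run_mono[OF _ assms(4)])
    then have "\<exists>x. y = replicate 3 ga @- x" by (rule run_eq_replicate)
    then obtain x where "y = ga ## ga ## ga ## x" by (auto simp: numeral_3_eq_3)
    then have "special w" using t plain assms by (auto simp: special_def germ_def)
    then show ?thesis using plain by simp
  qed
next
  case (check_in i j a y z)
  then have "run e n (replicate (Suc 0) a @- de ## ga ## z)" using assms by (auto simp: germ_def)
  then have "n \<le> Suc 0" using run_block_le[of e n "Suc 0" a de] assms(3) distinct by blast
  then show ?thesis using assms by simp
next
  case (move_on i j a m y z)
  then have "n \<le> Suc (Suc m) \<and> e = a" "k = j"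
    using assms distinct run_block_le[of e n "Suc (Suc m)" a de "ga ## z"] by (auto simp: germ_def simp del: replicate.simps)
  then show ?thesis using move_on assms tgt_facts[OF move_on(1)]
    by (intro bexI[of _ k] bexI[of _ e]) (auto simp: germ_def run_replicate_le simp del: replicate.simps)
next
  case (check_out i j a m y z)
  \<comment> \<open>By the look-ahead the run of \<open>ga\<close> in the image ends after exactly
    \<open>m + 3\<close> letters.\<close>
  have "shd z \<noteq> ga" using check_out Rel_shd_ga by blast
  have "run e n (replicate (Suc (Suc (Suc m))) ga @- z)" using check_out assms by (auto simp: germ_def)
  moreover have "e = ga" using calculation assms(4) by (cases n) auto
  ultimately have "n \<le> m + 3" "e = ga" 
    using run_block_le[of e n "Suc (Suc (Suc m))" ga "shd z" "stl z"] assms \<open>shd z \<noteq> ga\<close> by auto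
  moreover have "k = i" using check_out assms by (auto simp: germ_def)
  ultimately show ?thesis using check_out assms tgt_facts[OF check_out(1)]
    by (intro bexI[of _ j] bexI[of _ a]) (auto simp: germ_def run_replicate_le simp del: replicate.simps)
qed

lemma germ_near:
  assumes "germ k e n w" "germ k' e' n v" "pt k e = pt k' e'" "k \<in> A" "k' \<in> A"
    "e \<in> S" "e' \<in> S" "S \<subseteq> {al, be, ga}"
  shows "near (contact pt S) (Suc n) w v"
proof (cases "k = k'")
  case True
  then have "e = e'" using pt_inj[of k e e'] assms by auto
  then show ?thesis using assms True by (auto simp: germ_def near_run)
next
  case False
  then show ?thesis using assms by (auto simp: germ_def contact_def)
qed

section \<open>Isolated pieces\<close>

lemma near_ga:
  assumes "near Q3 (Suc n) (ga ## y) z" "z \<in> streams A"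
  shows "z = ga ## stl z \<and> near Q3 n y (stl z)"
proof -
  have "shd z = ga"
  proof (rule ccontr)
    assume "shd z \<noteq> ga"
    then obtain a b where "contact pt {al, be, ga} ga a (shd z) b" using assms by auto
    then show False using top_free[of "shd z" a b] assms streams_shd \<open>shd z \<noteq> ga\<close> by (auto simp: contact_def)
  qed
  then show ?thesis using assms(1) stream.collapse[of z] by simp
qed

text \<open>A neighbour that leaves the block at a letter \<open>a\<close> is excluded by
  \<open>corner_free\<close>, at \<open>de\<close> by \<open>de_tgt\<close> and
  \<open>pt_same\<close>, and at \<open>ga\<close> by \<open>near_ga\<close>, unless this happens at
  the last level that is inspected. Hence the run is guaranteed only up to
  \<open>n - 1\<close>.\<close>

lemma near_block:
  assumes "near Q3 n (replicate m a @- de ## ga ## y) z" "a \<in> {al, be}" "z \<in> streams A"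
  shows "(\<exists>z'. z = replicate m a @- de ## ga ## z') \<or> n \<le> m + 2 \<and> run a (min (n - 1) m) z"
  using assms
proof (induction m arbitrary: n z)
  case 0
  show ?case
  proof (cases n)
    case (Suc n')
    show ?thesis
    proof (cases "shd z = de")
      case True
      then have "near Q3 n' (ga ## y) (stl z)" using 0 Suc by simp
      show ?thesis
      proof (cases n')
        case (Suc n'')
        then have "stl z = ga ## stl (stl z)"
          using \<open>near Q3 n' (ga ## y) (stl z)\<close> near_ga[of n'' y "stl z"] streams_stl[OF 0(3)] by simp
        then have "z = de ## ga ## stl (stl z)" using True by (metis stream.collapse)
        then have "z = replicate 0 a @- de ## ga ## stl (stl z)" by simp
        then show ?thesis by blast
      qed (use \<open>n = Suc n'\<close> in simp)
    next
      case False
      then obtain e e' where e: "contact pt {al, be, ga} de e (shd z) e'" "run e n' (ga ## y)" using 0 Suc by auto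
      have "n' = 0"
      proof (rule ccontr)
        assume "n' \<noteq> 0"
        then have "e = ga" using e by (cases n') auto
        then show False using e False pt_same[of de "shd z" ga] tgt_dom[of de "shd z" e'] letters
          streams_shd[OF 0(3)] de_tgt by (auto simp: contact_def)
      qed
      then show ?thesis using Suc by simp
    qed
  qed simp
next
  case (Suc m)
  show ?case
  proof (cases n)
    case (Suc n')
    show ?thesis
    proof (cases "shd z = a")
      case True
      then have "near Q3 n' (replicate m a @- de ## ga ## y) (stl z)" using Suc.prems Suc by simp
      from Suc.IH[OF this assms(2) streams_stl[OF Suc.prems(3)]] show ?thesis
      proof
        assume "\<exists>z'. stl z = replicate m a @- de ## ga ## z'"
        then show ?thesis using True by (metis replicate_Suc shift.simps(2) stream.collapse)
      next
        assume "n' \<le> m + 2 \<and> run a (min (n' - 1) m) (stl z)"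
        moreover have "min (n - 1) (Suc m) \<le> Suc (min (n' - 1) m)" using Suc by auto
        ultimately show ?thesis using Suc True run_mono[of a "Suc (min (n' - 1) m)" z] by auto
      qed
    next
      case False
      then obtain e e' where e: "contact pt {al, be, ga} a e (shd z) e'" "run e n' (replicate m a @- de ## ga ## y)"
        using Suc.prems Suc by auto
      have "n' = 0"
      proof (rule ccontr)
        assume "n' \<noteq> 0"
        moreover have "e \<noteq> de" using e distinct by (auto simp: contact_def)
        ultimately have "e = a" using run_block_le[of e n' m a de] e by auto
        then show False using e False corner_free[of "shd z" a e'] assms(2) streams_shd[OF Suc.prems(3)]
          by (auto simp: contact_def)
      qed
      then show ?thesis using Suc by simp
    qed
  qed simp
qed

text \<open>The level lost in \<open>Rel_germ\<close> is regained, since a germ of depth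
  \<open>n - 1\<close> already fixes a cell of level \<open>n\<close>.\<close>

lemma germs_upper:
  assumes "Rel w v" "Rel w' v'" "germ k e n w" "germ k' e' n w'" "pt k e = pt k' e'"
    "k \<in> A" "k' \<in> A" "e \<in> {al, be}" "e' \<in> {al, be}" "n \<ge> 1"
  shows "near Q3 n v v'"
proof -
  obtain k1 e1 where 1: "k1 \<in> A" "e1 \<in> {al, be, ga}" "pt k1 e1 = pt k e" "germ k1 e1 (n - 1) v"
    using Rel_germ[OF assms(1,6,8,10,3)] by blast
  obtain k2 e2 where 2: "k2 \<in> A" "e2 \<in> {al, be, ga}" "pt k2 e2 = pt k' e'" "germ k2 e2 (n - 1) v'"
    using Rel_germ[OF assms(2,7,9,10,4)] by blast
  have "near Q3 (Suc (n - 1)) v v'"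
    by (rule germ_near[OF 1(4) 2(4)]) (use 1 2 assms in auto)
  then show ?thesis using assms(10) by simp
qed

lemma germs_lower:
  assumes "Rel w v" "Rel w' v'" "germ k e n v" "germ k' e' n v'" "pt k e = pt k' e'"
    "k \<in> A" "k' \<in> A" "e \<in> {al, be, ga}" "e' \<in> {al, be, ga}" "n \<ge> 3"
    "e = ga \<Longrightarrow> tgt k \<noteq> None" "e' = ga \<Longrightarrow> tgt k' \<noteq> None"
  shows "near Q2 (n - 1) w w'"
proof -
  obtain k1 e1 where 1: "k1 \<in> A" "e1 \<in> {al, be}" "pt k1 e1 = pt k e" "germ k1 e1 (n - 2) w"
    using Rel_germ_inv[OF assms(1,6,8,10,3,11)] by blast
  obtain k2 e2 where 2: "k2 \<in> A" "e2 \<in> {al, be}" "pt k2 e2 = pt k' e'" "germ k2 e2 (n - 2) w'"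
    using Rel_germ_inv[OF assms(2,7,9,10,4,12)] by blast
  have "near Q2 (Suc (n - 2)) w w'"
    by (rule germ_near[OF 1(4) 2(4)]) (use 1 2 assms in auto)
  moreover have "Suc (n - 2) = n - 1" using assms(10) by simp
  ultimately show ?thesis by simp
qed

lemma special_block: "tgt i = Some (j, a) \<Longrightarrow> special (j ## replicate (Suc m) a @- de ## ga ## y)"
  unfolding special_def by blast

lemma special_in: "tgt i = Some (j, a) \<Longrightarrow> special (i ## ga ## ga ## ga ## y)"
  unfolding special_def by fastforce

lemma Rel_check_in:
  assumes "tgt i = Some (j, a)" "Rel (i ## ga ## ga ## ga ## y) v"
  shows "\<exists>z. v = j ## replicate (Suc 0) a @- de ## ga ## z \<and> Rel y z"
  using assms(2)
proof (cases rule: Rel_cases)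
  case plain then show ?thesis using special_in assms by blast
qed (use assms in \<open>auto dest: tgt_facts\<close>)

lemma tgt_block_eq:
  assumes "tgt i = Some (j, a)" "tgt i' = Some (j', a')"
    "j ## replicate (Suc m) a @- de ## y = j' ## replicate (Suc m') a' @- de ## y'"
  shows "i = i' \<and> j = j' \<and> a = a' \<and> m = m' \<and> y = y'"
proof -
  have "j = j'" "a = a'" using assms(3) by auto
  moreover have "replicate (Suc m) a @- de ## y = replicate (Suc m') a' @- de ## y'" using assms(3) by auto
  ultimately show ?thesis using block_eq[of "Suc m" a de y "Suc m'" y'] tgt_facts[OF assms(1)]
    tgt_inj[OF assms(1), of i'] assms(2) by auto
qed

lemma Rel_block_out:
  assumes "tgt i = Some (j, a)" "Rel (j ## replicate (Suc m) a @- de ## ga ## y) v"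
  shows "(\<exists>y' z. y = ga ## y' \<and> v = j ## replicate (Suc (Suc m)) a @- de ## ga ## z \<and> Rel y' z) \<or>
    (\<exists>z. shd y \<noteq> ga \<and> v = i ## replicate (Suc (Suc (Suc m))) ga @- z \<and> Rel y z)"
  using assms(2)
proof (cases rule: Rel_cases)
  case plain then show ?thesis using special_block assms by blast
next
  case check_in then show ?thesis using assms by (auto dest: tgt_facts)
next
  case (move_on i' j' a' m' y' z)
  from tgt_block_eq[OF assms(1) move_on(1,2)] show ?thesis using move_on by auto
next
  case (check_out i' j' a' m' y' z)
  from tgt_block_eq[OF assms(1) check_out(1,2)] show ?thesis using check_out by auto
qed

text \<open>The shortest block, \<open>m = 0\<close>, is produced by \<open>check_in\<close>, a
  longer one by \<open>move_on\<close>. It cannot be copied, since \<open>Rel_block\<close> would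
  make the source word special.\<close>

lemma Rel_block_in:
  assumes "tgt i = Some (j, a)" "Rel w (j ## replicate (Suc m) a @- de ## ga ## z)"
  shows "\<exists>y. Rel y z \<and> w = (if m = 0 then [i, ga, ga, ga] else j # replicate m a @ [de, ga, ga]) @- y"
  using assms(2)
proof (cases rule: Rel_cases)
  case (plain k y z')
  then have "\<exists>z'. y = replicate (Suc m) a @- de ## ga ## z'" 
    using Rel_block[OF plain(3), of a "Suc m" z] assms(1) by (auto dest: tgt_facts simp del: replicate.simps)
  then have "special w" using special_block[OF assms(1)] plain by auto
  then show ?thesis using plain by simp
next
  case (check_in i' j' a' y z')
  from tgt_block_eq[OF assms(1) check_in(1,3)] show ?thesis using check_in by auto
next
  case (move_on i' j' a' m' y z')
  from tgt_block_eq[OF assms(1) move_on(1,3)] show ?thesis using move_on by auto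
next
  case (check_out i' j' a' m' y z') then show ?thesis using assms by (auto dest: tgt_facts)
qed

lemma Rel_top_in:
  assumes "tgt i = Some (j, a)" "Rel w v" "v = i ## ga ## ga ## ga ## z0"
  shows "\<exists>m y z. w = j ## replicate (Suc m) a @- de ## ga ## y \<and> v = i ## replicate (Suc (Suc (Suc m))) ga @- z
    \<and> Rel y z \<and> shd y \<noteq> ga"
  using assms(2)
proof (cases rule: Rel_cases)
  case (plain k y z')
  then have "run ga 3 z'" using assms(3) by (auto simp: numeral_3_eq_3)
  then have "run ga 3 y" using Rel_run_ga[OF plain(3)] by blast
  then have "\<exists>x. y = replicate 3 ga @- x" by (rule run_eq_replicate)
  then obtain x where "y = ga ## ga ## ga ## x" by (auto simp: numeral_3_eq_3)
  then have "special w" using special_in[OF assms(1)] plain assms(3) by auto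
  then show ?thesis using plain by simp
next
  case (check_out i' j' a' m y z)
  then show ?thesis using assms by auto
qed (use assms in \<open>auto dest: tgt_facts\<close>)

section \<open>Nearness changes by a bounded number of levels\<close>

text \<open>The situation in which an induction on the depth can continue with the tails.\<close>

definition same_factor where
  "same_factor w v w' v' \<longleftrightarrow> (\<exists>p q y z y' z'. w = p @- y \<and> v = q @- z \<and> w' = p @- y' \<and> v' = q @- z' \<and>
     length p = length q \<and> p \<noteq> [] \<and> Rel y z \<and> Rel y' z')"

lemma same_factorI: "w = p @- y \<Longrightarrow> v = q @- z \<Longrightarrow> w' = p @- y' \<Longrightarrow> v' = q @- z' \<Longrightarrow>
    length p = length q \<Longrightarrow> p \<noteq> [] \<Longrightarrow> Rel y z \<Longrightarrow> Rel y' z' \<Longrightarrow> same_factor w v w' v'"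
  unfolding same_factor_def by blast

lemma same_factor_sym: "same_factor w v w' v' \<Longrightarrow> same_factor w' v' w v"
  unfolding same_factor_def by blast

lemma near_gas:
  assumes "near Q3 n (replicate m ga @- y) z" "z \<in> streams A" "m \<le> n"
  shows "\<exists>z'. z = replicate m ga @- z' \<and> near Q3 (n - m) y z'"
  using assms
proof (induction m arbitrary: n z)
  case (Suc m)
  then obtain n' where n': "n = Suc n'" by (cases n) auto
  then have *: "z = ga ## stl z \<and> near Q3 n' (replicate m ga @- y) (stl z)"
    using near_ga[of n' "replicate m ga @- y" z] Suc.prems by simp
  then obtain z' where "stl z = replicate m ga @- z'" "near Q3 (n' - m) y z'"
    using Suc.IH[of n' "stl z"] Suc.prems n' streams_stl by auto
  then show ?case using * n' by (intro exI[of _ z']) (metis diff_Suc_Suc replicate_Suc shift.simps(2))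
qed simp

text \<open>If the factor is not shared, the words part inside the block or just behind it. Then
  both follow the run \<open>j a a ...\<close> to within four levels of \<open>n\<close>, and
  \<open>germs_upper\<close> at this one point settles the matter without induction.\<close>

lemma upper_special:
  assumes "Rel w v" "Rel w' v'" "near Q3 n w w'" "special w" "n > 4" "shd w = shd w'"
  shows "same_factor w v w' v' \<or> near Q3 (n - 4) v v'"
proof -
  note st = Rel_streams[OF assms(1)] Rel_streams[OF assms(2)]
  have n1: "near Q3 (n - 1) (stl w) (stl w')" using assms by (cases n) auto
  from assms(4) consider (1) i j a y where "tgt i = Some (j, a)" "w = [i, ga, ga, ga] @- y"
    | (2) i j a m y where "tgt i = Some (j, a)" "w = j ## replicate (Suc m) a @- de ## ga ## y"
    unfolding special_def by blast
  then show ?thesis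
  proof cases
    case 1
    have "near Q3 (n - 1) (replicate 3 ga @- y) (stl w')" using n1 1 by (simp add: numeral_3_eq_3)
    then obtain y' where "stl w' = replicate 3 ga @- y'"
      using near_gas[OF _ streams_stl[OF st(3)], of "n - 1" 3 y] assms(5) by force
    then have w': "w' = i ## ga ## ga ## ga ## y'" using assms(6) 1
      by (simp add: numeral_3_eq_3) (metis stream.collapse)
    obtain z where "v = j ## replicate (Suc 0) a @- de ## ga ## z" "Rel y z"
      using Rel_check_in[OF 1(1), of y v] assms(1) 1 by auto
    moreover obtain z' where "v' = j ## replicate (Suc 0) a @- de ## ga ## z'" "Rel y' z'"
      using Rel_check_in[OF 1(1), of y' v'] assms(2) w' by auto
    ultimately have "same_factor w v w' v'"
      by (intro same_factorI[of w "[i, ga, ga, ga]" y v "[j, a, de, ga]" z w' y' v' z']) (auto simp: 1 w')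
    then show ?thesis ..
  next
    case 2
    note t = tgt_facts[OF 2(1)]
    have germs: "near Q3 l v v'" if "run a l (stl w)" "run a l (stl w')" "l \<ge> 1" for l
      by (rule germs_upper[OF assms(1,2), of j a l j a]) (use that t 2 assms(6) in \<open>auto simp: germ_def\<close>)
    have runw: "run a l (stl w)" if "l \<le> Suc m" for l using 2 that by (simp add: run_replicate_le del: replicate.simps)
    have "(\<exists>y'. stl w' = replicate (Suc m) a @- de ## ga ## y') \<or> n - 1 \<le> Suc m + 2 \<and> run a (min (n - 1 - 1) (Suc m)) (stl w')"
      by (rule near_block[where y=y]) (use n1 2 t st streams_stl in auto)
    then show ?thesis
    proof
      assume "n - 1 \<le> Suc m + 2 \<and> run a (min (n - 1 - 1) (Suc m)) (stl w')"
      then have "near Q3 (min (n - 1 - 1) (Suc m)) v v'" "n - 4 \<le> min (n - 1 - 1) (Suc m)"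
        using germs[of "min (n - 1 - 1) (Suc m)"] runw assms(5) by auto
      then show ?thesis using near_mono by blast
    next
      assume "\<exists>y'. stl w' = replicate (Suc m) a @- de ## ga ## y'"
      then obtain y' where w': "w' = j ## replicate (Suc m) a @- de ## ga ## y'"
        using 2 assms(6) by (metis stream.collapse stream.sel(1))
      have run': "run a l (stl w')" if "l \<le> Suc m" for l using w' that by (simp add: run_replicate_le del: replicate.simps)
      \<comment> \<open>The words agree on the \<open>m + 4\<close> letters of
        \<open>j a ... a de ga\<close>, and only one of them goes on with \<open>ga\<close>;
        isolation of \<open>ga\<close> gives \<open>n \<le> m + 4\<close>, while the common run
        still has \<open>m + 1\<close> letters.\<close>
      have close: ?thesis if "shd y = ga \<longleftrightarrow> shd y' \<noteq> ga"
      proof -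
        have e: "Suc (Suc (Suc (Suc m))) = m + 4" by simp
        have *: "near Q3 (n - (m + 4)) y y'"
          using assms(3) near_shift[of Q3 n "j # replicate (Suc m) a @ [de, ga]" y y'] 2 w'
          by (simp add: e del: replicate.simps)
        have "n \<le> m + 4"
        proof (rule ccontr)
          assume "\<not> n \<le> m + 4"
          then obtain l where l: "n - (m + 4) = Suc l" by (cases "n - (m + 4)") auto
          have sy: "y \<in> streams A" "y' \<in> streams A" using st 2 w' by (auto simp: streams_iff_sset)
          show False
          proof (cases "shd y = ga")
            case True
            then show False using near_ga[of l "stl y" y'] * l sy that by (metis stream.collapse stream.sel(1))
          next
            case False
            then show False using near_ga[of l "stl y'" y] near_contact_sym[OF *] l sy that
              by (metis stream.collapse stream.sel(1))
          qed
        qed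
        then have "near Q3 (n - 4) v v'" using near_mono[OF germs[OF runw run'], of "Suc m" "n - 4"] by auto
        then show ?thesis ..
      qed
      from Rel_block_out[OF 2(1) assms(1)[unfolded 2(2)]] show ?thesis
      proof (elim disjE exE conjE)
        fix x z assume v: "y = ga ## x" "v = j ## replicate (Suc (Suc m)) a @- de ## ga ## z" "Rel x z"
        from Rel_block_out[OF 2(1) assms(2)[unfolded w']] show ?thesis
        proof (elim disjE exE conjE)
          fix x' z' assume v': "y' = ga ## x'" "v' = j ## replicate (Suc (Suc m)) a @- de ## ga ## z'" "Rel x' z'"
          have "same_factor w v w' v'"
            by (rule same_factorI[of w "j # replicate (Suc m) a @ [de, ga, ga]" x v "j # replicate (Suc (Suc m)) a @ [de, ga]" z w' x' v' z'])
              (use v v' 2 w' in auto)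
          then show ?thesis ..
        qed (use v close in auto)
      next
        fix z assume v: "shd y \<noteq> ga" "v = i ## replicate (Suc (Suc (Suc m))) ga @- z" "Rel y z"
        from Rel_block_out[OF 2(1) assms(2)[unfolded w']] show ?thesis
        proof (elim disjE exE conjE)
          fix z' assume v': "v' = i ## replicate (Suc (Suc (Suc m))) ga @- z'" "Rel y' z'"
          have "same_factor w v w' v'"
            by (rule same_factorI[of w "j # replicate (Suc m) a @ [de, ga]" y v "i # replicate (Suc (Suc (Suc m))) ga" z w' y' v' z'])
              (use v v' 2 w' in auto)
          then show ?thesis ..
        qed (use v close in auto)
      qed
    qed
  qed
qed

lemma Rel_plain:
  assumes "Rel w v" "\<not> special w"
  shows "\<exists>k y z. w = k ## y \<and> v = k ## z \<and> Rel y z"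
  using assms(1)
proof (cases rule: Rel_cases)
  case check_in then show ?thesis using special_in assms(2) by blast
next
  case move_on then show ?thesis using special_block assms(2) by blast
next
  case check_out then show ?thesis using special_block assms(2) by blast
qed blast

lemma plain_same_factor:
  assumes "Rel w v" "Rel w' v'" "\<not> special w" "\<not> special w'" "shd w = shd w' \<or> shd v = shd v'"
  shows "same_factor w v w' v'"
proof -
  obtain k y z k' y' z' where *: "w = k ## y" "v = k ## z" "Rel y z" "w' = k' ## y'" "v' = k' ## z'" "Rel y' z'"
    using Rel_plain assms by meson
  then show ?thesis using assms(5)
    by (intro same_factorI[of w "[k]" y v "[k]" z w' y' v' z']) auto
qed

lemma near_Q2_Q3: "near Q2 n w v \<Longrightarrow> near Q3 n w v"
  by (erule near_weaken[rotated]) (auto simp: contact_def)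

text \<open>The induction is strong because factors are arbitrarily long. Different first letters
  mean a contact, for which germs suffice.\<close>

lemma Rel_near:
  assumes "Rel w v" "Rel w' v'" "near Q2 n w w'"
  shows "near Q3 (n - 4) v v'"
  using assms
proof (induction n arbitrary: w v w' v' rule: less_induct)
  case (less n)
  note st = Rel_streams[OF less.prems(1)] Rel_streams[OF less.prems(2)]
  show ?case
  proof (cases "n \<le> 4")
    case False
    show ?thesis
    proof (cases "shd w = shd w'")
      case True
      have "same_factor w v w' v' \<or> near Q3 (n - 4) v v'"
      proof (cases "special w \<or> special w'")
        case True
        then show ?thesis
        proof
          assume "special w'"
          with upper_special[OF less.prems(2,1) near_Q2_Q3[OF near_contact_sym[OF less.prems(3)]]]
          have "same_factor w' v' w v \<or> near Q3 (n - 4) v' v" using False \<open>shd w = shd w'\<close> by auto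
          then show ?thesis using same_factor_sym near_contact_sym by blast
        qed (use upper_special less.prems near_Q2_Q3 False \<open>shd w = shd w'\<close> in auto)
      qed (use plain_same_factor less.prems \<open>shd w = shd w'\<close> in auto)
      then show ?thesis
      proof
        assume "same_factor w v w' v'"
        then obtain p q y z y' z' where *: "w = p @- y" "v = q @- z" "w' = p @- y'" "v' = q @- z'"
          "length p = length q" "p \<noteq> []" "Rel y z" "Rel y' z'" unfolding same_factor_def by blast
        have "near Q2 (n - length p) y y'" using less.prems(3) * near_shift by metis
        moreover have "n - length p < n" using * False by (cases p) auto
        ultimately have "near Q3 (n - length p - 4) z z'" using less.IH * by blast
        then have "near Q3 (n - 4 - length q) z z'" using * diff_commute[of n "length p" 4] by simp
        then show ?thesis using * by (simp add: near_shift)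
      qed
    next
      case neq: False
      obtain l where l: "n = Suc l" using False by (cases n) auto
      then obtain a b where ab: "Q2 (shd w) a (shd w') b" "run a l (stl w)" "run b l (stl w')"
        using neq less.prems by auto
      have "near Q3 l v v'"
        by (rule germs_upper[OF less.prems(1,2), of "shd w" a l "shd w'" b])
          (use ab st streams_shd l False in \<open>auto simp: germ_def contact_def\<close>)
      then show ?thesis using l near_mono by (metis Suc_diff_le diff_le_self le_SucI near_mono numeral_eq_Suc diff_Suc_Suc)
    qed
  qed simp
qed


lemma lower_block:
  assumes "Rel w v" "Rel w' v'" "near Q3 n v v'" "n > 5" "shd v = shd v'"
    "tgt i = Some (j, a)" "v = j ## replicate (Suc m) a @- de ## ga ## z"
  shows "same_factor w v w' v' \<or> near Q2 (n - 5) w w'"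
proof -
  note st = Rel_streams[OF assms(1)] Rel_streams[OF assms(2)] and t = tgt_facts[OF assms(6)]
  have n1: "near Q3 (n - 1) (stl v) (stl v')" using assms by (cases n) auto
  have "(\<exists>z'. stl v' = replicate (Suc m) a @- de ## ga ## z') \<or> n - 1 \<le> Suc m + 2 \<and> run a (min (n - 1 - 1) (Suc m)) (stl v')"
    by (rule near_block[where y=z]) (use n1 assms(7) t st streams_stl in auto)
  then show ?thesis
  proof
    assume "n - 1 \<le> Suc m + 2 \<and> run a (min (n - 1 - 1) (Suc m)) (stl v')"
    moreover define l where "l = min (n - 1 - 1) (Suc m)"
    \<comment> \<open>The assumption \<open>n > 5\<close> enters here: it gives
      \<open>l \<ge> 3\<close>, the depth at which \<open>germs_lower\<close> applies.\<close>
    ultimately have l: "run a l (stl v')" "n - 5 \<le> l - 1" "l \<ge> 3" "l \<le> Suc m" using assms(4) by auto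
    have "run a l (stl v)" using assms(7) l by (simp add: run_replicate_le del: replicate.simps)
    then have "near Q2 (l - 1) w w'"
      by (intro germs_lower[OF assms(1,2), of j a l j a]) (use l t assms(5,7) in \<open>auto simp: germ_def\<close>)
    then show ?thesis using l near_mono by blast
  next
    assume "\<exists>z'. stl v' = replicate (Suc m) a @- de ## ga ## z'"
    then obtain z' where v': "v' = j ## replicate (Suc m) a @- de ## ga ## z'"
      using assms(5,7) by (metis stream.collapse stream.sel(1))
    let ?p = "if m = 0 then [i, ga, ga, ga] else j # replicate m a @ [de, ga, ga]"
    obtain y where y: "Rel y z" "w = ?p @- y" using Rel_block_in[OF assms(6)] assms(1,7) by blast
    obtain y' where y': "Rel y' z'" "w' = ?p @- y'" using Rel_block_in[OF assms(6)] assms(2) v' by blast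
    have "same_factor w v w' v'"
      by (rule same_factorI[of w ?p y v "j # replicate (Suc m) a @ [de, ga]" z w' y' v' z'])
        (use y y' assms(7) v' in auto)
    then show ?thesis ..
  qed
qed

text \<open>If the runs of \<open>ga\<close> differ in length, the images part where the shorter one
  ends, and isolation of \<open>ga\<close> gives \<open>n \<le> m + 4\<close>. Up to that level both
  are germs at the top of \<open>i\<close>, which pull back to germs at the same point.\<close>

lemma lower_top:
  assumes "Rel w v" "Rel w' v'" "near Q3 n v v'" "tgt i = Some (j, a)"
    "w = j ## replicate (Suc m) a @- de ## ga ## y" "v = i ## replicate (Suc (Suc (Suc m))) ga @- z" "shd y \<noteq> ga" "Rel y z"
    "w' = j ## replicate (Suc m') a @- de ## ga ## y'" "v' = i ## replicate (Suc (Suc (Suc m'))) ga @- z'"  "Rel y' z'"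
    "m \<le> m'"
  shows "same_factor w v w' v' \<or> near Q2 (n - 5) w w'"
proof (cases "m = m'")
  case True
  have "same_factor w v w' v'"
    by (rule same_factorI[of w "j # replicate (Suc m) a @ [de, ga]" y v "i # replicate (Suc (Suc (Suc m))) ga" z w' y' v' z'])
      (use True assms in auto)
  then show ?thesis ..
next
  case False
  then obtain d where d: "m' = Suc (m + d)" using assms(12) less_iff_Suc_add[of m m'] by auto
  note st = Rel_streams[OF assms(1)] Rel_streams[OF assms(2)] and t = tgt_facts[OF assms(4)]
  have v: "v = (i # replicate (Suc (Suc (Suc m))) ga) @- z" using assms by simp
  have "v' = (i # replicate (Suc (Suc (Suc m))) ga) @- ga ## replicate d ga @- z'"
    using assms(10) d replicate_add[of "Suc (Suc (Suc m))" "Suc d" ga] by (simp del: replicate.simps(2)) simp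
  moreover have e: "Suc (Suc (Suc (Suc m))) = m + 4" by simp
  ultimately have *: "near Q3 (n - (m + 4)) (ga ## replicate d ga @- z') z" 
    using assms(3) near_shift[of Q3 n "i # replicate (Suc (Suc (Suc m))) ga" z "ga ## replicate d ga @- z'"] v
    by (auto intro: near_contact_sym simp add: e simp del: replicate.simps)
  have "shd z \<noteq> ga" using assms Rel_shd_ga by blast
  moreover have "z \<in> streams A" using assms Rel_streams by blast
  ultimately have n: "n \<le> m + 4"
    using near_ga[of "n - (m + 4) - 1" "replicate d ga @- z'" z] * 
    by (cases "n - (m + 4)") (auto, metis stream.sel(1))
  have "run ga (m + 3) (stl v)" "run ga (m + 3) (stl v')"
    using assms(6,10) d by (simp_all add: run_replicate_le del: replicate.simps)
  then have "near Q2 (m + 3 - 1) w w'"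
    by (intro germs_lower[OF assms(1,2), of i ga "m + 3" i ga])
      (use assms(4,6,10) t letters in \<open>auto simp: germ_def\<close>)
  then show ?thesis using n near_mono[of Q2 "m + 3 - 1" w w' "n - 5"] by auto
qed

lemma lower_special:
  assumes "Rel w v" "Rel w' v'" "near Q3 n v v'" "special w" "n > 5" "shd v = shd v'"
  shows "same_factor w v w' v' \<or> near Q2 (n - 5) w w'"
  using assms(1)
proof (cases rule: Rel_cases)
  case plain then show ?thesis using assms(4) by simp
next
  case check_in then show ?thesis using lower_block assms by blast
next
  case move_on then show ?thesis using lower_block assms by blast
next
  case (check_out i j a m y z)
  note st = Rel_streams[OF assms(1)] Rel_streams[OF assms(2)]
  have n1: "near Q3 (n - 1) (stl v) (stl v')" using assms by (cases n) auto
  then have "near Q3 (n - 1) (replicate 3 ga @- replicate m ga @- z) (stl v')" using check_out by (simp add: numeral_3_eq_3)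
  then obtain x where "stl v' = replicate 3 ga @- x"
    using near_gas[OF _ streams_stl[OF st(4)], of "n - 1" 3 "replicate m ga @- z"] assms(5) by force
  then have "v' = i ## ga ## ga ## ga ## x" using assms(6) check_out
    by (simp add: numeral_3_eq_3) (metis stream.collapse)
  from Rel_top_in[OF check_out(1) assms(2) this]
  obtain m' y' z' where *: "w' = j ## replicate (Suc m') a @- de ## ga ## y'"
     "v' = i ## replicate (Suc (Suc (Suc m'))) ga @- z'" "Rel y' z'" "shd y' \<noteq> ga" by blast
  show ?thesis
  proof (cases "m \<le> m'")
    case True
    show ?thesis by (rule lower_top[OF assms(1-3) check_out(1-3,5,4) *(1-3) True])
  next
    case False
    then have "m' \<le> m" by simp
    from lower_top[OF assms(2,1) near_contact_sym[OF assms(3)] check_out(1) *(1,2,4,3) check_out(2,3,4) this]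
    show ?thesis using same_factor_sym near_contact_sym by blast
  qed
qed

lemma Rel_near_inv:
  assumes "Rel w v" "Rel w' v'" "near Q3 n v v'"
  shows "near Q2 (n - 5) w w'"
  using assms
proof (induction n arbitrary: w v w' v' rule: less_induct)
  case (less n)
  note st = Rel_streams[OF less.prems(1)] Rel_streams[OF less.prems(2)]
  show ?case
  proof (cases "n \<le> 5")
    case False
    show ?thesis
    proof (cases "shd v = shd v'")
      case True
      have "same_factor w v w' v' \<or> near Q2 (n - 5) w w'"
      proof (cases "special w \<or> special w'")
        case True
        then show ?thesis
        proof
          assume "special w'"
          with lower_special[OF less.prems(2,1) near_contact_sym[OF less.prems(3)]]
          have "same_factor w' v' w v \<or> near Q2 (n - 5) w' w" using False \<open>shd v = shd v'\<close> by auto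
          then show ?thesis using same_factor_sym near_contact_sym by blast
        qed (use lower_special less.prems False \<open>shd v = shd v'\<close> in auto)
      qed (use plain_same_factor less.prems \<open>shd v = shd v'\<close> in auto)
      then show ?thesis
      proof
        assume "same_factor w v w' v'"
        then obtain p q y z y' z' where *: "w = p @- y" "v = q @- z" "w' = p @- y'" "v' = q @- z'"
          "length p = length q" "p \<noteq> []" "Rel y z" "Rel y' z'" unfolding same_factor_def by blast
        have "near Q3 (n - length p) z z'" using less.prems(3) * near_shift by metis
        moreover have "n - length p < n" using * False by (cases p) auto
        ultimately have "near Q2 (n - length p - 5) y y'" using less.IH * by blast
        then have "near Q2 (n - 5 - length p) y y'" using diff_commute[of n "length p" 5] by simp
        then show ?thesis using * by (simp add: near_shift)
      qed
    next
      case neq: False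
      obtain l where l: "n = Suc l" using False by (cases n) auto
      then obtain a b where ab: "Q3 (shd v) a (shd v') b" "run a l (stl v)" "run b l (stl v')"
        using neq less.prems by auto
      have A: "shd v \<in> A" "shd v' \<in> A" using st streams_shd by auto
      \<comment> \<open>Different cells never touch with corners of the same kind, so at most one of
        \<open>a\<close>, \<open>b\<close> is \<open>ga\<close>. Its cell is then a source by
        \<open>tgt_dom\<close>, as \<open>germs_lower\<close> requires.\<close>
      have ne: "a \<noteq> b" using pt_same[OF A, of a] neq ab by (auto simp: contact_def)
      have "near Q2 (l - 1) w w'"
        by (rule germs_lower[OF less.prems(1,2), of "shd v" a l "shd v'" b])
          (use ab A l False ne neq tgt_dom[OF A neq, of b] tgt_dom[OF A(2,1), of a] in \<open>auto simp: germ_def contact_def\<close>)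
      then show ?thesis by (rule near_mono) (use l in auto)
    qed
  qed simp
qed

section \<open>Existence and range of the substitution\<close>

lemma fac_ex:
  assumes "w \<in> streams A"
  shows "\<exists>p q y. w = p @- y \<and> fac p q y"
proof (cases "special w")
  case False
  moreover have "w = [shd w] @- stl w" by simp
  ultimately show ?thesis using plain[of "shd w" "stl w"] streams_shd[OF assms] by (metis stream.collapse)
next
  case True
  then consider (1) i j a y where "tgt i = Some (j, a)" "w = [i, ga, ga, ga] @- y"
    | (2) i j a m y where "tgt i = Some (j, a)" "w = j ## replicate (Suc m) a @- de ## ga ## y"
    unfolding special_def by blast
  then show ?thesis
  proof cases
    case 1 then show ?thesis using check_in by blast
  next
    case 2
    show ?thesis
    proof (cases "shd y = ga")
      case True
      then have "y = ga ## stl y" by (metis stream.collapse)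
      then have "w = (j # replicate (Suc m) a @ [de, ga, ga]) @- stl y" using 2 by simp
      then show ?thesis using move_on[OF 2(1)] by blast
    next
      case False
      have "w = (j # replicate (Suc m) a @ [de, ga]) @- y" using 2 by simp
      then show ?thesis using check_out[OF 2(1) False] by blast
    qed
  qed
qed

lemma Rel_ex:
  assumes "w \<in> streams A"
  shows "\<exists>v. Rel w v"
proof -
  have "\<exists>h. \<forall>w\<in>streams A. \<exists>q y. (\<exists>p. w = p @- y \<and> fac p q y) \<and> y \<in> streams A \<and> h w = q @- h y"
  proof (rule stream_unfold)
    fix w assume w: "w \<in> streams A"
    then obtain p q y where *: "w = p @- y" "fac p q y" using fac_ex by blast
    then have "y \<in> streams A" using w by (auto simp: streams_iff_sset)
    then show "\<exists>q y. (\<exists>p. w = p @- y \<and> fac p q y) \<and> y \<in> streams A \<and> q \<noteq> []" using * fac_nonempty by blast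
  qed
  then obtain h where h: "\<And>w. w \<in> streams A \<Longrightarrow> \<exists>q y. (\<exists>p. w = p @- y \<and> fac p q y) \<and> y \<in> streams A \<and> h w = q @- h y" by blast
  have "Rel w (h w)" using assms
  proof (coinduction arbitrary: w)
    case Rel
    with h[of w] show ?case by blast
  qed
  then show ?thesis ..
qed

definition out_special :: "'a stream \<Rightarrow> bool" where
  "out_special v \<longleftrightarrow> (\<exists>i j a z. tgt i = Some (j, a) \<and> v = i ## ga ## ga ## ga ## z) \<or>
     (\<exists>i j a m z. tgt i = Some (j, a) \<and> v = j ## replicate (Suc m) a @- de ## ga ## z)"

text \<open>The rules of \<open>fac\<close> read backwards. In the last one the run of
  \<open>ga\<close> has to be maximal, so some other letter must follow it; an endless run admits no
  factor.\<close>

inductive gfac :: "'a stream \<Rightarrow> 'a list \<Rightarrow> 'a stream \<Rightarrow> bool" where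
  "k \<in> A \<Longrightarrow> \<not> out_special (k ## z) \<Longrightarrow> gfac (k ## z) [k] z"
| "tgt i = Some (j, a) \<Longrightarrow> gfac (j ## a ## de ## ga ## z) [i, ga, ga, ga] z"
| "tgt i = Some (j, a) \<Longrightarrow> gfac (j ## replicate (Suc (Suc m)) a @- de ## ga ## z)
     (j # replicate (Suc m) a @ [de, ga, ga]) z"
| "tgt i = Some (j, a) \<Longrightarrow> shd z \<noteq> ga \<Longrightarrow> gfac (i ## replicate (Suc (Suc (Suc m))) ga @- z)
     (j # replicate (Suc m) a @ [de, ga]) z"

text \<open>A word ending in \<open>i ga ga ga \<dots>\<close> with a source \<open>i\<close> is not in the range of the substitution, but it
  addresses the same point as the word ending in \<open>j a a a \<dots>\<close> instead, which is.\<close>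

definition no_top_tail :: "'a stream \<Rightarrow> bool" where
  "no_top_tail v \<longleftrightarrow> v \<in> streams A \<and> (\<forall>x i. tgt i \<noteq> None \<longrightarrow> v \<noteq> x @- i ## sconst ga)"

lemma no_top_tail_shift: "no_top_tail (q @- z) \<Longrightarrow> no_top_tail z"
  unfolding no_top_tail_def by (auto simp: streams_iff_sset) (metis shift_append)

lemma gfac_ex:
  assumes "no_top_tail v"
  shows "\<exists>p z. gfac v p z"
proof (cases "out_special v")
  case False
  then show ?thesis using gfac.intros(1)[of "shd v" "stl v"] streams_shd assms
    by (auto simp: no_top_tail_def)
next
  case True
  then consider (1) i j a z where "tgt i = Some (j, a)" "v = i ## ga ## ga ## ga ## z"
    | (2) i j a m z where "tgt i = Some (j, a)" "v = j ## replicate (Suc m) a @- de ## ga ## z"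
    unfolding out_special_def by blast
  then show ?thesis
  proof cases
    case 1
    have "v \<noteq> [] @- i ## sconst ga" using 1 assms unfolding no_top_tail_def by blast
    moreover have "sconst ga = ga ## ga ## ga ## sconst ga" by (metis siterate.code id_apply)
    ultimately have "z \<noteq> sconst ga" using 1(2) by (metis shift.simps(1))
    then obtain n y where y: "z = replicate n ga @- y" "shd y \<noteq> ga" using sconst_or_run[of z ga] by metis
    then have "v = i ## replicate (Suc (Suc (Suc n))) ga @- y" using 1 by simp
    then show ?thesis using gfac.intros(4)[OF 1(1) y(2), of n] by blast
  next
    case 2
    then show ?thesis using gfac.intros(2)[OF 2(1)] gfac.intros(3)[OF 2(1)] by (cases m) (simp, blast)+
  qed
qed

text \<open>Unfolding \<open>gfac\<close> yields a candidate \<open>g v\<close>. The difficulty is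
  that a letter copied backwards must not open a special prefix of the word under construction,
  while only the given word is known to have no such prefix. The facts \<open>g_run\<close> and
  \<open>g_block\<close> carry prefixes of \<open>g z\<close> over to \<open>z\<close>.\<close>

lemma Rel_ex_inv:
  assumes "no_top_tail v"
  shows "\<exists>w. Rel w v"
proof -
  let ?I = "{v. no_top_tail v}"
  have "\<exists>g. \<forall>v\<in>?I. \<exists>p z. gfac v p z \<and> z \<in> ?I \<and> g v = p @- g z"
  proof (rule stream_unfold)
    fix v assume v: "v \<in> ?I"
    then obtain p z where "gfac v p z" using gfac_ex by blast
    moreover from this have "p \<noteq> []" "\<exists>q. v = q @- z"
      by (auto elim!: gfac.cases) (metis shift.simps shift_append)+
    ultimately show "\<exists>p z. gfac v p z \<and> z \<in> ?I \<and> p \<noteq> []" using v no_top_tail_shift by blast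
  qed
  then obtain g where g: "\<And>v. no_top_tail v \<Longrightarrow> \<exists>p z. gfac v p z \<and> no_top_tail z \<and> g v = p @- g z" by auto
  have g_ga: "shd (g v) = ga \<longleftrightarrow> shd v = ga" if nt: "no_top_tail v" for v
  proof -
    obtain p z where pz: "gfac v p z" "g v = p @- g z" using g[OF nt] by blast
    from pz(1) show ?thesis by cases (use pz in \<open>auto dest: tgt_facts\<close>)
  qed
  have g_run: "run ga n (g v) \<Longrightarrow> run ga n v" if "no_top_tail v" for n v
    using that
  proof (induction n arbitrary: v)
    case (Suc n)
    obtain p z where pz: "gfac v p z" "no_top_tail z" "g v = p @- g z" using g[OF Suc.prems(2)] by blast
    from pz(1) show ?case by cases (use Suc pz in \<open>auto dest: tgt_facts\<close>)
  qed simp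
  have g_block: "g v = replicate m a @- de ## ga ## y \<Longrightarrow> \<exists>z. v = replicate m a @- de ## ga ## z"
    if "no_top_tail v" "a \<in> {al, be}" for m a v y
    using that
  proof (induction m arbitrary: v)
    case 0
    obtain p z where pz: "gfac v p z" "no_top_tail z" "g v = p @- g z" using g[OF 0(2)] by blast
    from pz(1) show ?case
    proof cases
      case (1 k)
      then have "shd z = ga" using g_ga[OF pz(2)] pz 0 by auto
      then have "z = ga ## stl z" by (metis stream.collapse)
      then show ?thesis using 1 pz 0 by auto
    qed (use 0 pz in \<open>auto dest: tgt_facts\<close>)
  next
    case (Suc m)
    obtain p z where pz: "gfac v p z" "no_top_tail z" "g v = p @- g z" using g[OF Suc.prems(2)] by blast
    from pz(1) show ?case
    proof cases
      case (1 k)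
      then show ?thesis using Suc pz by auto
    next
      case (2 i j b)
      then show ?thesis using Suc.prems pz distinct by (cases m) auto
    qed (use Suc pz in \<open>auto dest: tgt_facts\<close>)
  qed
  have "Rel (g v) v" using assms
  proof (coinduction arbitrary: v)
    case Rel
    obtain p z where pz: "gfac v p z" "no_top_tail z" "g v = p @- g z" using g[OF Rel] by blast
    have "\<exists>q. v = q @- z \<and> fac p q (g z)"
      using pz(1)
    proof cases
      case (1 k)
      have "\<not> special (k ## g z)"
      proof
        assume "special (k ## g z)"
        then consider (1) i j a y where "tgt i = Some (j, a)" "k ## g z = [i, ga, ga, ga] @- y"
          | (2) i j a m y where "tgt i = Some (j, a)" "k ## g z = j ## replicate (Suc m) a @- de ## ga ## y"
          unfolding special_def by blast
        then have "out_special (k ## z)"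
        proof cases
          case 1
          then have "run ga 3 (g z)" by (simp add: numeral_3_eq_3)
          then have "run ga 3 z" using g_run[OF pz(2)] by blast
          then have "\<exists>x. z = replicate 3 ga @- x" by (rule run_eq_replicate)
          then show ?thesis using 1 by (auto simp: numeral_3_eq_3 out_special_def)
        next
          case (2 i j a m y)
          then have "g z = replicate (Suc m) a @- de ## ga ## y" "k = j" by auto
          then obtain x where "z = replicate (Suc m) a @- de ## ga ## x"
            using g_block[OF pz(2), of a "Suc m" y] tgt_facts[OF 2(1)] by auto
          then show ?thesis using 2(1) \<open>k = j\<close> unfolding out_special_def by blast
        qed
        then show False using 1 by simp
      qed
      then show ?thesis using 1 plain by (intro exI[of _ "[k]"]) auto
    next
      case (2 i j a)
      then show ?thesis using check_in[OF 2(3)] by (intro exI[of _ "[j, a, de, ga]"]) auto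
    next
      case (3 i j a m)
      then show ?thesis using move_on[OF 3(3)] by (intro exI[of _ "j # replicate (Suc (Suc m)) a @ [de, ga]"]) auto
    next
      case (4 i j a m)
      then show ?thesis using check_out[OF 4(3)] g_ga[OF pz(2)]
        by (intro exI[of _ "i # replicate (Suc (Suc (Suc m))) ga"]) auto
    qed
    then show ?case using pz by blast
  qed
  then show ?thesis ..
qed

lemma sconst_top_tail:
  assumes "a \<noteq> b" shows "x @- i ## sconst a \<noteq> y @- j ## sconst b"
proof
  assume eq: "x @- i ## sconst a = y @- j ## sconst b"
  define n where "n = Suc (length x + length y)"
  have "n - length x = Suc (length y)" "n - length y = Suc (length x)" "length x \<le> n" "length y \<le> n"
    by (auto simp: n_def)
  then have "(x @- i ## sconst a) !! n = a" "(y @- j ## sconst b) !! n = b" by simp_all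
  then show False using eq assms by metis
qed

lemma Rel_onto:
  assumes "v \<in> streams A"
  shows "\<exists>w v'. Rel w v' \<and> (\<forall>n. near Q3 n v' v)"
proof (cases "no_top_tail v")
  case True
  then show ?thesis using Rel_ex_inv near_refl by blast
next
  case False
  then obtain x i j a where x: "v = x @- i ## sconst ga" "tgt i = Some (j, a)"
    using assms unfolding no_top_tail_def by auto
  note t = tgt_facts[OF x(2)]
  define v' where "v' = x @- j ## sconst a"
  have "v' \<in> streams A" using assms t x by (auto simp: v'_def streams_iff_sset)
  \<comment> \<open>One exchange is enough: the new word ends in a constant tail of a base letter
    and so has no tail of letters \<open>ga\<close>.\<close>
  moreover have "v' \<noteq> y @- k ## sconst ga" for y k
    unfolding v'_def by (rule sconst_top_tail) (use t in auto)
  ultimately have "no_top_tail v'" unfolding no_top_tail_def by blast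
  then obtain w where "Rel w v'" using Rel_ex_inv by blast
  moreover have "near Q3 n v' v" for n
  proof -
    have "near Q3 (Suc n) (j ## sconst a) (i ## sconst ga)"
      by (rule germ_near[of j a _ _ i ga]) (use t in \<open>auto simp: germ_def run_sconst_self\<close>)
    then show ?thesis unfolding v'_def x near_shift by (rule near_mono) simp
  qed
  ultimately show ?thesis by blast
qed

end

section \<open>Geometry of the triangle and the coding map\<close>

abbreviation corners :: "complex set" where
  "corners \<equiv> {omega_a, omega_b, omega_c}"

definition centre :: complex where "centre = Complex (1/2) (sqrt 3 / 6)"

text \<open>The barycentric coordinate of \<open>z\<close> at the corner \<open>v\<close>, written uniformly in \<open>v\<close>.\<close>

definition lam :: "complex \<Rightarrow> complex \<Rightarrow> real" where
  "lam v z = 1/3 + 2 * ((z - centre) \<bullet> (v - centre))"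

lemma lam_a: "lam omega_a z = 1 - Re z - Im z * sqrt 3 / 3"
  and lam_b: "lam omega_b z = Re z - Im z * sqrt 3 / 3"
  and lam_c: "lam omega_c z = 2 * Im z * sqrt 3 / 3"
  by (simp_all add: lam_def centre_def omega_a_def omega_b_def omega_c_def inner_complex_def algebra_simps)

lemma omega_Re_Im [simp]: "Re omega_a = 0" "Im omega_a = 0" "Re omega_b = 1" "Im omega_b = 0"
  "Re omega_c = 1/2" "Im omega_c = sqrt 3 / 2"
  by (simp_all add: omega_a_def omega_b_def omega_c_def)

lemma omega_distinct: "omega_a \<noteq> omega_b" "omega_a \<noteq> omega_c" "omega_b \<noteq> omega_c"
  by (simp_all add: complex_eq_iff)

text \<open>The vectors from \<open>centre\<close> to the corners have squared length 1/3 and mutual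
  inner products -1/6, which explains the constants 1/3 and 2 in \<open>lam\<close>.\<close>

lemma lam_corner: "v \<in> corners \<Longrightarrow> v' \<in> corners \<Longrightarrow> lam v v' = (if v = v' then 1 else 0)"
  using omega_distinct by (auto simp: lam_a lam_b lam_c)

lemma lam_sum: "lam omega_a z + lam omega_b z + lam omega_c z = 1"
  by (simp add: lam_a lam_b lam_c)

lemma lam_bary: "z = lam omega_a z *\<^sub>R omega_a + lam omega_b z *\<^sub>R omega_b + lam omega_c z *\<^sub>R omega_c"
  by (simp add: complex_eq_iff lam_a lam_b lam_c)

lemma lam_diff: "lam v x - lam v y = 2 * ((x - y) \<bullet> (v - centre))"
  by (simp add: lam_def algebra_simps inner_diff_left)

lemma lam_comb: "a + b + c = 1 \<Longrightarrow>
    lam v (a *\<^sub>R x + b *\<^sub>R y + c *\<^sub>R z) = a * lam v x + b * lam v y + c * lam v z"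
proof -
  assume *: "a + b + c = 1"
  have "centre = (a + b + c) *\<^sub>R centre" using * by simp
  then have "a *\<^sub>R x + b *\<^sub>R y + c *\<^sub>R z - centre = a *\<^sub>R (x - centre) + b *\<^sub>R (y - centre) + c *\<^sub>R (z - centre)"
    by (simp add: algebra_simps)
  then have "lam v (a *\<^sub>R x + b *\<^sub>R y + c *\<^sub>R z) = (a + b + c) / 3 + 2 * (a * ((x - centre) \<bullet> (v - centre))
      + b * ((y - centre) \<bullet> (v - centre)) + c * ((z - centre) \<bullet> (v - centre)))"
    using * by (simp add: lam_def inner_add_left)
  then show ?thesis by (simp add: lam_def algebra_simps)
qed

lemma Delta_iff: "z \<in> Delta \<longleftrightarrow> (\<forall>v\<in>corners. 0 \<le> lam v z)"
proof
  assume "z \<in> Delta"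
  then obtain a b c where *: "0 \<le> a" "0 \<le> b" "0 \<le> c" "a + b + c = 1"
    "z = a *\<^sub>R omega_a + b *\<^sub>R omega_b + c *\<^sub>R omega_c"
    unfolding Delta_def convex_hull_3 by auto
  then show "\<forall>v\<in>corners. 0 \<le> lam v z" using omega_distinct
    by (auto simp: lam_comb[OF *(4)] lam_corner)
next
  assume "\<forall>v\<in>corners. 0 \<le> lam v z"
  then show "z \<in> Delta" unfolding Delta_def convex_hull_3
    using lam_bary[of z] lam_sum[of z] by blast
qed

lemma compact_Delta: "compact Delta"
  unfolding Delta_def by (intro finite_imp_compact_convex_hull) simp

lemma corner_Delta: "v \<in> corners \<Longrightarrow> v \<in> Delta"
  by (auto simp: Delta_iff lam_corner)

lemma corner_dist: "v \<in> corners \<Longrightarrow> v' \<in> corners \<Longrightarrow> dist v v' \<le> 1"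
  by (auto simp: dist_complex_def cmod_def power_divide)

text \<open>The vector \<open>z - v\<close> combines the sides \<open>u - v\<close> with weights
  \<open>lam u z\<close>; the sides have length at most 1, and the weights away from
  \<open>v\<close> add up to \<open>1 - lam v z\<close>.\<close>

lemma dist_corner:
  assumes "z \<in> Delta" "v \<in> corners"
  shows "dist z v \<le> 1 - lam v z"
proof -
  have nn: "0 \<le> lam omega_a z" "0 \<le> lam omega_b z" "0 \<le> lam omega_c z" using assms by (auto simp: Delta_iff)
  have "v = (lam omega_a z + lam omega_b z + lam omega_c z) *\<^sub>R v" by (simp add: lam_sum)
  then have "z - v = lam omega_a z *\<^sub>R (omega_a - v) + lam omega_b z *\<^sub>R (omega_b - v) + lam omega_c z *\<^sub>R (omega_c - v)"
    using lam_bary[of z] by (simp add: algebra_simps)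
  then have "dist z v \<le> norm (lam omega_a z *\<^sub>R (omega_a - v)) + norm (lam omega_b z *\<^sub>R (omega_b - v)) + norm (lam omega_c z *\<^sub>R (omega_c - v))"
    unfolding dist_norm by (metis norm_triangle_ineq norm_triangle_le add_right_mono)
  also have "\<dots> = lam omega_a z * dist omega_a v + lam omega_b z * dist omega_b v + lam omega_c z * dist omega_c v"
    using nn by (simp add: dist_norm)
  also have "\<dots> \<le> 1 - lam v z"
  proof -
    have "lam u z * dist u v \<le> lam u z" if "u \<in> corners" for u
      using mult_left_le[OF corner_dist[OF that assms(2)]] nn that by auto
    from this[of omega_a] this[of omega_b] this[of omega_c] show ?thesis
      using assms(2) lam_sum[of z] by auto
  qed
  finally show ?thesis .
qed

lemma Delta_dist: "z \<in> Delta \<Longrightarrow> z' \<in> Delta \<Longrightarrow> dist z z' \<le> 2"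
  using dist_corner[of z omega_a] dist_corner[of z' omega_a] dist_triangle2[of z z' omega_a]
  by (auto simp: Delta_iff)

lemma Delta_corner_eq:
  assumes "v \<in> corners" "\<And>v'. v' \<in> corners \<Longrightarrow> v' \<noteq> v \<Longrightarrow> lam v' z = 0"
  shows "z = v"
  using assms lam_bary[of z] lam_sum[of z] omega_distinct by auto

lemma finite_pos_bound:
  assumes "finite T" "\<And>t. t \<in> T \<Longrightarrow> \<exists>c>0. P t (c::real)" "\<And>t c c'. P t c \<Longrightarrow> 0 < c' \<Longrightarrow> c' \<le> c \<Longrightarrow> P t c'"
  shows "\<exists>c>0. \<forall>t\<in>T. P t c"
  using assms(1,2)
proof (induction T)
  case empty
  then show ?case by (auto intro: exI[of _ 1])
next
  case (insert t T)
  then obtain c c' where "c > 0" "\<forall>t\<in>T. P t c" "c' > 0" "P t c'" by blast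
  then have pos: "0 < min c c'" by simp
  have "P t (min c c')" by (rule assms(3)[OF \<open>P t c'\<close> pos]) simp
  moreover have "P u (min c c')" if "u \<in> T" for u
    by (rule assms(3)[OF _ pos]) (use \<open>\<forall>t\<in>T. P t c\<close> that in auto)
  ultimately show ?case using pos by blast
qed

section \<open>Position of the cells\<close>

locale gasket =
  fixes N :: nat and r :: "nat \<Rightarrow> real" and d :: "nat \<Rightarrow> complex"
  assumes gasket: "fractal_gasket N r d"
begin

definition "A = {1..N}"
abbreviation "phi \<equiv> ifs_map r d"

lemma r_bounds: "j \<in> A \<Longrightarrow> 0 < r j \<and> r j < 1"
  and phi_Delta: "j \<in> A \<Longrightarrow> z \<in> Delta \<Longrightarrow> phi j z \<in> Delta"
  and phi_meet: "i \<in> A \<Longrightarrow> j \<in> A \<Longrightarrow> i \<noteq> j \<Longrightarrow>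
    phi i ` Delta \<inter> phi j ` Delta \<subseteq> phi i ` corners \<inter> phi j ` corners"
  and finite_A: "finite A" and one_A: "1 \<in> A"
  using gasket unfolding fractal_gasket_def A_def by (blast, blast, blast, simp, simp)

lemma r_nonneg: "j \<in> A \<Longrightarrow> 0 \<le> r j"
  using r_bounds less_imp_le by blast

lemma phi_diff: "phi j x - phi j y = r j *\<^sub>R (x - y)"
  by (simp add: ifs_map_def scaleR_conv_of_real algebra_simps)

lemma dist_phi: "j \<in> A \<Longrightarrow> dist (phi j x) (phi j y) = r j * dist x y"
  using r_bounds[of j] by (simp add: dist_norm phi_diff)

lemma phi_inj: "j \<in> A \<Longrightarrow> phi j x = phi j y \<longleftrightarrow> x = y"
  using dist_phi[of j x y] r_bounds[of j] by (metis dist_eq_0_iff less_irrefl mult_eq_0_iff)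

lemma lam_phi: "v \<in> corners \<Longrightarrow> v' \<in> corners \<Longrightarrow> v' \<noteq> v \<Longrightarrow> lam v (phi j z) = r j * lam v z + lam v (phi j v')"
  using lam_diff[of v "phi j z" "phi j v'"] lam_diff[of v z v'] by (simp add: phi_diff lam_corner)

text \<open>A coordinate that vanishes at \<open>v\<close> is, along \<open>phi j\<close>, a sum of
  two nonnegative terms, so both terms are zero.\<close>

lemma phi_corner:
  assumes "j \<in> A" "z \<in> Delta" "v \<in> corners" "phi j z = v"
  shows "z = v"
proof (rule Delta_corner_eq[OF assms(3)])
  fix v' assume v': "v' \<in> corners" "v' \<noteq> v"
  have "0 = r j * lam v' z + lam v' (phi j v)"
    using lam_phi[OF v'(1) assms(3), of j z] v' assms lam_corner by auto
  moreover have "0 \<le> lam v' (phi j v)" "0 \<le> lam v' z"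
    using phi_Delta[OF assms(1)] corner_Delta[OF assms(3)] v' assms(2) by (auto simp: Delta_iff)
  ultimately show "lam v' z = 0" using r_bounds[OF assms(1)]
    by (metis add_nonneg_eq_0_iff mult_eq_0_iff less_eq_real_def less_irrefl mult_nonneg_nonneg)
qed

lemma centre_Delta: "centre \<in> Delta" "centre \<notin> corners"
  by (auto simp: Delta_iff lam_a lam_b lam_c) (auto simp: centre_def complex_eq_iff)

text \<open>Cells are homothetic, so two of them with the same corner in common are nested. Then the
  centre of the smaller one lies in both, although it is not a vertex.\<close>

lemma phi_same_corner_aux:
  assumes "i \<in> A" "j \<in> A" "v \<in> corners" "phi i v = phi j v" "r i \<le> r j"
  shows "i = j"
proof (rule ccontr)
  assume "i \<noteq> j"
  define t where "t = r i / r j"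
  have t: "0 \<le> t" "t \<le> 1" using assms r_bounds[of i] r_bounds[of j] by (auto simp: t_def)
  \<comment> \<open>The preimage under \<open>phi j\<close> of the centre of the cell
    \<open>i\<close>; the zero summand only fits the form of \<open>lam_comb\<close>.\<close>
  define z where "z = (1 - t) *\<^sub>R v + t *\<^sub>R centre + 0 *\<^sub>R v"
  have "lam u z = (1 - t) * lam u v + t * lam u centre" for u
    using lam_comb[of "1 - t" t 0 u v centre v] by (simp add: z_def)
  then have "z \<in> Delta" using t centre_Delta(1) corner_Delta[OF assms(3)]
    by (auto simp: Delta_iff)
  have "phi j z - phi j v = r i *\<^sub>R (centre - v)"
    using r_bounds[OF assms(2)] by (simp add: phi_diff z_def t_def algebra_simps)
  then have "phi i centre - phi i v = phi j z - phi i v" using phi_diff[of i centre v] assms(4) by simp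
  then have "phi i centre = phi j z" by simp
  then have "phi i centre \<in> phi i ` corners"
    using phi_meet[OF assms(1,2) \<open>i \<noteq> j\<close>] \<open>z \<in> Delta\<close> centre_Delta(1) by blast
  then show False using phi_inj[OF assms(1)] centre_Delta(2) by blast
qed

lemma phi_same_corner:
  "i \<in> A \<Longrightarrow> j \<in> A \<Longrightarrow> v \<in> corners \<Longrightarrow> phi i v = phi j v \<Longrightarrow> i = j"
  using phi_same_corner_aux[of i j v] phi_same_corner_aux[of j i v] by fastforce

text \<open>Two cells touching at a point lie on different sides of a line through it; the functional
  \<open>lam v - lam v'\<close> separates them with a definite angle.\<close>

lemma contact_separation:
  assumes "i \<in> A" "j \<in> A" "i \<noteq> j" "v \<in> corners" "v' \<in> corners" "phi i v = phi j v'"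
    "x \<in> phi i ` Delta" "y \<in> phi j ` Delta"
  shows "dist x (phi i v) + dist y (phi i v) \<le> 2 * dist x y"
proof -
  have ne: "v \<noteq> v'" using phi_same_corner assms by blast
  obtain z z' where z: "z \<in> Delta" "x = phi i z" "z' \<in> Delta" "y = phi j z'" using assms by blast
  have nn: "0 \<le> lam v z" "0 \<le> lam v' z" "0 \<le> lam v z'" "0 \<le> lam v' z'" using z assms Delta_iff by blast+
  define psi where "psi u = lam v u - lam v' u" for u
  have psi_diff: "psi u - psi w = 2 * ((u - w) \<bullet> (v - v'))" for u w
    using lam_diff[of v u w] lam_diff[of v' u w] by (simp add: psi_def inner_diff_right)
  have psi_phi: "psi (phi k u) - psi (phi k w) = r k * (psi u - psi w)" for k u w
    unfolding psi_diff phi_diff by simp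
  have corner_vals: "psi v = 1" "psi v' = -1" using assms ne by (auto simp: psi_def lam_corner)
  have "dist x (phi i v) = r i * dist z v" using z dist_phi[OF assms(1)] by simp
  also have "\<dots> \<le> r i * (psi v - psi z)"
    using dist_corner[OF z(1) assms(4)] r_bounds[OF assms(1)] nn corner_vals
    by (intro mult_left_mono) (auto simp: psi_def)
  also have "\<dots> = psi (phi i v) - psi x" using psi_phi z by simp
  finally have 1: "dist x (phi i v) \<le> psi (phi i v) - psi x" .
  have "dist y (phi j v') = r j * dist z' v'" using z dist_phi[OF assms(2)] by simp
  also have "\<dots> \<le> r j * (psi z' - psi v')"
    using dist_corner[OF z(3) assms(5)] r_bounds[OF assms(2)] nn corner_vals
    by (intro mult_left_mono) (auto simp: psi_def)
  also have "\<dots> = psi y - psi (phi j v')" using psi_phi z by simp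
  finally have 2: "dist y (phi i v) \<le> psi y - psi (phi i v)" using assms(6) by simp
  have "psi y - psi x \<le> 2 * (norm (y - x) * norm (v - v'))"
    unfolding psi_diff using norm_cauchy_schwarz[of "y - x" "v - v'"] by simp
  \<comment> \<open>Corners are at distance at most 1, so only the factor 2 of
    \<open>psi_diff\<close> remains.\<close>
  also have "\<dots> \<le> 2 * dist x y"
    using corner_dist[OF assms(4,5)] mult_left_le[of "dist v v'" "dist x y"]
    by (simp add: dist_norm norm_minus_commute)
  finally show ?thesis using 1 2 by simp
qed

section \<open>The coding map and the attractor\<close>

text \<open>The expansion of \<open>phi (w !! 0) (phi (w !! 1) ...)\<close>. Since
  \<open>phi j z\<close> scales \<open>z + d j\<close>, the translation \<open>d (w !! n)\<close>
  also carries its own ratio, and the product includes \<open>n\<close>.\<close>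

definition cod :: "nat stream \<Rightarrow> complex" where
  "cod w = (\<Sum>n. (\<Prod>k\<le>n. r (w !! k)) *\<^sub>R d (w !! n))"

definition rmax :: real where "rmax = Max (r ` A)"
definition dmax :: real where "dmax = Max ((norm \<circ> d) ` A)"

lemma rmax: "j \<in> A \<Longrightarrow> r j \<le> rmax" "0 < rmax" "rmax < 1"
proof -
  have ne: "r ` A \<noteq> {}" using one_A by auto
  show "j \<in> A \<Longrightarrow> r j \<le> rmax" unfolding rmax_def using finite_A by simp
  have "rmax \<in> r ` A" unfolding rmax_def by (rule Max_in) (use ne finite_A in auto)
  then show "0 < rmax" "rmax < 1" using r_bounds by auto
qed

lemma dmax: "j \<in> A \<Longrightarrow> norm (d j) \<le> dmax"
  unfolding dmax_def by (rule Max_ge) (use finite_A in auto)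

lemma prod_le:
  assumes "w \<in> streams A"
  shows "0 \<le> (\<Prod>k\<le>n. r (w !! k)) \<and> (\<Prod>k\<le>n. r (w !! k)) \<le> rmax ^ n"
proof -
  have w: "0 \<le> r (w !! k) \<and> r (w !! k) \<le> rmax" for k
    using snth_in[OF assms] rmax(1) r_bounds less_imp_le by meson
  then have "(\<Prod>k\<le>n. r (w !! k)) \<le> (\<Prod>k\<le>n. rmax)" by (intro prod_mono) auto
  also have "\<dots> = rmax * rmax ^ n" by simp
  also have "\<dots> \<le> 1 * rmax ^ n" using rmax by (intro mult_right_mono) auto
  finally show ?thesis using w by (auto intro: prod_nonneg)
qed

lemma cod_term:
  assumes "w \<in> streams A"
  shows "norm ((\<Prod>k\<le>n. r (w !! k)) *\<^sub>R d (w !! n)) \<le> rmax ^ n * dmax"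
  using prod_le[OF assms, of n] dmax[OF snth_in[OF assms], of n] rmax(2) by (auto intro!: mult_mono)

lemma bound_summable: "summable (\<lambda>n. rmax ^ n * dmax)"
  using rmax by (intro summable_mult2 summable_geometric) auto

lemma cod_summable:
  assumes "w \<in> streams A"
  shows "summable (\<lambda>n. (\<Prod>k\<le>n. r (w !! k)) *\<^sub>R d (w !! n))"
  by (rule summable_comparison_test'[OF bound_summable, of 0]) (use cod_term[OF assms] in auto)

lemma cod_bounded: "w \<in> streams A \<Longrightarrow> norm (cod w) \<le> (\<Sum>n. rmax ^ n * dmax)"
  unfolding cod_def by (rule norm_suminf_le) (use cod_term bound_summable in auto)

lemma cod_Cons:
  assumes "k \<in> A" "w \<in> streams A"
  shows "cod (k ## w) = phi k (cod w)"
proof -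
  let ?f = "\<lambda>n. (\<Prod>i\<le>n. r ((k ## w) !! i)) *\<^sub>R d ((k ## w) !! n)"
  have s: "summable ?f" using assms by (intro cod_summable) simp
  have "(\<Prod>i\<le>Suc n. r ((k ## w) !! i)) = r k * (\<Prod>k\<le>n. r (w !! k))" for n
    by (subst prod.atMost_Suc_shift) simp
  then have "?f (Suc n) = r k *\<^sub>R ((\<Prod>k\<le>n. r (w !! k)) *\<^sub>R d (w !! n))" for n
    by (simp del: prod.atMost_Suc)
  then have "(\<lambda>n. ?f (Suc n)) = (\<lambda>n. r k *\<^sub>R ((\<Prod>k\<le>n. r (w !! k)) *\<^sub>R d (w !! n)))" by blast
  then have "(\<Sum>n. ?f (Suc n)) = r k *\<^sub>R cod w"
    unfolding cod_def using suminf_scaleR_right[OF cod_summable[OF assms(2)], of "r k"] by metis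
  moreover have "cod (k ## w) = (\<Sum>n. ?f (Suc n)) + ?f 0" unfolding cod_def using suminf_split_head[OF s] by simp
  ultimately show ?thesis by (simp add: ifs_map_def scaleR_conv_of_real algebra_simps)
qed

lemma cod_unfold: "w \<in> streams A \<Longrightarrow> cod w = phi (shd w) (cod (stl w))"
  using cod_Cons[of "shd w" "stl w"] streams_shd streams_stl by fastforce

primrec iter :: "nat \<Rightarrow> nat stream \<Rightarrow> complex \<Rightarrow> complex" where
  "iter 0 w z = z"
| "iter (Suc n) w z = phi (shd w) (iter n (stl w) z)"

lemma cod_iter_dist:
  assumes "w \<in> streams A"
  shows "dist (cod w) (iter n w z) \<le> rmax ^ n * ((\<Sum>n. rmax ^ n * dmax) + norm z)"
  using assms
proof (induction n arbitrary: w)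
  case 0
  then show ?case using cod_bounded[of w] norm_triangle_ineq4[of "cod w" z] by (simp add: dist_norm)
next
  case (Suc n)
  have k: "shd w \<in> A" and w: "stl w \<in> streams A" using Suc.prems streams_shd streams_stl by auto
  have "dist (cod w) (iter (Suc n) w z) = r (shd w) * dist (cod (stl w)) (iter n (stl w) z)"
    using cod_unfold[OF Suc.prems] dist_phi[OF k] by simp
  also have "\<dots> \<le> rmax * (rmax ^ n * ((\<Sum>n. rmax ^ n * dmax) + norm z))"
    using Suc.IH[OF w] rmax k by (intro mult_mono) auto
  finally show ?case by (simp add: mult.assoc)
qed

text \<open>The base point may vary with \<open>n\<close> as long as it stays bounded; in
  \<open>bounded_coded\<close> it runs through successive preimages.\<close>

lemma cod_iter_lim:
  assumes "w \<in> streams A" "\<And>n. norm (f n) \<le> C"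
  shows "(\<lambda>n. iter n w (f n)) \<longlonglongrightarrow> cod w"
proof -
  let ?D = "(\<Sum>n. rmax ^ n * dmax) + C"
  have "(\<lambda>n. rmax ^ n * ?D) \<longlonglongrightarrow> 0 * ?D"
    using rmax by (intro tendsto_mult LIMSEQ_realpow_zero tendsto_const) auto
  then have l: "(\<lambda>n. rmax ^ n * ?D) \<longlonglongrightarrow> 0" by simp
  have "dist (iter n w (f n)) (cod w) \<le> rmax ^ n * ?D" for n
  proof -
    have "rmax ^ n * ((\<Sum>n. rmax ^ n * dmax) + norm (f n)) \<le> rmax ^ n * ?D"
      using assms(2)[of n] rmax by (intro mult_left_mono) auto
    then show ?thesis using cod_iter_dist[OF assms(1), of n "f n"] by (simp add: dist_commute)
  qed
  then show ?thesis
    by (intro metric_tendsto_imp_tendsto[OF l]) (auto intro!: always_eventually order_trans[OF _ abs_ge_self])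
qed

lemma cod_in_closed:
  assumes "closed X" "X \<noteq> {}" "\<And>j. j \<in> A \<Longrightarrow> phi j ` X \<subseteq> X" "w \<in> streams A"
  shows "cod w \<in> X"
proof -
  obtain x where "x \<in> X" using assms by blast
  have "w \<in> streams A \<Longrightarrow> iter n w x \<in> X" for n w
  proof (induction n arbitrary: w)
    case (Suc n)
    then have "iter n (stl w) x \<in> X" using streams_stl[OF Suc.prems] by blast
    then show ?case using assms(3)[OF streams_shd[OF Suc.prems]] by auto
  qed (use \<open>x \<in> X\<close> in simp)
  moreover have "(\<lambda>n. iter n w x) \<longlonglongrightarrow> cod w" by (rule cod_iter_lim[OF assms(4), of _ "norm x"]) simp
  ultimately show ?thesis using closed_sequentially[OF assms(1), of "\<lambda>n. iter n w x"] assms(4) by blast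
qed

text \<open>Repeated choice of a preimage in \<open>X\<close> spells out an address of the point;
  boundedness of \<open>X\<close> makes the truncated codes converge to it. This gives both
  compactness of the coded set and uniqueness of the attractor.\<close>

lemma bounded_coded:
  assumes "bounded X" "X \<subseteq> (\<Union>j\<in>A. phi j ` X)"
  shows "X \<subseteq> cod ` streams A"
proof
  fix x assume x: "x \<in> X"
  obtain C where C: "\<And>y. y \<in> X \<Longrightarrow> norm y \<le> C" using assms(1) by (auto simp: bounded_iff)
  have "\<exists>h. \<forall>x\<in>X. \<exists>q y. (\<exists>j\<in>A. q = [j] \<and> x = phi j y) \<and> y \<in> X \<and> h x = q @- h y"
    by (rule stream_unfold) (use assms(2) in blast)
  then obtain h where h: "\<And>x. x \<in> X \<Longrightarrow> \<exists>j\<in>A. \<exists>y. x = phi j y \<and> y \<in> X \<and> h x = j ## h y" by fastforce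
  have hs: "h x \<in> streams A" if "x \<in> X" for x
    using that
  proof (coinduction arbitrary: x)
    case (streams u) then show ?case using h[of u] by blast
  qed
  have "\<exists>y\<in>X. x = iter n (h x) y" if "x \<in> X" for n x
    using that
  proof (induction n arbitrary: x)
    case (Suc n)
    obtain j y where "j \<in> A" "x = phi j y" "y \<in> X" "h x = j ## h y" using h[OF Suc.prems] by blast
    then show ?case using Suc.IH[of y] by (metis iter.simps(2) stream.sel)
  qed auto
  then have "\<forall>n. \<exists>y. y \<in> X \<and> x = iter n (h x) y" using x by blast
  then obtain f where f: "\<And>n. f n \<in> X \<and> x = iter n (h x) (f n)" by metis
  have "(\<lambda>n. iter n (h x) (f n)) \<longlonglongrightarrow> cod (h x)" by (rule cod_iter_lim[OF hs[OF x]]) (use C f in blast)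
  moreover have "(\<lambda>n. iter n (h x) (f n)) = (\<lambda>n. x)" using f by auto
  ultimately have "x = cod (h x)" using LIMSEQ_unique by (metis tendsto_const)
  then show "x \<in> cod ` streams A" using hs[OF x] by blast
qed

lemma phi_continuous: "continuous_on X (phi j)"
  unfolding ifs_map_def by (intro continuous_intros)

lemma cod_image: "cod ` streams A = (\<Union>j\<in>A. phi j ` cod ` streams A)"
proof
  show "cod ` streams A \<subseteq> (\<Union>j\<in>A. phi j ` cod ` streams A)"
    using cod_unfold streams_shd streams_stl by fast
  show "(\<Union>j\<in>A. phi j ` cod ` streams A) \<subseteq> cod ` streams A"
    using cod_Cons by (auto simp flip: cod_Cons)
qed

lemma streams_ne: "streams A \<noteq> {}"
proof -
  have "sconst 1 \<in> streams A" using one_A by (auto simp: streams_iff_sset)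
  then show ?thesis by blast
qed

text \<open>No topology on words is involved: the closure is covered by its own images, hence it
  consists of coded points.\<close>

lemma compact_cod: "compact (cod ` streams A)"
proof -
  let ?K = "cod ` streams A"
  have "bounded ?K" using cod_bounded by (auto simp: bounded_iff)
  then have c: "compact (closure ?K)" by (simp add: compact_closure)
  have "compact (\<Union>j\<in>A. phi j ` closure ?K)"
    by (intro compact_UN compact_continuous_image phi_continuous c finite_A) 
  moreover have "?K \<subseteq> (\<Union>j\<in>A. phi j ` closure ?K)"
    by (subst cod_image) (intro UN_mono image_mono closure_subset order_refl)
  ultimately have "closure ?K \<subseteq> (\<Union>j\<in>A. phi j ` closure ?K)" by (intro closure_minimal compact_imp_closed)
  then have "closure ?K \<subseteq> ?K" by (intro bounded_coded compact_imp_bounded[OF c])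
  then show ?thesis using c closure_subset by (metis subset_antisym)
qed

lemma attractor_cod: "attractor N r d = cod ` streams A"
  unfolding attractor_def A_def[symmetric]
proof (rule the_equality)
  show "cod ` streams A \<noteq> {} \<and> compact (cod ` streams A) \<and> cod ` streams A = (\<Union>j\<in>A. phi j ` cod ` streams A)"
    by (intro conjI compact_cod cod_image) (simp add: streams_ne)
  fix K assume K: "K \<noteq> {} \<and> compact K \<and> K = (\<Union>j\<in>A. phi j ` K)"
  have "K \<subseteq> cod ` streams A" by (rule bounded_coded) (use K compact_imp_bounded in auto)
  moreover have "cod w \<in> K" if "w \<in> streams A" for w
    by (rule cod_in_closed[OF compact_imp_closed _ _ that]) (use K in blast)+
  ultimately show "K = cod ` streams A" by blast
qed

lemma cod_Delta: "w \<in> streams A \<Longrightarrow> cod w \<in> Delta"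
  using cod_in_closed[of Delta w] compact_imp_closed[OF compact_Delta] phi_Delta corner_Delta[of omega_a] by auto

section \<open>Distance and combinatorial closeness\<close>

text \<open>The fixed point of \<open>phi e\<close>, given by its constant address; for a corner
  letter it is a corner of the triangle.\<close>

definition pole :: "nat \<Rightarrow> complex" where
  "pole e = cod (sconst e)"

lemma pole_phi:
  assumes "e \<in> A"
  shows "phi e (pole e) = pole e" "pole e \<in> Delta"
proof -
  have s: "sconst e \<in> streams A" using assms by (auto simp: streams_iff_sset)
  show "phi e (pole e) = pole e" using cod_unfold[OF s] by (simp add: pole_def)
  show "pole e \<in> Delta" unfolding pole_def by (rule cod_Delta[OF s])
qed

lemma pole_eq:
  assumes "e \<in> A" "phi e v = v"
  shows "pole e = v"
proof -
  have "dist (pole e) v = r e * dist (pole e) v"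
    using dist_phi[OF assms(1), of "pole e" v] pole_phi assms by simp
  then show ?thesis using r_bounds[OF assms(1)] by simp
qed

definition pt :: "nat \<Rightarrow> nat \<Rightarrow> complex" where
  "pt k e = phi k (pole e)"

definition corner_letters :: "nat set \<Rightarrow> bool" where
  "corner_letters S \<longleftrightarrow> S \<subseteq> A \<and> (\<forall>e\<in>S. \<exists>v\<in>corners. phi e v = v)"

lemma corner_lettersD: "corner_letters S \<Longrightarrow> e \<in> S \<Longrightarrow> e \<in> A \<and> pole e \<in> corners \<and> phi e (pole e) = pole e"
  unfolding corner_letters_def using pole_eq by (metis subsetD)

lemma run_upper:
  assumes "corner_letters S" "e \<in> S" "\<And>j. j \<in> A \<Longrightarrow> r j \<le> hi" "y \<in> streams A" "run e n y"
  shows "dist (cod y) (pole e) \<le> 2 * hi ^ n"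
  using assms(4,5)
proof (induction n arbitrary: y)
  note e = corner_lettersD[OF assms(1,2)]
  case 0 
  have "dist (cod y) (pole e) \<le> 2"
    by (rule Delta_dist[OF cod_Delta[OF 0(1)] pole_phi(2)]) (use e in blast)
  then show ?case unfolding power_0 mult_1_right .
next
  case (Suc n)
  note e = corner_lettersD[OF assms(1,2)]
  have hi: "0 \<le> hi" using assms(3)[of e] r_bounds[of e] e by auto
  have "dist (cod y) (pole e) = dist (phi e (cod (stl y))) (phi e (pole e))"
    using cod_unfold[OF Suc.prems(1)] Suc.prems e by simp
  also have "\<dots> = r e * dist (cod (stl y)) (pole e)" using dist_phi e by blast
  also have "\<dots> \<le> hi * (2 * hi ^ n)"
    using Suc assms(3) e streams_stl hi by (intro mult_mono) auto
  finally show ?case by simp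
qed

text \<open>Words with different first letters are joined through the contact point by two legs,
  each bounded with the diameter bound 2; hence the constant 4.\<close>

lemma near_upper:
  assumes "corner_letters S" "\<And>j. j \<in> A \<Longrightarrow> r j \<le> hi" "w \<in> streams A" "w' \<in> streams A"
    "near (contact pt S) n w w'"
  shows "dist (cod w) (cod w') \<le> 4 * hi ^ n"
  using assms(3-5)
proof (induction n arbitrary: w w')
  case 0 then show ?case using Delta_dist[OF cod_Delta cod_Delta, of w w'] by simp
next
  case (Suc n)
  let ?k = "shd w" and ?k' = "shd w'"
  have k: "?k \<in> A" "?k' \<in> A" and y: "stl w \<in> streams A" "stl w' \<in> streams A"
    using Suc.prems streams_shd streams_stl by auto
  have hi: "0 \<le> hi" using assms(2)[of ?k] r_bounds[of ?k] k by auto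
  note cw = cod_unfold[OF Suc.prems(1)] cod_unfold[OF Suc.prems(2)]
  show ?case
  proof (cases "?k = ?k'")
    case True
    then have "dist (cod w) (cod w') = r ?k * dist (cod (stl w)) (cod (stl w'))" using cw dist_phi k by metis
    also have "\<dots> \<le> hi * (4 * hi ^ n)" using Suc True k y assms(2) hi by (intro mult_mono) auto
    finally show ?thesis by simp
  next
    case False
    then obtain e e' where e: "e \<in> S" "e' \<in> S" "pt ?k e = pt ?k' e'" "run e n (stl w)" "run e' n (stl w')"
      using Suc.prems(3) by (auto simp: contact_def)
    have "dist (cod w) (pt ?k e) = r ?k * dist (cod (stl w)) (pole e)" using cw(1) dist_phi[OF k(1)] by (simp add: pt_def)
    also have "\<dots> \<le> hi * (2 * hi ^ n)" using run_upper[OF assms(1) e(1) assms(2) y(1) e(4)] assms(2) k hi by (intro mult_mono) auto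
    finally have 1: "dist (cod w) (pt ?k e) \<le> 2 * hi ^ Suc n" by simp
    have "dist (cod w') (pt ?k e) = r ?k' * dist (cod (stl w')) (pole e')" using cw(2) dist_phi[OF k(2)] e(3) by (simp add: pt_def)
    also have "\<dots> \<le> hi * (2 * hi ^ n)" using run_upper[OF assms(1) e(2) assms(2) y(2) e(5)] assms(2) k hi by (intro mult_mono) auto
    finally have 2: "dist (cod w') (pt ?k e) \<le> 2 * hi ^ Suc n" by simp
    show ?thesis using 1 2 dist_triangle2[of "cod w" "cod w'" "pt ?k e"] by simp
  qed
qed

text \<open>By \<open>phi_corner\<close> another cell could reach \<open>pole e\<close> only with
  the same corner, which \<open>phi_same_corner\<close> forbids. Compactness turns this into a
  gap.\<close>

lemma corner_gap:
  assumes "corner_letters S"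
  shows "\<exists>c>0. \<forall>e\<in>S. \<forall>k\<in>A. k \<noteq> e \<longrightarrow> (\<forall>y\<in>streams A. c \<le> dist (phi k (cod y)) (pole e))"
proof -
  have fin: "finite (S \<times> A)" using assms finite_subset finite_A by (auto simp: corner_letters_def)
  let ?P = "\<lambda>t c. snd t \<noteq> fst t \<longrightarrow> (\<forall>y\<in>streams A. c \<le> dist (phi (snd t) (cod y)) (pole (fst t)))"
  have "\<exists>c>0. \<forall>t\<in>S \<times> A. ?P t c"
  proof (rule finite_pos_bound[OF fin])
    fix t assume t: "t \<in> S \<times> A"
    obtain e k where ek: "t = (e, k)" "e \<in> S" "k \<in> A" using t by auto
    note e = corner_lettersD[OF assms ek(2)]
    show "\<exists>c>0. ?P t c"
    proof (cases "k = e")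
      case True then show ?thesis using ek by (auto intro: exI[of _ 1])
    next
      case False
      have "compact (phi k ` cod ` streams A)" by (intro compact_continuous_image phi_continuous compact_cod)
      moreover have "pole e \<notin> phi k ` cod ` streams A"
      proof
        assume "pole e \<in> phi k ` cod ` streams A"
        then obtain y where y: "y \<in> streams A" "phi k (cod y) = pole e" by auto
        then have "cod y = pole e" using phi_corner[OF ek(3) cod_Delta] e by blast
        then have "k = e" using phi_same_corner[OF ek(3), of e "pole e"] e y by auto
        then show False using False by simp
      qed
      ultimately obtain c where c: "c > 0" "\<forall>y\<in>phi k ` cod ` streams A. c \<le> dist (pole e) y"
        using separate_point_closed[OF compact_imp_closed, of "phi k ` cod ` streams A" "pole e"] by metis
      show ?thesis
      proof (intro exI[of _ c] conjI c(1) impI ballI)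
        fix y assume "y \<in> streams A"
        then have "c \<le> dist (pole e) (phi k (cod y))" using c(2) by blast
        then show "c \<le> dist (phi (snd t) (cod y)) (pole (fst t))"
          using ek(1) by (simp add: dist_commute)
      qed
    qed
  qed auto
  then show ?thesis by force
qed

lemma cell_gap:
  "\<exists>c>0. \<forall>i\<in>A. \<forall>j\<in>A. phi i ` cod ` streams A \<inter> phi j ` cod ` streams A = {} \<longrightarrow>
    (\<forall>w\<in>streams A. \<forall>w'\<in>streams A. c \<le> dist (phi i (cod w)) (phi j (cod w')))"
proof -
  let ?E = "\<lambda>i. phi i ` cod ` streams A"
  let ?P = "\<lambda>t c. ?E (fst t) \<inter> ?E (snd t) = {} \<longrightarrow>
    (\<forall>w\<in>streams A. \<forall>w'\<in>streams A. c \<le> dist (phi (fst t) (cod w)) (phi (snd t) (cod w')))"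
  have "\<exists>c>0. \<forall>t\<in>A \<times> A. ?P t c"
  proof (rule finite_pos_bound)
    fix t assume "t \<in> A \<times> A"
    have c: "compact (?E i)" for i by (intro compact_continuous_image phi_continuous compact_cod)
    show "\<exists>c>0. ?P t c"
    proof (cases "?E (fst t) \<inter> ?E (snd t) = {}")
      case True
      then obtain c where c': "c > 0" "\<forall>x\<in>?E (fst t). \<forall>y\<in>?E (snd t). c \<le> dist x y"
        using separate_compact_closed[OF c[of "fst t"] compact_imp_closed[OF c[of "snd t"]]] by metis
      show ?thesis
      proof (intro exI[of _ c] conjI c'(1) impI ballI)
        fix w w' assume "w \<in> streams A" "w' \<in> streams A"
        then have "phi (fst t) (cod w) \<in> ?E (fst t)" "phi (snd t) (cod w') \<in> ?E (snd t)" by blast+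
        then show "c \<le> dist (phi (fst t) (cod w)) (phi (snd t) (cod w'))" using c'(2) by blast
      qed
    next
      case False then show ?thesis by (intro exI[of _ 1]) auto
    qed
  qed (simp add: finite_A, force)
  then show ?thesis by force
qed

lemma run_lower:
  assumes "corner_letters S" "e \<in> S" "\<And>j. j \<in> A \<Longrightarrow> lo \<le> r j" "0 < lo" "0 < c" "y \<in> streams A" "\<not> run e n y"
    "\<forall>k\<in>A. k \<noteq> e \<longrightarrow> (\<forall>y\<in>streams A. c \<le> dist (phi k (cod y)) (pole e))"
  shows "c * lo ^ n \<le> dist (cod y) (pole e)"
  using assms(6,7)
proof (induction n arbitrary: y)
  case (Suc n)
  note e = corner_lettersD[OF assms(1,2)]
  have lo1: "lo \<le> 1" using assms(3)[of e] r_bounds[of e] e by auto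
  have k: "shd y \<in> A" and y: "stl y \<in> streams A" using Suc.prems streams_shd streams_stl by auto
  show ?case
  proof (cases "shd y = e")
    case True
    then have "dist (cod y) (pole e) = dist (phi e (cod (stl y))) (phi e (pole e))"
      using cod_unfold[OF Suc.prems(1)] e by simp
    also have "\<dots> = r e * dist (cod (stl y)) (pole e)" using dist_phi e by blast
    also have "\<dots> \<ge> lo * (c * lo ^ n)"
      using Suc.IH[OF y] Suc.prems True assms(3,4,5) e by (intro mult_mono) (auto intro: less_imp_le r_nonneg)
    finally show ?thesis by (simp add: mult.left_commute)
  next
    case False
    then have "c \<le> dist (cod y) (pole e)" using assms(8) k y cod_unfold[OF Suc.prems(1)] by auto
    moreover have "c * lo ^ Suc n \<le> c" using assms(4,5) lo1 power_le_one[of lo "Suc n"] mult_left_le[of "lo ^ Suc n" c] by auto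
    ultimately show ?thesis by linarith
  qed
qed simp

text \<open>Where the words first differ, their pieces are disjoint with a uniform gap, or their
  cells touch at a contact point from \<open>S\<close>. In the second case one word leaves the run
  towards that point too early, and \<open>contact_separation\<close> turns its distance from the
  point into a distance between the two points.\<close>

lemma near_lower:
  assumes "corner_letters S" "\<And>j. j \<in> A \<Longrightarrow> lo \<le> r j" "0 < lo"
    "\<And>i j. i \<in> A \<Longrightarrow> j \<in> A \<Longrightarrow> i \<noteq> j \<Longrightarrow> phi i ` cod ` streams A \<inter> phi j ` cod ` streams A \<noteq> {} \<Longrightarrow>
      \<exists>e\<in>S. \<exists>e'\<in>S. pt i e = pt j e'"
  shows "\<exists>c>0. \<forall>n. \<forall>w\<in>streams A. \<forall>w'\<in>streams A. \<not> near (contact pt S) n w w' \<longrightarrow> c * lo ^ n \<le> dist (cod w) (cod w')"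
proof -
  obtain c1 where c1: "c1 > 0" "\<forall>e\<in>S. \<forall>k\<in>A. k \<noteq> e \<longrightarrow> (\<forall>y\<in>streams A. c1 \<le> dist (phi k (cod y)) (pole e))"
    using corner_gap[OF assms(1)] by blast
  obtain c2 where c2: "c2 > 0" "\<And>i j w w'. i \<in> A \<Longrightarrow> j \<in> A \<Longrightarrow> w\<in>streams A \<Longrightarrow> w'\<in>streams A \<Longrightarrow>
    phi i ` cod ` streams A \<inter> phi j ` cod ` streams A = {} \<Longrightarrow> c2 \<le> dist (phi i (cod w)) (phi j (cod w'))"
    using cell_gap by blast
  \<comment> \<open>Halving \<open>c1\<close> absorbs the factor 2 of
    \<open>contact_separation\<close>.\<close>
  define c where "c = min (c1 / 2) c2"
  have c: "c > 0" "c \<le> c1 / 2" "c \<le> c2" using c1 c2 by (auto simp: c_def)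
  have lo1: "lo \<le> 1" using assms(2)[of 1] r_bounds[of 1] one_A by auto
  have "c * lo ^ n \<le> dist (cod w) (cod w')"
    if "w \<in> streams A" "w' \<in> streams A" "\<not> near (contact pt S) n w w'" for n w w'
    using that
  proof (induction n arbitrary: w w')
    case (Suc n)
    let ?k = "shd w" and ?k' = "shd w'"
    have k: "?k \<in> A" "?k' \<in> A" and y: "stl w \<in> streams A" "stl w' \<in> streams A"
      using Suc.prems streams_shd streams_stl by auto
    note cw = cod_unfold[OF Suc.prems(1)] cod_unfold[OF Suc.prems(2)]
    show ?case
    proof (cases "?k = ?k'")
      case True
      then have "dist (cod w) (cod w') = r ?k * dist (cod (stl w)) (cod (stl w'))" using cw dist_phi k by metis
      also have "\<dots> \<ge> lo * (c * lo ^ n)" using Suc True k y assms(2,3) c by (intro mult_mono) (auto intro: less_imp_le r_nonneg)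
      finally show ?thesis by (simp add: mult.left_commute)
    next
      case False
      show ?thesis
      proof (cases "phi ?k ` cod ` streams A \<inter> phi ?k' ` cod ` streams A = {}")
        case True
        have "c * lo ^ Suc n \<le> c" using assms(3) c lo1 power_le_one[of lo "Suc n"] mult_left_le[of "lo ^ Suc n" c] by auto
        also have "c \<le> dist (cod w) (cod w')" using c2(2)[OF k y True] c(3) cw by simp
        finally show ?thesis .
      next
        case meet: False
        then obtain e e' where e: "e \<in> S" "e' \<in> S" "pt ?k e = pt ?k' e'" using assms(4)[OF k False] by blast
        note ce = corner_lettersD[OF assms(1) e(1)] corner_lettersD[OF assms(1) e(2)]
        have sep: "dist (cod w) (pt ?k e) + dist (cod w') (pt ?k e) \<le> 2 * dist (cod w) (cod w')"
          unfolding pt_def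
          by (rule contact_separation[OF k False, of "pole e" "pole e'"])
            (use ce e cw cod_Delta y in \<open>auto simp: pt_def\<close>)
        have "\<not> run e n (stl w) \<or> \<not> run e' n (stl w')" using Suc.prems(3) e False by (auto simp: contact_def)
        then have "c1 * lo ^ Suc n \<le> dist (cod w) (pt ?k e) + dist (cod w') (pt ?k e)"
        proof
          assume "\<not> run e n (stl w)"
          then have "c1 * lo ^ n \<le> dist (cod (stl w)) (pole e)"
            using run_lower[OF assms(1) e(1) assms(2,3) c1(1) y(1)] c1(2) e(1) by blast
          then have "lo * (c1 * lo ^ n) \<le> r ?k * dist (cod (stl w)) (pole e)"
            using assms(2,3) k c1 by (intro mult_mono) (auto intro: less_imp_le r_nonneg)
          also have "\<dots> = dist (cod w) (pt ?k e)" using cw(1) dist_phi[OF k(1)] by (simp add: pt_def)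
          finally have "c1 * lo ^ Suc n \<le> dist (cod w) (pt ?k e)" by (simp add: mult.left_commute)
          then show ?thesis using zero_le_dist[of "cod w'" "pt ?k e"] by linarith
        next
          assume "\<not> run e' n (stl w')"
          then have "c1 * lo ^ n \<le> dist (cod (stl w')) (pole e')"
            using run_lower[OF assms(1) e(2) assms(2,3) c1(1) y(2)] c1(2) e(2) by blast
          then have "lo * (c1 * lo ^ n) \<le> r ?k' * dist (cod (stl w')) (pole e')"
            using assms(2,3) k c1 by (intro mult_mono) (auto intro: less_imp_le r_nonneg)
          also have "\<dots> = dist (cod w') (pt ?k e)" using cw(2) dist_phi[OF k(2)] e(3) by (simp add: pt_def)
          finally have "c1 * lo ^ Suc n \<le> dist (cod w') (pt ?k e)" by (simp add: mult.left_commute)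
          then show ?thesis using zero_le_dist[of "cod w" "pt ?k e"] by linarith
        qed
        moreover have "c * lo ^ Suc n \<le> c1 / 2 * lo ^ Suc n" using c assms(3) by (intro mult_right_mono) auto
        ultimately show ?thesis using sep by linarith
      qed
    qed
  qed simp
  then show ?thesis using c(1) by blast
qed

text \<open>That \<open>v\<close> and \<open>v'\<close> belong to the attractor matters when
  \<open>omega_c\<close> does not: then no top takes part in a contact.\<close>

lemma meet_corners:
  assumes "i \<in> A" "j \<in> A" "i \<noteq> j" "phi i ` cod ` streams A \<inter> phi j ` cod ` streams A \<noteq> {}"
  shows "\<exists>v\<in>corners. \<exists>v'\<in>corners. v \<noteq> v' \<and> phi i v = phi j v' \<and> v \<in> cod ` streams A \<and> v' \<in> cod ` streams A"
proof -
  obtain x y where x: "x \<in> cod ` streams A" "y \<in> cod ` streams A" "phi i x = phi j y" using assms(4) by auto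
  then have "phi i x \<in> phi i ` Delta \<inter> phi j ` Delta" using cod_Delta by (metis IntI image_eqI imageE)
  then have "phi i x \<in> phi i ` corners" "phi j y \<in> phi j ` corners" using phi_meet[OF assms(1-3)] x(3) by auto
  then have "x \<in> corners" "y \<in> corners" using phi_inj assms(1,2) by blast+
  moreover have "x \<noteq> y" using phi_same_corner[OF assms(1,2)] x(3) assms(3) calculation by blast
  ultimately show ?thesis using x by blast
qed

end

section \<open>Codings that only see horizontal contacts\<close>

text \<open>Points are avoided on purpose: the successor relation and two letters can be transported
  to another gasket by a bijection of letters.\<close>

definition hcontact :: "('a \<Rightarrow> 'a \<Rightarrow> bool) \<Rightarrow> 'a \<Rightarrow> 'a \<Rightarrow> 'a \<Rightarrow> 'a \<Rightarrow> 'a \<Rightarrow> 'a \<Rightarrow> bool" where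
  "hcontact sc al be k a k' b \<longleftrightarrow> sc k k' \<and> a = be \<and> b = al \<or> sc k' k \<and> a = al \<and> b = be"

context gasket begin

definition sc :: "nat \<Rightarrow> nat \<Rightarrow> bool" where
  "sc k k' \<longleftrightarrow> phi k omega_b = phi k' omega_a"

lemma near_eq:
  assumes "corner_letters S" "w \<in> streams A" "w' \<in> streams A" "\<And>n. near (contact pt S) n w w'"
  shows "cod w = cod w'"
proof -
  have "(\<lambda>n. 4 * rmax ^ n) \<longlonglongrightarrow> 4 * 0"
    using rmax by (intro tendsto_mult LIMSEQ_realpow_zero tendsto_const) auto
  moreover have "dist (cod w) (cod w') \<le> 4 * rmax ^ n" for n
    by (rule near_upper[OF assms(1) rmax(1) assms(2-4)])
  ultimately have "dist (cod w) (cod w') \<le> 4 * 0"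
    by (intro LIMSEQ_le_const[of _ "4 * 0"]) blast+
  then show ?thesis by simp
qed

lemma Im_Delta: "z \<in> Delta \<Longrightarrow> 0 \<le> Im z"
  by (auto simp: Delta_iff lam_c zero_le_mult_iff)

lemma Im_phi: "Im (phi j x) - Im (phi j y) = r j * (Im x - Im y)"
  using arg_cong[OF phi_diff[of j x y], of Im] by simp

lemma Im_phi_top: "j \<in> A \<Longrightarrow> v \<in> {omega_a, omega_b} \<Longrightarrow> Im (phi j v) < Im (phi j omega_c)"
proof -
  assume "j \<in> A" "v \<in> {omega_a, omega_b}"
  then have "0 < r j * (Im omega_c - Im v)" using r_bounds[of j] by auto
  then show ?thesis using Im_phi[of j omega_c v] by linarith
qed

lemma Im_top_pos: "i \<in> A \<Longrightarrow> 0 < Im (phi i omega_c)"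
  using Im_phi_top[of i omega_a] Im_Delta[OF phi_Delta[OF _ corner_Delta[of omega_a]], of i] by auto

lemma Im_base: "j \<in> A \<Longrightarrow> u \<in> {omega_a, omega_b} \<Longrightarrow> phi j u = u \<Longrightarrow> v \<in> {omega_a, omega_b} \<Longrightarrow> Im (phi j v) = 0"
  using Im_phi[of j v u] by auto

end

locale gasket_base = gasket +
  fixes al be :: nat
  assumes al: "al \<in> A" "phi al omega_a = omega_a" and be: "be \<in> A" "phi be omega_b = omega_b"
begin

lemma pole_al: "pole al = omega_a" and pole_be: "pole be = omega_b"
  using pole_eq al be by auto

lemma al_ne_be: "al \<noteq> be"
  using pole_al pole_be omega_distinct by auto

lemma base_letters: "corner_letters {al, be}"
  using al be by (auto simp: corner_letters_def)

abbreviation "Qh \<equiv> hcontact sc al be"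

lemma contact_hcontact:
  assumes "k \<in> A" "k' \<in> A" "k \<noteq> k'"
  shows "Qh k a k' b \<longleftrightarrow> contact pt {al, be} k a k' b"
proof -
  have "phi k omega_a \<noteq> phi k' omega_a" "phi k omega_b \<noteq> phi k' omega_b"
    using phi_same_corner[OF assms(1,2)] assms(3) by auto
  then show ?thesis
    by (auto simp: hcontact_def contact_def sc_def pt_def pole_al pole_be)
qed

lemma near_hcontact:
  "w \<in> streams A \<Longrightarrow> w' \<in> streams A \<Longrightarrow> near Qh n w w' \<longleftrightarrow> near (contact pt {al, be}) n w w'"
  by (rule near_cong_streams[OF contact_hcontact])

text \<open>The interface between geometry and combinatorics. \<open>G\<close> may differ from
  \<open>cod\<close> and need not be injective, which leaves room for the substitution.\<close>

definition coding :: "(nat stream \<Rightarrow> complex) \<Rightarrow> real \<Rightarrow> real \<Rightarrow> bool" where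
  "coding G lo hi \<longleftrightarrow> G ` streams A = attractor N r d \<and>
    (\<exists>C>0. \<forall>n. \<forall>w\<in>streams A. \<forall>w'\<in>streams A. near Qh n w w' \<longrightarrow> dist (G w) (G w') \<le> C * hi ^ n) \<and>
    (\<exists>c>0. \<forall>n. \<forall>w\<in>streams A. \<forall>w'\<in>streams A. \<not> near Qh n w w' \<longrightarrow> c * lo ^ n \<le> dist (G w) (G w'))"

lemma codingD:
  assumes "coding G lo hi"
  shows "G ` streams A = attractor N r d"
    and "\<exists>C>0. \<forall>n. \<forall>w\<in>streams A. \<forall>w'\<in>streams A. near Qh n w w' \<longrightarrow> dist (G w) (G w') \<le> C * hi ^ n"
    and "\<exists>c>0. \<forall>n. \<forall>w\<in>streams A. \<forall>w'\<in>streams A. \<not> near Qh n w w' \<longrightarrow> c * lo ^ n \<le> dist (G w) (G w')"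
  using assms by (simp_all only: coding_def)

lemma coding_no_source:
  assumes "\<And>j. j \<in> A \<Longrightarrow> lo \<le> r j" "\<And>j. j \<in> A \<Longrightarrow> r j \<le> hi" "0 < lo"
    and no_source: "\<And>i j v. omega_c \<in> attractor N r d \<Longrightarrow> i \<in> A \<Longrightarrow> j \<in> A \<Longrightarrow> i \<noteq> j \<Longrightarrow> v \<in> {omega_a, omega_b} \<Longrightarrow>
      phi i omega_c \<noteq> phi j v"
  shows "coding cod lo hi"
proof -
  have "\<exists>e\<in>{al, be}. \<exists>e'\<in>{al, be}. pt i e = pt j e'"
    if ij: "i \<in> A" "j \<in> A" "i \<noteq> j" "phi i ` cod ` streams A \<inter> phi j ` cod ` streams A \<noteq> {}" for i j
  proof -
    obtain v v' where v: "v \<in> corners" "v' \<in> corners" "v \<noteq> v'" "phi i v = phi j v'"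
      "v \<in> cod ` streams A" "v' \<in> cod ` streams A" using meet_corners[OF ij] by blast
    have "v \<noteq> omega_c"
    proof
      assume *: "v = omega_c"
      then have "omega_c \<in> attractor N r d" "v' \<in> {omega_a, omega_b}" using v by (auto simp only: attractor_cod)
      then show False using no_source[OF _ ij(1-3)] v(4) * by blast
    qed
    moreover have "v' \<noteq> omega_c"
    proof
      assume *: "v' = omega_c"
      then have "omega_c \<in> attractor N r d" "v \<in> {omega_a, omega_b}" using v by (auto simp only: attractor_cod)
      then show False using no_source[OF _ ij(2,1)] ij(3) v(4) * by metis
    qed
    ultimately show ?thesis using v(1,2,4) unfolding pt_def by (auto simp: pole_al pole_be)
  qed
  then obtain c where c: "c > 0" "\<forall>n. \<forall>w\<in>streams A. \<forall>w'\<in>streams A. \<not> near (contact pt {al, be}) n w w' \<longrightarrow> c * lo ^ n \<le> dist (cod w) (cod w')"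
    using near_lower[OF base_letters assms(1) assms(3)] by blast
  show ?thesis unfolding coding_def
  proof (intro conjI)
    show "\<exists>c>0. \<forall>n. \<forall>w\<in>streams A. \<forall>w'\<in>streams A. \<not> near Qh n w w' \<longrightarrow> c * lo ^ n \<le> dist (cod w) (cod w')"
      using c by (auto simp: near_hcontact)
    show "\<exists>C>0. \<forall>n. \<forall>w\<in>streams A. \<forall>w'\<in>streams A. near Qh n w w' \<longrightarrow> dist (cod w) (cod w') \<le> C * hi ^ n"
      using near_upper[OF base_letters assms(2)] by (intro exI[of _ 4]) (auto simp: near_hcontact)
  qed (simp add: attractor_cod)
qed

end

section \<open>Gaskets with vertical contacts\<close>

locale gasket_top = gasket_base +
  fixes ga :: nat
  assumes ga: "ga \<in> A" "phi ga omega_c = omega_c"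
    and isolated: "\<And>j. j \<in> A \<Longrightarrow> j \<noteq> ga \<Longrightarrow> phi ga ` Delta \<inter> phi j ` Delta = {}"
    and source: "\<exists>i\<in>A. \<exists>j\<in>A. \<exists>v\<in>{omega_a, omega_b}. i \<noteq> j \<and> phi i omega_c = phi j v"
begin

lemma pole_ga: "pole ga = omega_c"
  using pole_eq ga by auto

lemma all_letters: "corner_letters {al, be, ga}"
  using al be ga by (auto simp: corner_letters_def)

definition source_of :: "nat \<Rightarrow> nat \<times> nat \<Rightarrow> bool" where
  "source_of i x \<longleftrightarrow> i \<in> A \<and> fst x \<in> A \<and> i \<noteq> fst x \<and> snd x \<in> {al, be} \<and> pt i ga = pt (fst x) (snd x)"

text \<open>The top of \<open>i\<close> may touch a left corner and a right corner of two other
  cells. One of them is chosen; these two corners form a horizontal contact, so the model already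
  knows the other one.\<close>

definition tgt :: "nat \<Rightarrow> (nat \<times> nat) option" where
  "tgt i = (if \<exists>x. source_of i x then Some (SOME x. source_of i x) else None)"

lemma tgt_source: "tgt i = Some x \<Longrightarrow> source_of i x"
  by (auto simp: tgt_def split: if_splits intro: someI)

lemma pole_corners: "e \<in> {al, be, ga} \<Longrightarrow> pole e \<in> corners"
  using pole_al pole_be pole_ga by auto

lemma meet_top:
  assumes "k \<in> A" "u \<in> Delta" "v \<in> Delta" "phi ga u = phi k v" shows "k = ga"
  using isolated[OF assms(1)] assms(2-4) by (metis IntI empty_iff imageI)

text \<open>Tops have positive height, while the cells at the base corners have their own base
  corners at height 0; \<open>ga\<close> is ruled out by isolation.\<close>

lemma target_not_base:
  assumes "tgt i = Some (j, a)" shows "j \<notin> {al, be, ga}"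
proof -
  have *: "i \<in> A" "j \<in> A" "i \<noteq> j" "a \<in> {al, be}" "pt i ga = pt j a"
    using tgt_source[OF assms] by (auto simp: source_of_def)
  then have p: "pole a \<in> {omega_a, omega_b}" "phi i omega_c = phi j (pole a)"
    using pole_al pole_be pole_ga by (auto simp: pt_def)
  have "j \<noteq> ga" 
  proof
    assume "j = ga"
    then have "i = ga" using meet_top[OF *(1), of "pole a" omega_c] p corner_Delta by auto
    then show False using * \<open>j = ga\<close> by simp
  qed
  moreover have "Im (phi j (pole a)) > 0" using p Im_top_pos[OF *(1)] by simp
  then have "j \<noteq> al" "j \<noteq> be" using Im_base[OF al(1) _ al(2) p(1)] Im_base[OF be(1) _ be(2) p(1)] by auto
  ultimately show ?thesis by simp
qed

text \<open>If the target with the highest top were a source, its top would be a base corner of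
  another target, whose top is strictly higher.\<close>

lemma highest_target: "\<exists>de. (\<exists>i a. tgt i = Some (de, a)) \<and> tgt de = None"
proof -
  define T where "T = {j. \<exists>i a. tgt i = Some (j, a)}"
  have "T \<subseteq> A" using tgt_source by (auto simp: T_def source_of_def)
  then have fin: "finite T" using finite_A finite_subset by blast
  obtain i j v where ij: "i \<in> A" "j \<in> A" "v \<in> {omega_a, omega_b}" "i \<noteq> j" "phi i omega_c = phi j v"
    using source by blast
  then have "source_of i (j, if v = omega_a then al else be)"
    using pole_al pole_be pole_ga by (auto simp: source_of_def pt_def)
  then have "tgt i \<noteq> None" by (auto simp: tgt_def)
  then have "T \<noteq> {}" by (auto simp: T_def)
  let ?h = "\<lambda>j. Im (phi j omega_c)"
  have "Max (?h ` T) \<in> ?h ` T" using fin \<open>T \<noteq> {}\<close> by (intro Max_in) auto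
  then obtain de where de: "de \<in> T" "?h de = Max (?h ` T)" by auto
  have "tgt de = None"
  proof (rule ccontr)
    assume "tgt de \<noteq> None"
    then obtain j a where ja: "tgt de = Some (j, a)" by auto
    then have "j \<in> T" "j \<in> A" "a \<in> {al, be}" "pt de ga = pt j a"
      using tgt_source[OF ja] by (auto simp: T_def source_of_def)
    then have "?h de < ?h j" using Im_phi_top[of j "pole a"] pole_al pole_be pole_ga by (auto simp: pt_def)
    moreover have "?h j \<le> Max (?h ` T)" using fin \<open>j \<in> T\<close> by simp
    ultimately show False using de by simp
  qed
  then show ?thesis using de by (auto simp: T_def)
qed

definition de :: nat where
  "de = (SOME de. (\<exists>i a. tgt i = Some (de, a)) \<and> tgt de = None)"

lemma de: "\<exists>i a. tgt i = Some (de, a)" "tgt de = None"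
  using someI_ex[OF highest_target] unfolding de_def by blast+

sublocale hotel A al be ga de pt tgt
proof
  show "al \<in> A" "be \<in> A" "ga \<in> A" by (fact al be ga)+
  show "de \<in> A" using de tgt_source by (auto simp: source_of_def)
  show "al \<noteq> be" by (fact al_ne_be)
  show "al \<noteq> ga" "be \<noteq> ga" using pole_al pole_be pole_ga omega_distinct by auto
  show "de \<notin> {al, be, ga}" using target_not_base de by blast
  show "a = b" if "k \<in> A" "a \<in> {al, be, ga}" "b \<in> {al, be, ga}" "pt k a = pt k b" for k a b
  proof -
    have "pole a = pole b" using that phi_inj by (auto simp: pt_def)
    then show ?thesis using that(2,3) pole_al pole_be pole_ga omega_distinct by auto
  qed
  show "k = k'" if "k \<in> A" "k' \<in> A" "a \<in> {al, be, ga}" "pt k a = pt k' a" for k k' a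
    using phi_same_corner[OF that(1,2) pole_corners[OF that(3)]] that(4) by (simp add: pt_def)
  show "k = ga" if "k \<in> A" "a \<in> {al, be, ga}" "b \<in> {al, be, ga}" "pt ga a = pt k b" for k a b
    using meet_top[OF that(1), of "pole a" "pole b"] that pole_corners corner_Delta by (auto simp: pt_def)
  show "k = a" if "k \<in> A" "a \<in> {al, be}" "b \<in> {al, be, ga}" "pt a a = pt k b" for k a b
  proof -
    have a: "a \<in> A" "pole a \<in> corners" "pole b \<in> corners" "phi a (pole a) = pole a"
      using that al be pole_corners pole_phi by auto
    then have e: "phi k (pole b) = pole a" using that(4) by (simp add: pt_def)
    then have "pole b = pole a" using phi_corner[OF that(1) corner_Delta] a by blast
    then show ?thesis using phi_same_corner[OF that(1) a(1,2)] e a by simp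
  qed
  show "i \<in> A \<and> j \<in> A \<and> i \<noteq> j \<and> a \<in> {al, be} \<and> pt i ga = pt j a" if "tgt i = Some (j, a)" for i j a
    using tgt_source[OF that] by (auto simp: source_of_def)
  show "j \<notin> {al, be, ga}" if "tgt i = Some (j, a)" for i j a by (rule target_not_base[OF that])
  show "tgt i \<noteq> None" if "i \<in> A" "j \<in> A" "i \<noteq> j" "a \<in> {al, be}" "pt i ga = pt j a" for i j a
  proof -
    have "source_of i (j, a)" using that by (simp add: source_of_def)
    then show ?thesis by (auto simp: tgt_def)
  qed
  show "tgt de = None" by (fact de)
qed

lemma coding_source:
  assumes "\<And>j. j \<in> A \<Longrightarrow> lo \<le> r j" "\<And>j. j \<in> A \<Longrightarrow> r j \<le> hi" "0 < lo" "hi < 1"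
  shows "\<exists>G. coding G lo hi"
proof -
  define vf where "vf w = (SOME v. Rel w v)" for w
  have vf: "Rel w (vf w)" if "w \<in> streams A" for w
    using someI_ex[OF Rel_ex[OF that]] by (simp add: vf_def)
  note vfs = Rel_streams(2)[OF vf]
  have hi: "0 < hi" using assms(2)[OF al(1)] r_bounds[OF al(1)] by simp
  have "\<exists>e\<in>{al, be, ga}. \<exists>e'\<in>{al, be, ga}. pt i e = pt j e'"
    if ij: "i \<in> A" "j \<in> A" "i \<noteq> j" "phi i ` cod ` streams A \<inter> phi j ` cod ` streams A \<noteq> {}" for i j
    using meet_corners[OF ij] unfolding pt_def using pole_al pole_be pole_ga by auto
  then obtain c where c: "c > 0" "\<forall>n. \<forall>w\<in>streams A. \<forall>w'\<in>streams A. \<not> near Q3 n w w' \<longrightarrow> c * lo ^ n \<le> dist (cod w) (cod w')"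
    using near_lower[OF all_letters assms(1) assms(3)] by blast
  have "coding (\<lambda>w. cod (vf w)) lo hi" unfolding coding_def
  proof (intro conjI)
    show "(\<lambda>w. cod (vf w)) ` streams A = attractor N r d"
    proof
      show "(\<lambda>w. cod (vf w)) ` streams A \<subseteq> attractor N r d" using vfs by (auto simp: attractor_cod)
      show "attractor N r d \<subseteq> (\<lambda>w. cod (vf w)) ` streams A"
      proof
        fix x assume "x \<in> attractor N r d"
        then obtain v where v: "v \<in> streams A" "x = cod v" by (auto simp: attractor_cod)
        obtain w v' where w: "Rel w v'" "\<And>n. near Q3 n v' v" using Rel_onto[OF v(1)] by blast
        have ws: "w \<in> streams A" "v' \<in> streams A" using Rel_streams[OF w(1)] by auto
        \<comment> \<open>The chosen image \<open>vf w\<close> may differ from \<open>v'\<close>.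
          Applying \<open>Rel_near\<close> to \<open>w\<close> and itself, four levels deeper, shows
          that they are near at every depth and so code the same point.\<close>
        have "near Q3 n (vf w) v'" for n using Rel_near[OF vf[OF ws(1)] w(1) near_refl[of _ "n + 4"]] by simp
        then have "cod (vf w) = cod v'" using near_eq[OF all_letters vfs[OF ws(1)] ws(2)] by blast
        moreover have "cod v' = cod v" using near_eq[OF all_letters ws(2) v(1)] w(2) by blast
        ultimately show "x \<in> (\<lambda>w. cod (vf w)) ` streams A"
          using v(2) ws(1) by (intro image_eqI[of _ _ w]) simp_all
      qed
    qed
    have "dist (cod (vf w)) (cod (vf w')) \<le> 4 / hi ^ 4 * hi ^ n"
      if w: "w \<in> streams A" "w' \<in> streams A" "near Qh n w w'" for n w w'
    proof -
      have "near Q3 (n - 4) (vf w) (vf w')"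
        using Rel_near[OF vf[OF w(1)] vf[OF w(2)]] w near_hcontact by blast
      then have "dist (cod (vf w)) (cod (vf w')) \<le> 4 * hi ^ (n - 4)"
        using near_upper[OF all_letters assms(2) vfs[OF w(1)] vfs[OF w(2)]] by blast
      \<comment> \<open>Only an inequality, since \<open>n - 4\<close> is truncated at 0;
        \<open>hi < 1\<close> makes it go the right way.\<close>
      moreover have "hi ^ (n - 4) * hi ^ 4 \<le> hi ^ n"
        unfolding power_add[symmetric] by (rule power_decreasing) (use hi assms(4) in auto)
      then have "4 * hi ^ (n - 4) \<le> 4 / hi ^ 4 * hi ^ n" using hi by (simp add: field_simps)
      ultimately show ?thesis by linarith
    qed
    then show "\<exists>C>0. \<forall>n. \<forall>w\<in>streams A. \<forall>w'\<in>streams A. near Qh n w w' \<longrightarrow>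
        dist (cod (vf w)) (cod (vf w')) \<le> C * hi ^ n"
      using hi by (intro exI[of _ "4 / hi ^ 4"]) auto
    have "c * lo ^ 5 * lo ^ n \<le> dist (cod (vf w)) (cod (vf w'))"
      if w: "w \<in> streams A" "w' \<in> streams A" "\<not> near Qh n w w'" for n w w'
    proof -
      have "\<not> near Q3 (n + 5) (vf w) (vf w')"
        using Rel_near_inv[OF vf[OF w(1)] vf[OF w(2)], of "n + 5"] w near_hcontact by auto
      then have "c * lo ^ (n + 5) \<le> dist (cod (vf w)) (cod (vf w'))" using c(2) vfs w by blast
      then show ?thesis by (simp add: power_add mult.assoc mult.commute[of "lo ^ 5"])
    qed
    then show "\<exists>c>0. \<forall>n. \<forall>w\<in>streams A. \<forall>w'\<in>streams A. \<not> near Qh n w w' \<longrightarrow>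
        c * lo ^ n \<le> dist (cod (vf w)) (cod (vf w'))"
      using c(1) assms(3) by (intro exI[of _ "c * lo ^ 5"]) auto
  qed
  then show ?thesis by blast
qed

end

lemma (in gasket_base) coding_ex:
  assumes "top_isolated N r d \<or> omega_c \<notin> attractor N r d"
    and "\<And>j. j \<in> A \<Longrightarrow> lo \<le> r j" "\<And>j. j \<in> A \<Longrightarrow> r j \<le> hi" "0 < lo" "hi < 1"
  shows "\<exists>G. coding G lo hi"
proof (cases "omega_c \<in> attractor N r d \<and> (\<exists>i\<in>A. \<exists>j\<in>A. \<exists>v\<in>{omega_a, omega_b}. i \<noteq> j \<and> phi i omega_c = phi j v)")
  case True
  then obtain ga where "ga \<in> A" "phi ga omega_c = omega_c"
    "\<And>j. j \<in> A \<Longrightarrow> j \<noteq> ga \<Longrightarrow> phi ga ` Delta \<inter> phi j ` Delta = {}"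
    using assms(1) unfolding top_isolated_def A_def by blast
  then interpret gasket_top N r d al be ga
    using True by unfold_locales auto
  show ?thesis by (rule coding_source[OF assms(2-5)])
next
  case False
  have "coding cod lo hi" by (rule coding_no_source[OF assms(2-4)]) (use False in auto)
  then show ?thesis by (intro exI[of _ cod])
qed

section \<open>Horizontal blocks\<close>

text \<open>The function \<open>x\<close> stands for the abscissa of the left corner of a cell. Its
  growth along \<open>sc\<close> excludes cycles, so prolonging a chain never repeats a
  letter.\<close>

locale succ_order =
  fixes A :: "nat set" and sc :: "nat \<Rightarrow> nat \<Rightarrow> bool" and x :: "nat \<Rightarrow> real"
  assumes fin: "finite A"
    and sc_right: "\<And>i j k. i \<in> A \<Longrightarrow> j \<in> A \<Longrightarrow> k \<in> A \<Longrightarrow> sc i j \<Longrightarrow> sc i k \<Longrightarrow> j = k"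
    and sc_left: "\<And>i j k. i \<in> A \<Longrightarrow> j \<in> A \<Longrightarrow> k \<in> A \<Longrightarrow> sc i k \<Longrightarrow> sc j k \<Longrightarrow> i = j"
    and sc_less: "\<And>i j. i \<in> A \<Longrightarrow> j \<in> A \<Longrightarrow> sc i j \<Longrightarrow> x i < x j"
begin

definition chain :: "nat list \<Rightarrow> bool" where
  "chain l \<longleftrightarrow> l \<noteq> [] \<and> distinct l \<and> set l \<subseteq> A \<and> (\<forall>j. Suc j < length l \<longrightarrow> sc (l ! j) (l ! Suc j))"

definition block :: "nat set \<Rightarrow> bool" where
  "block I \<longleftrightarrow> (\<exists>l. chain l \<and> set l = I) \<and> (\<forall>l. chain l \<and> I \<subseteq> set l \<longrightarrow> set l = I)"

text \<open>Blocks are sets; a list that cannot be prolonged at either end also fixes an order and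
  hence positions inside the block.\<close>

definition maximal :: "nat list \<Rightarrow> bool" where
  "maximal l \<longleftrightarrow> chain l \<and> (\<forall>k\<in>A. \<not> sc k (hd l)) \<and> (\<forall>k\<in>A. \<not> sc (last l) k)"

lemma chain_in: "chain l \<Longrightarrow> p < length l \<Longrightarrow> l ! p \<in> A"
  unfolding chain_def using nth_mem by blast

lemma chain_sc: "chain l \<Longrightarrow> Suc p < length l \<Longrightarrow> sc (l ! p) (l ! Suc p)"
  unfolding chain_def by blast

lemma chain_mono: "chain l \<Longrightarrow> p \<le> q \<Longrightarrow> q < length l \<Longrightarrow> x (l ! p) \<le> x (l ! q)"
proof (induction q)
  case (Suc q)
  then show ?case
    using sc_less[OF chain_in[of l q] chain_in[of l "Suc q"] chain_sc[of l q]] by (cases "p = Suc q") auto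
qed simp

lemma chain_Cons:
  assumes "chain l" "k \<in> A" "sc k (hd l)"
  shows "chain (k # l)" "k \<notin> set l"
proof -
  have l: "l \<noteq> []" "hd l = l ! 0" using assms(1) by (auto simp: chain_def hd_conv_nth)
  have "x k < x (l ! 0)" using sc_less[OF assms(2) chain_in[OF assms(1), of 0]] assms(3) l by auto
  then show "k \<notin> set l"
    using chain_mono[OF assms(1), of 0] by (fastforce simp: in_set_conv_nth)
  then show "chain (k # l)" using assms l unfolding chain_def by (auto simp: nth_Cons split: nat.splits)
qed

lemma chain_snoc:
  assumes "chain l" "k \<in> A" "sc (last l) k"
  shows "chain (l @ [k])" "k \<notin> set l"
proof -
  have l: "l \<noteq> []" "last l = l ! (length l - 1)" using assms(1) by (auto simp: chain_def last_conv_nth)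
  have "x (l ! (length l - 1)) < x k" using sc_less[OF chain_in[OF assms(1), of "length l - 1"] assms(2)] assms(3) l by auto
  moreover have "x (l ! p) \<le> x (l ! (length l - 1))" if "p < length l" for p
    using chain_mono[OF assms(1), of p "length l - 1"] that by auto
  ultimately show k: "k \<notin> set l" by (fastforce simp: in_set_conv_nth)
  have "sc ((l @ [k]) ! j) ((l @ [k]) ! Suc j)" if "Suc j < Suc (length l)" for j
  proof (cases "Suc j < length l")
    case True then show ?thesis using chain_sc[OF assms(1)] by (simp add: nth_append)
  next
    case False
    then have "j = length l - 1" using that by simp
    then show ?thesis using assms(3) l by (simp add: nth_append)
  qed
  then show "chain (l @ [k])" using assms l k unfolding chain_def by auto
qed

lemma block_maximal:
  assumes "chain l" "block (set l)"
  shows "maximal l"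
proof -
  have *: "set l' = set l" if "chain l'" "set l \<subseteq> set l'" for l' using assms(2) that unfolding block_def by blast
  show ?thesis unfolding maximal_def
  proof (intro conjI ballI notI assms(1))
    fix k assume k: "k \<in> A" "sc k (hd l)"
    show False using *[OF chain_Cons(1)[OF assms(1) k]] chain_Cons(2)[OF assms(1) k] by auto
  next
    fix k assume k: "k \<in> A" "sc (last l) k"
    show False using *[OF chain_snoc(1)[OF assms(1) k]] chain_snoc(2)[OF assms(1) k] by auto
  qed
qed

lemma agree_right:
  assumes "chain l" "chain l'" "l ! p = l' ! q"
  shows "p + t < length l \<Longrightarrow> q + t < length l' \<Longrightarrow> l ! (p + t) = l' ! (q + t)"
proof (induction t)
  case (Suc t)
  then have e: "l ! (p + t) = l' ! (q + t)" by simp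
  show ?case
    by (rule sc_right[of "l ! (p + t)"])
      (use Suc.prems e chain_in[OF assms(1)] chain_in[OF assms(2)] chain_sc[OF assms(1), of "p + t"]
        chain_sc[OF assms(2), of "q + t"] in auto)
qed (use assms in simp)

lemma agree_left:
  assumes "chain l" "chain l'" "l ! p = l' ! q" "p < length l" "q < length l'"
  shows "t \<le> p \<Longrightarrow> t \<le> q \<Longrightarrow> l ! (p - t) = l' ! (q - t)"
proof (induction t)
  case (Suc t)
  then have e: "l ! (p - t) = l' ! (q - t)" by simp
  have s: "Suc (p - Suc t) = p - t" "Suc (q - Suc t) = q - t" using Suc.prems by auto
  show ?case
    by (rule sc_left[of _ _ "l ! (p - t)"])
      (use Suc.prems e assms(4,5) chain_in[OF assms(1)] chain_in[OF assms(2)] chain_sc[OF assms(1), of "p - Suc t"]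
        chain_sc[OF assms(2), of "q - Suc t"] s in auto)
qed (use assms in simp)

lemma maximal_start:
  assumes "maximal l" "chain l'" "l ! p = l' ! q" "p < length l" "q < length l'"
  shows "q \<le> p"
proof (rule ccontr)
  assume "\<not> q \<le> p"
  then have "l ! 0 = l' ! (q - p)"
    using agree_left[of l l' p q p] assms by (auto simp: maximal_def)
  moreover have "sc (l' ! (q - p - 1)) (l' ! (q - p))" "l' ! (q - p - 1) \<in> A"
    using chain_sc[OF assms(2), of "q - p - 1"] chain_in[OF assms(2)] \<open>\<not> q \<le> p\<close> assms(5) by (auto simp: Suc_diff_Suc)
  moreover have "hd l = l ! 0" using assms(1) by (simp add: maximal_def chain_def hd_conv_nth)
  ultimately show False using assms(1) unfolding maximal_def by metis
qed

lemma maximal_end: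
  assumes "maximal l" "chain l'" "l ! p = l' ! p" "p < length l" "p < length l'"
  shows "length l' \<le> length l"
proof (rule ccontr)
  assume *: "\<not> length l' \<le> length l"
  have "l ! (length l - 1) = l' ! (length l - 1)"
    using agree_right[of l l' p p "length l - 1 - p"] assms * by (auto simp: maximal_def)
  moreover have "Suc (length l - 1) = length l" using assms(4) by simp
  then have "sc (l' ! (length l - 1)) (l' ! length l)" "l' ! length l \<in> A"
    using chain_sc[OF assms(2), of "length l - 1"] chain_in[OF assms(2)] * assms(4) by auto
  moreover have "last l = l ! (length l - 1)" using assms(1) by (simp add: maximal_def chain_def last_conv_nth)
  ultimately show False using assms(1) unfolding maximal_def by metis
qed

text \<open>Successors and predecessors are unique, so chains with a common letter agree once their
  positions are aligned. Maximality of \<open>l\<close> gives \<open>q \<le> p\<close>; the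
  disjunction supplies \<open>p \<le> q\<close> in the forms needed by \<open>maximal_block\<close>
  and \<open>maximal_unique\<close>.\<close>

lemma maximal_contains:
  assumes "maximal l" "chain l'" "i \<in> set l" "i \<in> set l'" "i = l ! 0 \<or> maximal l'"
  shows "set l' \<subseteq> set l \<and> (maximal l' \<longrightarrow> l' = l)"
proof -
  have l: "chain l" using assms(1) by (simp add: maximal_def)
  obtain p q where pq: "l ! p = l' ! q" "p < length l" "q < length l'" "i = l ! p"
    using assms(3,4) by (metis in_set_conv_nth)
  have "q \<le> p" by (rule maximal_start[OF assms(1,2) pq(1-3)])
  moreover have "p \<le> q"
  proof (cases "maximal l'")
    case True then show ?thesis using maximal_start[OF _ l pq(1)[symmetric] pq(3,2)] by blast
  next
    case False
    then have "p = 0" using assms(5) pq l nth_eq_iff_index_eq[of l p 0] by (auto simp: chain_def)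
    then show ?thesis by simp
  qed
  ultimately have e: "l ! p = l' ! p" "p < length l'" using pq by auto
  have len: "length l' \<le> length l" by (rule maximal_end[OF assms(1,2) e(1) pq(2) e(2)])
  have nth: "l' ! j = l ! j" if "j < length l'" for j
  proof (cases "j \<le> p")
    case True then show ?thesis using agree_left[OF l assms(2) e(1) pq(2) e(2), of "p - j"] by simp
  next
    case False then show ?thesis using agree_right[OF l assms(2) e(1), of "j - p"] that len by simp
  qed
  then have "set l' \<subseteq> set l" using len by (metis in_set_conv_nth less_le_trans subsetI)
  moreover have "l' = l" if "maximal l'"
    using maximal_end[OF that l e(1)[symmetric] e(2) pq(2)] len nth by (intro nth_equalityI) auto
  ultimately show ?thesis by blast
qed

lemma maximal_unique: "maximal l \<Longrightarrow> maximal l' \<Longrightarrow> i \<in> set l \<Longrightarrow> i \<in> set l' \<Longrightarrow> l' = l"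
  using maximal_contains[of l l' i] by (auto simp: maximal_def)

lemma maximal_block:
  assumes "maximal l" shows "block (set l)"
proof -
  have l: "chain l" "l \<noteq> []" using assms by (auto simp: maximal_def chain_def)
  have "set l' = set l" if "chain l'" "set l \<subseteq> set l'" for l'
    using maximal_contains[OF assms that(1), of "l ! 0"] that(2) nth_mem[of 0 l] l(2) by blast
  then show ?thesis unfolding block_def using l by blast
qed

lemma maximal_ex:
  assumes "i \<in> A" shows "\<exists>l. maximal l \<and> i \<in> set l"
proof -
  let ?P = "\<lambda>l. chain l \<and> i \<in> set l"
  have "?P [i]" using assms by (auto simp: chain_def)
  moreover have "length l < Suc (card A)" if "?P l" for l
    using that card_mono[OF fin, of "set l"] distinct_card[of l] by (auto simp: chain_def)
  ultimately obtain l where l: "?P l" "\<And>l'. ?P l' \<Longrightarrow> length l' \<le> length l"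
    using ex_has_greatest_nat[of ?P "[i]" length "Suc (card A)"] by blast
  have "maximal l" unfolding maximal_def
  proof (intro conjI ballI notI)
    fix k assume "k \<in> A" "sc k (hd l)"
    then show False using l(2)[of "k # l"] chain_Cons(1)[of l k] l(1) by simp
  next
    fix k assume "k \<in> A" "sc (last l) k"
    then show False using l(2)[of "l @ [k]"] chain_snoc(1)[of l k] l(1) by simp
  qed (use l in blast)
  then show ?thesis using l by blast
qed

lemma block_ex: "block I \<Longrightarrow> \<exists>l. maximal l \<and> set l = I"
  using block_maximal unfolding block_def by metis

lemma maximal_set_eq: "maximal l \<Longrightarrow> maximal l' \<Longrightarrow> set l = set l' \<Longrightarrow> l = l'"
  using maximal_unique[of l' l "hd l"] hd_in_set[of l] by (auto simp: maximal_def chain_def)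

end

section \<open>Matching the blocks of two gaskets\<close>

locale block_matching = E: succ_order A sc x + F: succ_order B sd y for A sc x B sd y +
  fixes g :: "nat set \<Rightarrow> nat set"
  assumes g: "bij_betw g {I. E.block I} {I. F.block I}"
    and g_card: "\<And>I. E.block I \<Longrightarrow> card (g I) = card I"
begin

definition matched :: "nat list \<Rightarrow> nat list \<Rightarrow> bool" where
  "matched l l' \<longleftrightarrow> E.maximal l \<and> F.maximal l' \<and> set l' = g (set l)"

lemma matched_length:
  assumes "matched l l'" shows "length l' = length l"
proof -
  have "distinct l" "distinct l'" using assms by (auto simp: matched_def E.maximal_def F.maximal_def E.chain_def F.chain_def)
  then show ?thesis using g_card[OF E.maximal_block, of l] assms distinct_card by (metis matched_def)
qed

lemma matched_fst:
  assumes "matched l l'" "matched l2 l2'" "set l \<inter> set l2 \<noteq> {}"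
  shows "l = l2 \<and> l' = l2'"
  using assms E.maximal_unique[of l2 l] F.maximal_set_eq[of l' l2'] by (auto simp: matched_def)

lemma matched_snd:
  assumes "matched l l'" "matched l2 l2'" "set l' \<inter> set l2' \<noteq> {}"
  shows "l = l2 \<and> l' = l2'"
proof -
  have "l' = l2'" using assms F.maximal_unique[of l2' l'] by (auto simp: matched_def)
  then have "set l = set l2" using assms E.maximal_block g by (auto simp: matched_def bij_betw_def inj_on_def)
  then show ?thesis using \<open>l' = l2'\<close> E.maximal_set_eq assms by (auto simp: matched_def)
qed

lemma matched_ex:
  assumes "E.maximal l" shows "\<exists>l'. matched l l'"
proof -
  have "F.block (g (set l))" using bij_betwE[OF g] E.maximal_block[OF assms] by blast
  then obtain l' where "F.maximal l'" "set l' = g (set l)" using F.block_ex by blast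
  then show ?thesis unfolding matched_def using assms by blast
qed

lemma matched_ex_snd:
  assumes "F.maximal l'" shows "\<exists>l. matched l l'"
proof -
  have "set l' \<in> g ` {I. E.block I}"
    using F.maximal_block[OF assms] bij_betw_imp_surj_on[OF g] by simp
  then obtain I where I: "E.block I" "set l' = g I" by blast
  then obtain l where "E.maximal l" "set l = I" using E.block_ex by blast
  then show ?thesis unfolding matched_def using assms I by blast
qed

text \<open>Letters at equal positions of matched blocks. As a relation it treats the two alphabets
  symmetrically.\<close>

definition corr :: "nat \<Rightarrow> nat \<Rightarrow> bool" where
  "corr i i' \<longleftrightarrow> (\<exists>l l' p. matched l l' \<and> p < length l \<and> i = l ! p \<and> i' = l' ! p)"

lemma matched_chain: "matched l l' \<Longrightarrow> E.chain l \<and> F.chain l' \<and> distinct l \<and> distinct l'"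
  by (auto simp: matched_def E.maximal_def F.maximal_def E.chain_def F.chain_def)

lemma corr_inj:
  assumes "corr i i'" "corr j j'"
  shows "i = j \<longleftrightarrow> i' = j'"
proof -
  obtain l l' p where l: "matched l l'" "p < length l" "i = l ! p" "i' = l' ! p" using assms(1) by (auto simp: corr_def)
  obtain m m' q where m: "matched m m'" "q < length m" "j = m ! q" "j' = m' ! q" using assms(2) by (auto simp: corr_def)
  have len: "length l' = length l" "length m' = length m" using matched_length l m by auto
  show ?thesis
  proof
    assume "i = j"
    then have "set l \<inter> set m \<noteq> {}" using l m nth_mem by fastforce
    then have "l = m" "l' = m'" using matched_fst l m by blast+
    then show "i' = j'" using l m \<open>i = j\<close> matched_chain nth_eq_iff_index_eq by metis
  next
    assume "i' = j'"
    then have "set l' \<inter> set m' \<noteq> {}" using l m len nth_mem by (metis disjoint_iff)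
    then have "l = m" "l' = m'" using matched_snd l m by blast+
    then show "i = j" using l m \<open>i' = j'\<close> matched_chain nth_eq_iff_index_eq len by metis
  qed
qed

lemma corr_in: "corr i i' \<Longrightarrow> i \<in> A \<and> i' \<in> B"
  unfolding corr_def using matched_chain matched_length E.chain_in F.chain_in by metis

lemma corr_ex: "i \<in> A \<Longrightarrow> \<exists>i'. corr i i'"
  using E.maximal_ex[of i] matched_ex unfolding corr_def by (metis in_set_conv_nth)

lemma corr_ex_snd: "i' \<in> B \<Longrightarrow> \<exists>i. corr i i'"
  using F.maximal_ex[of i'] matched_ex_snd matched_length unfolding corr_def by (metis in_set_conv_nth)

text \<open>Inside a block the successor is the next position on both sides; at its end neither
  letter has a successor.\<close>

lemma corr_sc:
  assumes "corr i i'" "corr j j'"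
  shows "sc i j \<longleftrightarrow> sd i' j'"
proof -
  obtain l l' p where l: "matched l l'" "p < length l" "i = l ! p" "i' = l' ! p" using assms(1) by (auto simp: corr_def)
  note len = matched_length[OF l(1)] and ch = matched_chain[OF l(1)]
  have mx: "E.maximal l" "F.maximal l'" using l(1) by (auto simp: matched_def)
  have ne: "l \<noteq> []" "l' \<noteq> []" using ch by (auto simp: E.chain_def F.chain_def)
  have inA: "i \<in> A" "i' \<in> B" "j \<in> A" "j' \<in> B" using corr_in assms by auto
  show ?thesis
  proof (cases "Suc p < length l")
    case True
    have c: "corr (l ! Suc p) (l' ! Suc p)" using True l by (auto simp: corr_def)
    have s: "sc i (l ! Suc p)" "sd i' (l' ! Suc p)"
      using E.chain_sc F.chain_sc ch True len l by auto
    have "sc i j \<longleftrightarrow> j = l ! Suc p" using s(1) E.sc_right inA corr_in[OF c] by blast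
    moreover have "sd i' j' \<longleftrightarrow> j' = l' ! Suc p" using s(2) F.sc_right inA corr_in[OF c] by blast
    ultimately show ?thesis using corr_inj[OF assms(2) c] by simp
  next
    case False
    then have "p = length l - 1" using l(2) by simp
    then have "i = last l" "i' = last l'" using l(3,4) len ne by (simp_all add: last_conv_nth)
    then show ?thesis using mx inA unfolding E.maximal_def F.maximal_def by blast
  qed
qed

text \<open>Without a predecessor a letter can only stand at position 0. This is how the cells at
  the left corner are found to correspond.\<close>

lemma corr_first:
  assumes "E.block I" "i \<in> I" "\<And>k. k \<in> A \<Longrightarrow> \<not> sc k i" "i' \<in> g I" "\<And>k. k \<in> B \<Longrightarrow> \<not> sd k i'"
  shows "corr i i'"
proof -
  obtain l where l: "E.maximal l" "set l = I" using E.block_ex assms(1) by blast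
  obtain l' where m: "matched l l'" using matched_ex l by blast
  then have "i' \<in> set l'" using assms(4) l by (simp add: matched_def)
  then obtain p q where p: "p < length l" "i = l ! p" "q < length l'" "i' = l' ! q" 
    using assms(2) l by (metis in_set_conv_nth)
  note ch = matched_chain[OF m]
  have "p = 0" using E.chain_sc[of l "p - 1"] E.chain_in[of l "p - 1"] ch p assms(3) by (cases p) auto
  moreover have "q = 0" using F.chain_sc[of l' "q - 1"] F.chain_in[of l' "q - 1"] ch p assms(5) by (cases q) auto
  ultimately show ?thesis using m p unfolding corr_def by blast
qed

lemma corr_last:
  assumes "E.block I" "i \<in> I" "\<And>k. k \<in> A \<Longrightarrow> \<not> sc i k" "i' \<in> g I" "\<And>k. k \<in> B \<Longrightarrow> \<not> sd i' k"
  shows "corr i i'"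
proof -
  obtain l where l: "E.maximal l" "set l = I" using E.block_ex assms(1) by blast
  obtain l' where m: "matched l l'" using matched_ex l by blast
  then have "i' \<in> set l'" using assms(4) l by (simp add: matched_def)
  then obtain p q where p: "p < length l" "i = l ! p" "q < length l'" "i' = l' ! q" 
    using assms(2) l by (metis in_set_conv_nth)
  note ch = matched_chain[OF m]
  have "\<not> Suc p < length l" using E.chain_sc[of l p] E.chain_in[of l "Suc p"] ch p assms(3) by auto
  moreover have "\<not> Suc q < length l'" using F.chain_sc[of l' q] F.chain_in[of l' "Suc q"] ch p assms(5) by auto
  ultimately have "p = q" using p matched_length[OF m] by simp
  then show ?thesis using m p unfolding corr_def by blast
qed

lemma letter_bijection:
  "\<exists>\<tau>. bij_betw \<tau> A B \<and> (\<forall>i\<in>A. corr i (\<tau> i)) \<and> (\<forall>i\<in>A. \<forall>j\<in>A. sc i j \<longleftrightarrow> sd (\<tau> i) (\<tau> j))"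
proof -
  define \<tau> where "\<tau> i = (SOME i'. corr i i')" for i
  have \<tau>: "corr i (\<tau> i)" if "i \<in> A" for i using someI_ex[OF corr_ex[OF that]] by (simp add: \<tau>_def)
  have "inj_on \<tau> A" using \<tau> corr_inj by (metis inj_onI)
  moreover have "\<tau> ` A = B"
  proof
    show "\<tau> ` A \<subseteq> B" using \<tau> corr_in by blast
    show "B \<subseteq> \<tau> ` A"
    proof
      fix i' assume "i' \<in> B"
      then obtain i where i: "corr i i'" using corr_ex_snd by blast
      then have "i' = \<tau> i" using \<tau> corr_inj[of i i' i "\<tau> i"] corr_in by blast
      then show "i' \<in> \<tau> ` A" using i corr_in by blast
    qed
  qed
  ultimately show ?thesis using \<tau> corr_sc by (intro exI[of _ \<tau>]) (auto simp: bij_betw_def)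
qed

end

section \<open>Hoelder equivalence\<close>

lemma run_smap:
  assumes "inj_on \<tau> A" "a \<in> A" "w \<in> streams A"
  shows "run (\<tau> a) n (smap \<tau> w) \<longleftrightarrow> run a n w"
  using assms(3)
proof (induction n arbitrary: w)
  case (Suc n)
  then show ?case using inj_onD[OF assms(1), of "shd w" a] assms(2) streams_shd[OF Suc.prems] streams_stl[OF Suc.prems] by auto
qed simp

lemma near_smap:
  assumes "inj_on \<tau> A" "al \<in> A" "be \<in> A" "\<And>i j. i \<in> A \<Longrightarrow> j \<in> A \<Longrightarrow> sc i j \<longleftrightarrow> sd (\<tau> i) (\<tau> j)"
    "w \<in> streams A" "w' \<in> streams A"
  shows "near (hcontact sd (\<tau> al) (\<tau> be)) n (smap \<tau> w) (smap \<tau> w') \<longleftrightarrow> near (hcontact sc al be) n w w'"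
  using assms(5,6)
proof (induction n arbitrary: w w')
  case (Suc n)
  have k: "shd w \<in> A" "shd w' \<in> A" "stl w \<in> streams A" "stl w' \<in> streams A"
    using Suc.prems streams_shd streams_stl by auto
  have e: "\<tau> (shd w) = \<tau> (shd w') \<longleftrightarrow> shd w = shd w'" by (rule inj_on_eq_iff[OF assms(1) k(1,2)])
  have ex: "(\<exists>a b. hcontact sc' x y u a v b \<and> P a \<and> R b) \<longleftrightarrow> sc' u v \<and> P y \<and> R x \<or> sc' v u \<and> P x \<and> R y"
    for sc' and x y u v :: 'c and P R by (auto simp: hcontact_def)
  show ?case
    using Suc.IH[OF k(3,4)] e run_smap[OF assms(1)] assms(2-4) k by (simp add: ex)
qed simp

text \<open>Let \<open>n\<close> be the first depth at which \<open>R\<close> fails. Depth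
  \<open>n - 1\<close> bounds the distance under \<open>G'\<close> from above, depth
  \<open>n\<close> bounds the distance under \<open>G\<close> from below, and
  \<open>hi = lo powr s\<close> converts the powers. The factor \<open>lo\<close> in the constant
  pays for the difference of one level.\<close>

lemma coded_holder:
  fixes G :: "'w \<Rightarrow> 'a::metric_space" and G' :: "'w \<Rightarrow> 'b::metric_space"
  assumes R0: "\<And>w w'. R 0 w w'"
    and lo: "0 < lo" and hi: "0 < hi" "hi < 1" and s: "hi = lo powr s" and pos: "0 < c" "0 < C'"
    and up: "\<And>n w w'. w \<in> W \<Longrightarrow> w' \<in> W \<Longrightarrow> R n w w' \<Longrightarrow> dist (G w) (G w') \<le> C * hi ^ n"
    and low: "\<And>n w w'. w \<in> W \<Longrightarrow> w' \<in> W \<Longrightarrow> \<not> R n w w' \<Longrightarrow> c * lo ^ n \<le> dist (G w) (G w')"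
    and up': "\<And>n w w'. w \<in> W \<Longrightarrow> w' \<in> W \<Longrightarrow> R n w w' \<Longrightarrow> dist (G' w) (G' w') \<le> C' * hi ^ n"
    and spos: "0 < s" and w: "w \<in> W" "w' \<in> W"
  shows "dist (G' w) (G' w') \<le> C' / (c * lo) powr s * dist (G w) (G w') powr s"
proof -
  have lim0: "(\<lambda>n. K * hi ^ n) \<longlonglongrightarrow> K * 0" for K
    using hi by (intro tendsto_mult LIMSEQ_realpow_zero tendsto_const) auto
  show ?thesis
  proof (cases "\<forall>n. R n w w'")
    case True
    then have le: "dist (G' w) (G' w') \<le> C' * hi ^ n" for n using up'[OF w] by blast
    have "dist (G' w) (G' w') \<le> C' * 0"
      by (rule LIMSEQ_le_const[OF lim0]) (intro exI[of _ 0] allI impI le)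
    moreover have "0 \<le> C' / (c * lo) powr s * dist (G w) (G w') powr s"
      using pos(2) by (intro mult_nonneg_nonneg divide_nonneg_nonneg) auto
    ultimately show ?thesis by linarith
  next
    case False
    define n where "n = (LEAST n. \<not> R n w w')"
    obtain k where "\<not> R k w w'" using False by blast
    then have n: "\<not> R n w w'" unfolding n_def by (rule LeastI)
    have "n \<noteq> 0" using R0[of w w'] n by (intro notI) simp
    then obtain m where m: "n = Suc m" using not0_implies_Suc by blast
    then have "m < n" by simp
    then have "R m w w'" unfolding n_def using not_less_Least by blast
    then have "dist (G' w) (G' w') \<le> C' * hi ^ m" using up' w by blast
    also have "hi ^ m = (lo ^ m) powr s"
      unfolding s using lo by (simp add: powr_realpow[symmetric] powr_powr mult.commute)
    also have "C' * (lo ^ m) powr s \<le> C' * (dist (G w) (G w') / (c * lo)) powr s"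
    proof (intro mult_left_mono powr_mono2)
      have "c * lo ^ Suc m \<le> dist (G w) (G w')" using low[OF w n] m by simp
      then show "lo ^ m \<le> dist (G w) (G w') / (c * lo)" using pos lo by (simp add: field_simps)
    qed (use lo pos spos in auto)
    also have "\<dots> = C' / (c * lo) powr s * dist (G w) (G w') powr s"
      using lo pos by (simp add: powr_divide)
    finally show ?thesis .
  qed
qed

text \<open>By the two estimates \<open>G\<close> and \<open>G'\<close> identify the same words, so
  \<open>f\<close> is well defined and injective. The lower bound is the second estimate raised to
  the power \<open>1 / s\<close>.\<close>

lemma holder_bijection:
  fixes G :: "'w \<Rightarrow> 'a::metric_space" and G' :: "'w \<Rightarrow> 'b::metric_space"
  assumes s: "0 < s" and K: "0 < K" "0 < K'"
    and le: "\<And>w w'. w \<in> W \<Longrightarrow> w' \<in> W \<Longrightarrow> dist (G' w) (G' w') \<le> K * dist (G w) (G w') powr s"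
    and le': "\<And>w w'. w \<in> W \<Longrightarrow> w' \<in> W \<Longrightarrow> dist (G w) (G w') \<le> K' * dist (G' w) (G' w') powr s"
  shows "\<exists>f. bij_betw f (G ` W) (G' ` W) \<and> (\<exists>C>0. \<forall>x\<in>G ` W. \<forall>y\<in>G ` W.
    inverse C * dist x y powr (1 / s) \<le> dist (f x) (f y) \<and> dist (f x) (f y) \<le> C * dist x y powr s)"
proof -
  have eq: "G w = G w' \<longleftrightarrow> G' w = G' w'" if "w \<in> W" "w' \<in> W" for w w'
    using le[OF that] le'[OF that] by (auto simp: powr_0)
  define f where "f x = G' (SOME w. w \<in> W \<and> G w = x)" for x
  have f: "f (G w) = G' w" if "w \<in> W" for w
  proof -
    have "(SOME w'. w' \<in> W \<and> G w' = G w) \<in> W \<and> G (SOME w'. w' \<in> W \<and> G w' = G w) = G w"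
      by (rule someI[of _ w]) (use that in simp)
    then show ?thesis unfolding f_def using eq that by blast
  qed
  have "bij_betw f (G ` W) (G' ` W)"
    unfolding bij_betw_def
  proof
    show "inj_on f (G ` W)" by (rule inj_onI) (use f eq in auto)
    show "f ` G ` W = G' ` W" using f by (force simp: image_image)
  qed
  moreover define C where "C = max K (K' powr (1 / s))"
  have C: "0 < C" "K \<le> C" "K' powr (1 / s) \<le> C" using K by (auto simp: C_def)
  have "inverse C * dist (G w) (G w') powr (1 / s) \<le> dist (G' w) (G' w') \<and>
      dist (G' w) (G' w') \<le> C * dist (G w) (G w') powr s" if w: "w \<in> W" "w' \<in> W" for w w'
  proof
    have "dist (G w) (G w') powr (1 / s) \<le> (K' * dist (G' w) (G' w') powr s) powr (1 / s)"
      by (rule powr_mono2) (use le'[OF w] s in auto)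
    also have "\<dots> = K' powr (1 / s) * dist (G' w) (G' w')"
      using s K by (simp add: powr_mult powr_powr)
    also have "\<dots> \<le> C * dist (G' w) (G' w')" by (intro mult_right_mono C) simp
    finally show "inverse C * dist (G w) (G w') powr (1 / s) \<le> dist (G' w) (G' w')"
      using C(1) by (simp add: field_simps)
    have "K * dist (G w) (G w') powr s \<le> C * dist (G w) (G w') powr s" by (intro mult_right_mono C) simp
    then show "dist (G' w) (G' w') \<le> C * dist (G w) (G w') powr s" using le[OF w] by linarith
  qed
  then have "\<forall>x\<in>G ` W. \<forall>y\<in>G ` W.
    inverse C * dist x y powr (1 / s) \<le> dist (f x) (f y) \<and> dist (f x) (f y) \<le> C * dist x y powr s"
    by (auto simp: f)
  ultimately show ?thesis using C(1) by blast
qed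

context gasket begin

sublocale succ_order A sc "\<lambda>i. Re (phi i omega_a)"
proof
  show "finite A" by (rule finite_A)
  show "j = k" if "i \<in> A" "j \<in> A" "k \<in> A" "sc i j" "sc i k" for i j k
    using phi_same_corner[of j k omega_a] that by (auto simp: sc_def)
  show "i = j" if "i \<in> A" "j \<in> A" "k \<in> A" "sc i k" "sc j k" for i j k
    using phi_same_corner[of i j omega_b] that by (auto simp: sc_def)
  show "Re (phi i omega_a) < Re (phi j omega_a)" if "i \<in> A" "j \<in> A" "sc i j" for i j
    using arg_cong[OF phi_diff[of i omega_b omega_a], of Re] r_bounds[of i] that by (auto simp: sc_def)
qed

lemma hblock_block: "hblock N r d I \<longleftrightarrow> block I"
proof -
  have "hchain N r d l \<longleftrightarrow> chain l" for l
    unfolding chain_def unfolding hchain_def sc_def A_def by blast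
  then show ?thesis unfolding hblock_def block_def by blast
qed

lemma first_letter:
  assumes "a \<in> A" "phi a omega_a = omega_a" "k \<in> A" shows "\<not> sc k a"
  using phi_corner[OF assms(3) corner_Delta[of omega_b], of omega_a] assms(2) omega_distinct by (auto simp: sc_def)

lemma last_letter:
  assumes "b \<in> A" "phi b omega_b = omega_b" "k \<in> A" shows "\<not> sc b k"
  using phi_corner[OF assms(3) corner_Delta[of omega_a], of omega_b] assms(2) omega_distinct by (auto simp: sc_def)

end

text \<open>Compose with the transposition of \<open>y\<close> and \<open>g x\<close>. The last
  clause describes the one other value that changes, so that sizes of blocks can still be
  checked.\<close>

lemma bij_betw_redirect:
  assumes "bij_betw g X Y" "x \<in> X" "y \<in> Y"
  shows "\<exists>h. bij_betw h X Y \<and> h x = y \<and> (\<forall>z\<in>X. h z = g z \<or> z = x \<or> h z = g x \<and> g z = y)"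
proof -
  let ?h = "Transposition.transpose y (g x) \<circ> g"
  have "g x \<in> Y" using assms bij_betwE by blast
  then have "bij_betw ?h X Y"
    using assms by (intro bij_betw_trans[OF assms(1)] permutes_imp_bij permutes_swap_id) auto
  moreover have "?h x = y" "\<forall>z\<in>X. ?h z = g z \<or> z = x \<or> ?h z = g x \<and> g z = y"
    using assms bij_betw_imp_inj_on[OF assms(1)] by (auto simp: Transposition.transpose_def inj_on_def)
  ultimately show ?thesis by blast
qed

lemma gasket_holder:
  assumes hE: "in_FTab N r d" and hF: "in_FTab M r' d'"
    and blocks: "bij_betw g (hblocks N r d) (hblocks M r' d')" "\<And>I. I \<in> hblocks N r d \<Longrightarrow> card (g I) = card I"
    and abE: "ab_block N r d IE" and abF: "ab_block M r' d' IF" and ab_size: "card IE = card IF"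
    and lo: "0 < lo" "\<And>j. j \<in> {1..N} \<Longrightarrow> lo \<le> r j" "\<And>j. j \<in> {1..M} \<Longrightarrow> lo \<le> r' j"
    and hi: "hi < 1" "\<And>j. j \<in> {1..N} \<Longrightarrow> r j \<le> hi" "\<And>j. j \<in> {1..M} \<Longrightarrow> r' j \<le> hi"
  shows "\<exists>f. bij_betw f (attractor N r d) (attractor M r' d') \<and>
    (\<exists>C>0. \<forall>x\<in>attractor N r d. \<forall>y\<in>attractor N r d.
      inverse C * dist x y powr (1 / (ln hi / ln lo)) \<le> dist (f x) (f y) \<and>
      dist (f x) (f y) \<le> C * dist x y powr (ln hi / ln lo))"
proof -
  obtain al be where ab: "al \<in> {1..N}" "be \<in> {1..N}" "ifs_map r d al omega_a = omega_a" "ifs_map r d be omega_b = omega_b"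
    "al \<in> IE" "be \<in> IE" "hblock N r d IE" using abE unfolding ab_block_def by blast
  obtain al' be' where ab': "al' \<in> {1..M}" "be' \<in> {1..M}" "ifs_map r' d' al' omega_a = omega_a" "ifs_map r' d' be' omega_b = omega_b"
    "al' \<in> IF" "be' \<in> IF" "hblock M r' d' IF" using abF unfolding ab_block_def by blast
  interpret E0: gasket N r d using hE by unfold_locales (simp add: in_FTab_def)
  interpret F0: gasket M r' d' using hF by unfold_locales (simp add: in_FTab_def)
  interpret E: gasket_base N r d al be using ab by unfold_locales (simp_all add: E0.A_def)
  interpret F: gasket_base M r' d' al' be' using ab' by unfold_locales (simp_all add: F0.A_def)
  have IE: "IE \<in> hblocks N r d" and IF: "IF \<in> hblocks M r' d'"
    using ab(7) ab'(7) by (simp_all add: hblocks_def)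
  obtain h where h: "bij_betw h (hblocks N r d) (hblocks M r' d')" "h IE = IF"
      "\<forall>I\<in>hblocks N r d. h I = g I \<or> I = IE \<or> h I = g IE \<and> g I = IF"
    using bij_betw_redirect[OF blocks(1) IE IF] by blast
  have h_card: "card (h I) = card I" if "I \<in> hblocks N r d" for I
  proof -
    have "h I = g I \<or> I = IE \<or> h I = g IE \<and> g I = IF" using h(3) that by blast
    then show ?thesis using h(2) blocks(2)[OF that] blocks(2)[OF IE] ab_size by auto
  qed
  interpret M: block_matching E0.A E0.sc "\<lambda>i. Re (ifs_map r d i omega_a)" F0.A F0.sc "\<lambda>i. Re (ifs_map r' d' i omega_a)" h
    using h(1) h_card by unfold_locales (auto simp: hblocks_def E0.hblock_block F0.hblock_block)
  obtain \<tau> where \<tau>: "bij_betw \<tau> E0.A F0.A" "\<forall>i\<in>E0.A. M.corr i (\<tau> i)" "\<forall>i\<in>E0.A. \<forall>j\<in>E0.A. E0.sc i j \<longleftrightarrow> F0.sc (\<tau> i) (\<tau> j)"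
    using M.letter_bijection by blast
  \<comment> \<open>No cell precedes the one at the left corner, so both letters open their blocks,
    and \<open>h\<close> matches these blocks.\<close>
  have "M.corr al al'"
    by (rule M.corr_first[of IE]) (use ab ab' h(2) E.al F.al E0.first_letter F0.first_letter E0.hblock_block in auto)
  then have al: "\<tau> al = al'" using M.corr_inj \<tau>(2) E.al by blast
  have "M.corr be be'"
    by (rule M.corr_last[of IE]) (use ab ab' h(2) E.be F.be E0.last_letter F0.last_letter E0.hblock_block in auto)
  then have be: "\<tau> be = be'" using M.corr_inj \<tau>(2) E.be by blast
  have lo1: "lo < 1" using lo(2)[OF ab(1)] hi(2)[OF ab(1)] hi(1) by linarith
  have hi0: "0 < hi" using lo(1) lo(2)[OF ab(1)] hi(2)[OF ab(1)] by linarith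
  obtain G where G: "E.coding G lo hi"
    using E.coding_ex[of lo hi] hE lo hi unfolding in_FTab_def E0.A_def by blast
  obtain G' where G': "F.coding G' lo hi"
    using F.coding_ex[of lo hi] hF lo hi unfolding in_FTab_def F0.A_def by blast
  note G_onto = E.codingD(1)[OF G] and G_up = E.codingD(2)[OF G] and G_low = E.codingD(3)[OF G]
  obtain C where C: "0 < C" "\<And>n w w'. w \<in> streams E0.A \<Longrightarrow> w' \<in> streams E0.A \<Longrightarrow> near E.Qh n w w' \<Longrightarrow> dist (G w) (G w') \<le> C * hi ^ n"
    using G_up by metis
  obtain c where c: "0 < c" "\<And>n w w'. w \<in> streams E0.A \<Longrightarrow> w' \<in> streams E0.A \<Longrightarrow> \<not> near E.Qh n w w' \<Longrightarrow> c * lo ^ n \<le> dist (G w) (G w')"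
    using G_low by metis
  note G'_onto = F.codingD(1)[OF G'] and G'_up = F.codingD(2)[OF G'] and G'_low = F.codingD(3)[OF G']
  obtain C' where C': "0 < C'" "\<And>n w w'. w \<in> streams F0.A \<Longrightarrow> w' \<in> streams F0.A \<Longrightarrow> near F.Qh n w w' \<Longrightarrow> dist (G' w) (G' w') \<le> C' * hi ^ n"
    using G'_up by metis
  obtain c' where c': "0 < c'" "\<And>n w w'. w \<in> streams F0.A \<Longrightarrow> w' \<in> streams F0.A \<Longrightarrow> \<not> near F.Qh n w w' \<Longrightarrow> c' * lo ^ n \<le> dist (G' w) (G' w')"
    using G'_low by metis
  define H where "H w = G' (smap \<tau> w)" for w
  have tr: "near F.Qh n (smap \<tau> w) (smap \<tau> w') \<longleftrightarrow> near E.Qh n w w'"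
    if "w \<in> streams E0.A" "w' \<in> streams E0.A" for n w w'
    using near_smap[OF bij_betw_imp_inj_on[OF \<tau>(1)] E.al(1) E.be(1) _ that, of E0.sc F0.sc n] \<tau>(3) al be by simp
  have st: "smap \<tau> w \<in> streams F0.A" if "w \<in> streams E0.A" for w
    using smap_streams[OF that] bij_betwE[OF \<tau>(1)] by blast
  have H_image: "H ` streams E0.A = attractor M r' d'"
  proof -
    have "smap \<tau> ` streams E0.A = streams F0.A"
    proof
      show "smap \<tau> ` streams E0.A \<subseteq> streams F0.A" using st by blast
      show "streams F0.A \<subseteq> smap \<tau> ` streams E0.A"
      proof
        fix v assume v: "v \<in> streams F0.A"
        let ?\<sigma> = "inv_into E0.A \<tau>"
        have "smap ?\<sigma> v \<in> streams E0.A"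
          using smap_streams[OF v] bij_betwE[OF bij_betw_inv_into[OF \<tau>(1)]] by blast
        moreover have "smap \<tau> (smap ?\<sigma> v) = v"
          unfolding smap_alt using snth_in[OF v] bij_betw_inv_into_right[OF \<tau>(1)] by simp
        ultimately show "v \<in> smap \<tau> ` streams E0.A" by (metis imageI)
      qed
    qed
    then show ?thesis using G'_onto unfolding H_def by (metis image_image)
  qed
  define s where "s = ln hi / ln lo"
  have s: "0 < s" "hi = lo powr s"
    using lo(1) lo1 hi0 hi(1) by (auto simp: s_def powr_def divide_neg_neg)
  have upH: "dist (H w) (H w') \<le> C' * hi ^ n"
    if "w \<in> streams E0.A" "w' \<in> streams E0.A" "near E.Qh n w w'" for n w w'
    unfolding H_def by (rule C'(2)) (use st tr that in auto)
  have lowH: "c' * lo ^ n \<le> dist (H w) (H w')"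
    if "w \<in> streams E0.A" "w' \<in> streams E0.A" "\<not> near E.Qh n w w'" for n w w'
    unfolding H_def by (rule c'(2)) (use st tr that in auto)
  have "\<exists>f. bij_betw f (G ` streams E0.A) (H ` streams E0.A) \<and> (\<exists>C>0. \<forall>x\<in>G ` streams E0.A. \<forall>y\<in>G ` streams E0.A.
    inverse C * dist x y powr (1 / s) \<le> dist (f x) (f y) \<and> dist (f x) (f y) \<le> C * dist x y powr s)"
  proof (rule holder_bijection[OF s(1)])
    show "dist (H w) (H w') \<le> C' / (c * lo) powr s * dist (G w) (G w') powr s"
      if "w \<in> streams E0.A" "w' \<in> streams E0.A" for w w'
      by (rule coded_holder[where R = "near E.Qh" and W = "streams E0.A"])
        (use lo hi0 hi s C C' c c' upH that in auto)
    show "dist (G w) (G w') \<le> C / (c' * lo) powr s * dist (H w) (H w') powr s"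
      if "w \<in> streams E0.A" "w' \<in> streams E0.A" for w w'
      by (rule coded_holder[where R = "near E.Qh" and W = "streams E0.A"])
        (use lo hi0 hi s C C' c c' upH lowH that in auto)
  qed (use C(1) C'(1) c(1) c'(1) lo(1) in auto)
  then show ?thesis unfolding H_image G_onto s_def .
qed

theorem theorem1p4:
  fixes N M :: nat and r r' :: "nat \<Rightarrow> real" and d d' :: "nat \<Rightarrow> complex"
    and E F :: "complex set"
  assumes E_def: "E = attractor N r d" and F_def: "F = attractor M r' d'"
    and hE: "in_FTab N r d" and hF: "in_FTab M r' d'"
    and blocks: "\<exists>g. bij_betw g (hblocks N r d) (hblocks M r' d') \<and>
                     (\<forall>I\<in>hblocks N r d. card (g I) = card I)"
    and abE: "ab_block N r d IE" and abF: "ab_block M r' d' IF"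
    and ab_size: "card IE = card IF"
  shows "(\<exists>f. bij_betw f E F \<and> (\<exists>s>0. \<exists>C>0. \<forall>x\<in>E. \<forall>y\<in>E.
            inverse C * dist x y powr (1 / s) \<le> dist (f x) (f y) \<and>
            dist (f x) (f y) \<le> C * dist x y powr s))
       \<and> ((\<exists>\<rho>. (\<forall>j\<in>{1..N}. r j = \<rho>) \<and> (\<forall>j\<in>{1..M}. r' j = \<rho>)) \<longrightarrow>
          (\<exists>f. bij_betw f E F \<and> (\<exists>C>0. \<forall>x\<in>E. \<forall>y\<in>E.
            inverse C * dist x y \<le> dist (f x) (f y) \<and>
            dist (f x) (f y) \<le> C * dist x y)))"
proof -
  obtain g where g: "bij_betw g (hblocks N r d) (hblocks M r' d')" "\<And>I. I \<in> hblocks N r d \<Longrightarrow> card (g I) = card I"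
    using blocks by blast
  note holder = gasket_holder[OF hE hF g abE abF ab_size]
  have N: "1 \<in> {1..N}" and rE: "\<And>j. j \<in> {1..N} \<Longrightarrow> 0 < r j \<and> r j < 1" and rF: "\<And>j. j \<in> {1..M} \<Longrightarrow> 0 < r' j \<and> r' j < 1"
    using hE hF unfolding in_FTab_def fractal_gasket_def by auto
  show ?thesis
  proof (intro conjI impI)
    \<comment> \<open>The extreme ratios of both systems together, so that one pair of bases serves
      both gaskets.\<close>
    let ?X = "r ` {1..N} \<union> r' ` {1..M}"
    have X: "finite ?X" "?X \<noteq> {}" using N by auto
    have "0 < x \<and> x < 1" if "x \<in> ?X" for x using that rE rF by blast
    from this[OF Min_in[OF X]] this[OF Max_in[OF X]]
    have b: "0 < Min ?X" "Min ?X < 1" "0 < Max ?X" "Max ?X < 1" by simp_all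
    have "0 < ln (Max ?X) / ln (Min ?X)" using b by (simp add: divide_neg_neg)
    moreover have "\<exists>f. bij_betw f E F \<and> (\<exists>C>0. \<forall>x\<in>E. \<forall>y\<in>E.
        inverse C * dist x y powr (1 / (ln (Max ?X) / ln (Min ?X))) \<le> dist (f x) (f y) \<and>
        dist (f x) (f y) \<le> C * dist x y powr (ln (Max ?X) / ln (Min ?X)))"
      unfolding E_def F_def by (rule holder) (use b X in auto)
    ultimately show "\<exists>f. bij_betw f E F \<and> (\<exists>s>0. \<exists>C>0. \<forall>x\<in>E. \<forall>y\<in>E.
            inverse C * dist x y powr (1 / s) \<le> dist (f x) (f y) \<and>
            dist (f x) (f y) \<le> C * dist x y powr s)" by blast
  next
    assume "\<exists>\<rho>. (\<forall>j\<in>{1..N}. r j = \<rho>) \<and> (\<forall>j\<in>{1..M}. r' j = \<rho>)"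
    then obtain \<rho> where \<rho>: "\<forall>j\<in>{1..N}. r j = \<rho>" "\<forall>j\<in>{1..M}. r' j = \<rho>" by blast
    then have b: "0 < \<rho>" "\<rho> < 1" using rE[OF N] N by auto
    \<comment> \<open>Both bases equal the common ratio, and the exponent becomes 1.\<close>
    then have "ln \<rho> / ln \<rho> = 1" by simp
    moreover have "\<exists>f. bij_betw f E F \<and> (\<exists>C>0. \<forall>x\<in>E. \<forall>y\<in>E.
        inverse C * dist x y powr (1 / (ln \<rho> / ln \<rho>)) \<le> dist (f x) (f y) \<and>
        dist (f x) (f y) \<le> C * dist x y powr (ln \<rho> / ln \<rho>))"
      unfolding E_def F_def by (rule holder) (use b \<rho> in auto)
    ultimately show "\<exists>f. bij_betw f E F \<and> (\<exists>C>0. \<forall>x\<in>E. \<forall>y\<in>E.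
            inverse C * dist x y \<le> dist (f x) (f y) \<and> dist (f x) (f y) \<le> C * dist x y)" by simp
  qed
qed

end
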